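(* Let $X$, $U$, $I=[0,b]$, $A(t)=A+\widetilde B(t)$, $S_0$, $S$, $C$, $B$, $F$ be as in the context, and let $x_0,y_0,x_b\in X$. Assume: (1) $aR(a,\Upsilon_0^b)\to 0$ as $a\to 0^+$ in the strong operator topology; (2) $S_0(t)$ is compact for every $t>0$; (3) for each $r>0$ there exists $L_{f,r}\in L^1(I,\mathbb{R}^+)$ such that for every $x\in\mathcal{C}$ with $\|x\|_{\mathcal{C}}\le r$ one has $\sup\{\|f\|: f\in F(t,x(t))\}\le L_{f,r}(t)$ for a.e. $t\in I$; (4) there exists $\gamma>0$ such that $\lim_{r\to\infty}\frac{1}{r}\int_0^b L_{f,r}(s)\,ds=\gamma<+\infty$. Let $a>0$ and assume also that $$\widetilde N\gamma\Big[1+\frac1a\widetilde N^2M_B^2\,b\Big]<1,\qquad M_B=\|B\|.$$ Then the system $$x''(t)\in A(t)x(t)+F(t,x(t))+Bu(t),\ t\in I,\qquad x(0)=x_0,\quad x'(0)=y_0,$$ with the control $u(t)=u(t,x)$ associated with $a$ and $x_b$ as defined in the context, has a mild solution on $I$; that is, there exist $x\in\mathcal{C}$ and $f\in S_{F,x}$ such that for all $t\in I$ $$x(t)=C(t,0)x_0+S(t,0)y_0+\int_0^tS(t,s)f(s)\,ds+\int_0^tS(t,s)Bu(s,x)\,ds,$$ where $u(t,x)=B^*S^*(b,t)R(a,\Upsilon_0^b)\Big[x_b-C(b,0)x_0-S(b,0)y_0-\int_0^bS(b,s)f(s)\,ds\Big]$.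
   Context: $X$ and $U$ are Hilbert spaces, $b>0$, $I=[0,b]$, $\mathcal{C}=C(I,X)$ with the sup norm $\|x\|_{\mathcal{C}}=\sup_{t\in I}\|x(t)\|$; $\mathcal{L}(Y,Z)$ denotes bounded linear operators, $\mathcal{L}(X)=\mathcal{L}(X,X)$. $B\in\mathcal{L}(U,X)$; controls $u$ belong to $L^2(I,U)$. Operators. $A:D(A)\subseteq X\to X$ generates a strongly continuous cosine family $(C_0(t))_{t\in\mathbb{R}}$ on $X$, with sine family $S_0(t)x=\int_0^tC_0(s)x\,ds$. $E$ is the space of $x\in X$ for which $t\mapsto C_0(t)x$ is of class $C^1$ on $\mathbb{R}$, with norm $\|x\|_E=\|x\|+\sup_{0\le t\le1}\|AS_0(t)x\|$. $A(t)=A+\widetilde B(t)$, where $\widetilde B:\mathbb{R}\to\mathcal{L}(E,X)$ is such that $t\mapsto\widetilde B(t)x$ is continuously differentiable in $X$ for each $x\in E$; $D=D(A(t))=D(A)$ is dense and independent of $t$, and $A(t)$ is closed. $S(t,s)\in\mathcal{L}(X)$, $t,s\in I$, is the associated evolution operator: for $y\in E$, $t\mapsto S(t,s)y$ is the unique solution of $x(t)=S_0(t-s)y+\int_s^tS_0(t-\tau)\widetilde B(\tau)x(\tau)\,d\tau$, and $S(t,s)$ is extended to $X$ by density. It is an evolution operator for $x''=A(t)x$ in the following sense: (Z1) for each $x\in X$, $(t,s)\mapsto S(t,s)x$ is of class $C^1$ on $I\times I$, $S(t,t)=0$, $\frac{\partial}{\partial t}S(t,s)x|_{t=s}=x$,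 $\frac{\partial}{\partial s}S(t,s)x|_{t=s}=-x$; (Z2) if $x\in D$ then $S(t,s)x\in D$, $(t,s)\mapsto S(t,s)x$ is of class $C^2$, $\frac{\partial^2}{\partial t^2}S(t,s)x=A(t)S(t,s)x$, $\frac{\partial^2}{\partial s^2}S(t,s)x=S(t,s)A(s)x$, $\frac{\partial}{\partial s}\frac{\partial}{\partial t}S(t,s)x|_{t=s}=0$; (Z3) if $x\in D$ then $\frac{\partial}{\partial s}S(t,s)x\in D$, the following derivatives exist, $\frac{\partial^2}{\partial t^2}\frac{\partial}{\partial s}S(t,s)x=A(t)\frac{\partial}{\partial s}S(t,s)x$, $\frac{\partial^2}{\partial s^2}\frac{\partial}{\partial t}S(t,s)x=\frac{\partial}{\partial t}S(t,s)A(s)x$, and $(t,s)\mapsto A(t)\frac{\partial}{\partial s}S(t,s)x$ is continuous. Put $C(t,s)=-\frac{\partial S(t,s)}{\partial s}$. $\widetilde N>0$ is a constant with $\sup_{t,s\in I}\|S(t,s)\|\le\widetilde N$. Multivalued map. $F:I\times X\to 2^X\setminus\{\emptyset\}$ has bounded, closed, convex values, is measurable in $t$ for each fixed $x\in X$, upper semicontinuous in $x$ for each $t\in I$, and for each $x\in\mathcal{C}$ the set $S_{F,x}=\{f\in L^1(I,X): f(t)\in F(t,x(t))\text{ for } t\in I\}$ is nonempty. (A map $G$ is upper semicontinuous if each $G(x_0)$ is nonempty closed and for each open $V\supseteq G(x_0)$ there is a neighbourhood $W$ of $x_0$ with $G(W)\subseteq V$.) Control. $\Upsilon_0^b=\int_0^bS(b,s)BB^*S^*(b,s)\,ds\in\mathcal{L}(X)$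 and $R(a,\Upsilon_0^b)=(aI+\Upsilon_0^b)^{-1}$ for $a>0$, where here $I$ is the identity operator and $S^*(b,s)$ is the adjoint of $S(b,s)$. For $a>0$, $x_b\in X$, $x\in\mathcal{C}$, $f\in S_{F,x}$, the associated control is $u(t,x)=B^*S^*(b,t)R(a,\Upsilon_0^b)p(x(\cdot))$ with $p(x(\cdot))=x_b-C(b,0)x_0-S(b,0)y_0-\int_0^bS(b,s)f(s)\,ds$. Mild solution. For given $u$, $x\in\mathcal{C}$ is a mild solution if there is $f\in S_{F,x}$ with $x(t)=C(t,0)x_0+S(t,0)y_0+\int_0^tS(t,s)f(s)\,ds+\int_0^tS(t,s)Bu(s)\,ds$ for $t\in I$ (the initial conditions $x(0)=x_0$, $x'(0)=y_0$ being imposed through this equation). *)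

theory Defs
  imports "HOL-Analysis.Analysis"
begin

section \<open>Integration of vector-valued functions\<close>

text \<open>
  The Bochner integral of the library requires a second countable codomain. Separability of
  the Hilbert spaces is not assumed here, so Bochner integrability is spelled out (strong
  measurability and an integrable norm), while integrals themselves are the library's
  Henstock-Kurzweil integrals \<open>integral S f\<close>; on Bochner integrable functions
  these agree with the Bochner integral.
\<close>

definition strongly_measurable_on :: "real set \<Rightarrow> (real \<Rightarrow> 'a::real_normed_vector) \<Rightarrow> bool" where
  "strongly_measurable_on J f \<longleftrightarrow>
     (\<exists>\<phi> :: nat \<Rightarrow> real \<Rightarrow> 'a. (\<forall>n. simple_function (lebesgue_on J) (\<phi> n)) \<and>
        (AE t in lebesgue_on J. (\<lambda>n. \<phi> n t) \<longlonglongrightarrow> f t))"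

definition L1_on :: "real set \<Rightarrow> (real \<Rightarrow> 'a::real_normed_vector) set" where
  "L1_on J = {f. strongly_measurable_on J f \<and> integrable (lebesgue_on J) (\<lambda>t. norm (f t))}"

definition oriented_integral :: "real \<Rightarrow> real \<Rightarrow> (real \<Rightarrow> 'a::real_normed_vector) \<Rightarrow> 'a" where
  "oriented_integral s t f = (if s \<le> t then integral {s..t} f else - integral {t..s} f)"


section \<open>Operators\<close>

text \<open>\<^const>\<open>adjoint\<close> is the library's Hilbert space adjoint; here it is viewed
  as a bounded operator.\<close>

definition adj :: "('a::{real_inner,complete_space} \<Rightarrow>\<^sub>L 'b::{real_inner,complete_space}) \<Rightarrow> 'b \<Rightarrow>\<^sub>L 'a" where
  "adj T = Blinfun (adjoint (blinfun_apply T))"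

definition op_inverse :: "('a::real_normed_vector \<Rightarrow>\<^sub>L 'b::real_normed_vector) \<Rightarrow> 'b \<Rightarrow>\<^sub>L 'a" where
  "op_inverse T = (THE R. R o\<^sub>L T = id_blinfun \<and> T o\<^sub>L R = id_blinfun)"

definition compact_op :: "('a::real_normed_vector \<Rightarrow> 'b::real_normed_vector) \<Rightarrow> bool" where
  "compact_op T \<longleftrightarrow> bounded_linear T \<and> (\<forall>M. bounded M \<longrightarrow> compact (closure (T ` M)))"


section \<open>Cosine families\<close>

definition cosine_family :: "(real \<Rightarrow> 'a::real_normed_vector \<Rightarrow>\<^sub>L 'a) \<Rightarrow> bool" where
  "cosine_family C0 \<longleftrightarrow>
     C0 0 = id_blinfun \<and>
     (\<forall>t s. C0 (t + s) + C0 (t - s) = 2 *\<^sub>R (C0 t o\<^sub>L C0 s)) \<and>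
     (\<forall>x. continuous_on UNIV (\<lambda>t. C0 t x))"

definition sine_family :: "(real \<Rightarrow> 'a::real_normed_vector \<Rightarrow>\<^sub>L 'a) \<Rightarrow> real \<Rightarrow> 'a \<Rightarrow> 'a" where
  "sine_family C0 t x = oriented_integral 0 t (\<lambda>s. C0 s x)"

text \<open>An unbounded operator is a pair of its domain \<open>D\<close> and a total function whose
  values off \<open>D\<close> are irrelevant.\<close>

definition generates_cosine_family ::
  "'a set \<Rightarrow> ('a \<Rightarrow> 'a) \<Rightarrow> (real \<Rightarrow> 'a::real_normed_vector \<Rightarrow>\<^sub>L 'a) \<Rightarrow> bool" where
  "generates_cosine_family D A C0 \<longleftrightarrow>
     cosine_family C0 \<and>
     D = {x. (\<lambda>t. C0 t x) C1_differentiable_on UNIV \<and>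
             (\<lambda>t. vector_derivative (\<lambda>r. C0 r x) (at t)) C1_differentiable_on UNIV} \<and>
     (\<forall>x\<in>D. A x = vector_derivative (\<lambda>t. vector_derivative (\<lambda>r. C0 r x) (at t)) (at 0))"

definition E_space :: "(real \<Rightarrow> 'a::real_normed_vector \<Rightarrow>\<^sub>L 'a) \<Rightarrow> 'a set" where
  "E_space C0 = {x. (\<lambda>t. C0 t x) C1_differentiable_on UNIV}"

definition E_norm :: "('a \<Rightarrow> 'a) \<Rightarrow> (real \<Rightarrow> 'a::real_normed_vector \<Rightarrow>\<^sub>L 'a) \<Rightarrow> 'a \<Rightarrow> real" where
  "E_norm A C0 x = norm x + (SUP t\<in>{0..1}. norm (A (sine_family C0 t x)))"


section \<open>The perturbed operator and its evolution operator\<close>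

text \<open>\<open>Bt t\<close> is an element of \<open>L(E,X)\<close>; only its values on \<open>E\<close> matter.\<close>

definition admissible_perturbation ::
  "('a \<Rightarrow> 'a) \<Rightarrow> (real \<Rightarrow> 'a::real_normed_vector \<Rightarrow>\<^sub>L 'a) \<Rightarrow> (real \<Rightarrow> 'a \<Rightarrow> 'a) \<Rightarrow> bool" where
  "admissible_perturbation A C0 Bt \<longleftrightarrow>
     (\<forall>t. (\<forall>x\<in>E_space C0. \<forall>y\<in>E_space C0. Bt t (x + y) = Bt t x + Bt t y) \<and>
          (\<forall>c. \<forall>x\<in>E_space C0. Bt t (c *\<^sub>R x) = c *\<^sub>R Bt t x) \<and>
          (\<exists>K. \<forall>x\<in>E_space C0. norm (Bt t x) \<le> K * E_norm A C0 x)) \<and>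
     (\<forall>x\<in>E_space C0. (\<lambda>t. Bt t x) C1_differentiable_on UNIV)"

definition closed_operator :: "'a set \<Rightarrow> ('a::real_normed_vector \<Rightarrow> 'a) \<Rightarrow> bool" where
  "closed_operator D A \<longleftrightarrow> closed {(x, A x) | x. x \<in> D}"

text \<open>Solutions of the Volterra equation on \<open>[0,b]\<close> in the class \<open>C([0,b], E)\<close>, the
  integrand involving \<open>Bt \<tau>\<close> being defined only on \<open>E\<close>.\<close>

definition volterra_solution ::
  "real \<Rightarrow> ('a \<Rightarrow> 'a) \<Rightarrow> (real \<Rightarrow> 'a::real_normed_vector \<Rightarrow>\<^sub>L 'a) \<Rightarrow> (real \<Rightarrow> 'a \<Rightarrow> 'a)
     \<Rightarrow> real \<Rightarrow> 'a \<Rightarrow> (real \<Rightarrow> 'a) \<Rightarrow> bool" where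
  "volterra_solution b A C0 Bt s y z \<longleftrightarrow>
     (\<forall>t\<in>{0..b}. z t \<in> E_space C0) \<and>
     (\<forall>t\<in>{0..b}. ((\<lambda>r. E_norm A C0 (z r - z t)) \<longlongrightarrow> 0) (at t within {0..b})) \<and>
     (\<forall>t\<in>{0..b}. z t = sine_family C0 (t - s) y +
        oriented_integral s t (\<lambda>\<tau>. sine_family C0 (t - \<tau>) (Bt \<tau> (z \<tau>))))"

text \<open>Since \<open>E\<close> is dense, the values \<open>S t s y\<close> for \<open>y \<in> E\<close> determine the bounded
  operator \<open>S t s\<close>.\<close>

definition associated_evolution_operator ::
  "real \<Rightarrow> ('a \<Rightarrow> 'a) \<Rightarrow> (real \<Rightarrow> 'a::real_normed_vector \<Rightarrow>\<^sub>L 'a) \<Rightarrow> (real \<Rightarrow> 'a \<Rightarrow> 'a)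
     \<Rightarrow> (real \<Rightarrow> real \<Rightarrow> 'a \<Rightarrow>\<^sub>L 'a) \<Rightarrow> bool" where
  "associated_evolution_operator b A C0 Bt S \<longleftrightarrow>
     (\<forall>s\<in>{0..b}. \<forall>y\<in>E_space C0.
        volterra_solution b A C0 Bt s y (\<lambda>t. S t s y) \<and>
        (\<forall>z. volterra_solution b A C0 Bt s y z \<longrightarrow> (\<forall>t\<in>{0..b}. z t = S t s y)))"

text \<open>Partial derivatives on the square \<open>[0,b] \<times> [0,b]\<close> in the first (\<open>t\<close>) and the second
  (\<open>s\<close>) variable, one-sided on the boundary.\<close>

definition D_fst :: "real \<Rightarrow> (real \<Rightarrow> real \<Rightarrow> 'a::real_normed_vector) \<Rightarrow> real \<Rightarrow> real \<Rightarrow> 'a" where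
  "D_fst b g t s = vector_derivative (\<lambda>r. g r s) (at t within {0..b})"

definition D_snd :: "real \<Rightarrow> (real \<Rightarrow> real \<Rightarrow> 'a::real_normed_vector) \<Rightarrow> real \<Rightarrow> real \<Rightarrow> 'a" where
  "D_snd b g t s = vector_derivative (\<lambda>r. g t r) (at s within {0..b})"

definition C1_square :: "real \<Rightarrow> (real \<Rightarrow> real \<Rightarrow> 'a::real_normed_vector) \<Rightarrow> bool" where
  "C1_square b g \<longleftrightarrow>
     (\<forall>t\<in>{0..b}. \<forall>s\<in>{0..b}.
        (\<lambda>r. g r s) differentiable (at t within {0..b}) \<and>
        (\<lambda>r. g t r) differentiable (at s within {0..b})) \<and>
     continuous_on ({0..b} \<times> {0..b}) (\<lambda>(t, s). D_fst b g t s) \<and>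
     continuous_on ({0..b} \<times> {0..b}) (\<lambda>(t, s). D_snd b g t s)"

definition C2_square :: "real \<Rightarrow> (real \<Rightarrow> real \<Rightarrow> 'a::real_normed_vector) \<Rightarrow> bool" where
  "C2_square b g \<longleftrightarrow> C1_square b g \<and> C1_square b (D_fst b g) \<and> C1_square b (D_snd b g)"

definition evolution_Z1 :: "real \<Rightarrow> (real \<Rightarrow> real \<Rightarrow> 'a::real_normed_vector \<Rightarrow>\<^sub>L 'a) \<Rightarrow> bool" where
  "evolution_Z1 b S \<longleftrightarrow>
     (\<forall>x. C1_square b (\<lambda>t s. S t s x) \<and>
          (\<forall>t\<in>{0..b}. S t t x = 0 \<and>
             D_fst b (\<lambda>t s. S t s x) t t = x \<and>
             D_snd b (\<lambda>t s. S t s x) t t = - x))"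

definition evolution_Z2 ::
  "real \<Rightarrow> 'a set \<Rightarrow> (real \<Rightarrow> 'a \<Rightarrow> 'a) \<Rightarrow> (real \<Rightarrow> real \<Rightarrow> 'a::real_normed_vector \<Rightarrow>\<^sub>L 'a) \<Rightarrow> bool" where
  "evolution_Z2 b D A S \<longleftrightarrow>
     (\<forall>x\<in>D. C2_square b (\<lambda>t s. S t s x) \<and>
        (\<forall>t\<in>{0..b}. \<forall>s\<in>{0..b}.
           S t s x \<in> D \<and>
           D_fst b (D_fst b (\<lambda>t s. S t s x)) t s = A t (S t s x) \<and>
           D_snd b (D_snd b (\<lambda>t s. S t s x)) t s = S t s (A s x)) \<and>
        (\<forall>t\<in>{0..b}. D_snd b (D_fst b (\<lambda>t s. S t s x)) t t = 0))"

text \<open>The first and second order derivatives occurring below exist by the previous condition;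
  \<open>has_vector_derivative\<close> asserts the existence of the third order ones.\<close>

definition evolution_Z3 ::
  "real \<Rightarrow> 'a set \<Rightarrow> (real \<Rightarrow> 'a \<Rightarrow> 'a) \<Rightarrow> (real \<Rightarrow> real \<Rightarrow> 'a::real_normed_vector \<Rightarrow>\<^sub>L 'a) \<Rightarrow> bool" where
  "evolution_Z3 b D A S \<longleftrightarrow>
     (\<forall>x\<in>D.
        (\<forall>t\<in>{0..b}. \<forall>s\<in>{0..b}.
           D_snd b (\<lambda>t s. S t s x) t s \<in> D \<and>
           ((\<lambda>r. D_fst b (D_snd b (\<lambda>t s. S t s x)) r s) has_vector_derivative
              A t (D_snd b (\<lambda>t s. S t s x) t s)) (at t within {0..b}) \<and>
           ((\<lambda>r. D_snd b (D_fst b (\<lambda>t s. S t s x)) t r) has_vector_derivative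
              D_fst b (\<lambda>r q. S r q (A s x)) t s) (at s within {0..b})) \<and>
        continuous_on ({0..b} \<times> {0..b}) (\<lambda>(t, s). A t (D_snd b (\<lambda>t s. S t s x) t s)))"

definition evolution_C ::
  "real \<Rightarrow> (real \<Rightarrow> real \<Rightarrow> 'a::real_normed_vector \<Rightarrow>\<^sub>L 'a) \<Rightarrow> real \<Rightarrow> real \<Rightarrow> 'a \<Rightarrow> 'a" where
  "evolution_C b S t s x = - D_snd b (\<lambda>t s. S t s x) t s"

definition second_order_evolution_system ::
  "real \<Rightarrow> 'a set \<Rightarrow> ('a \<Rightarrow> 'a) \<Rightarrow> (real \<Rightarrow> 'a::real_normed_vector \<Rightarrow>\<^sub>L 'a) \<Rightarrow> (real \<Rightarrow> 'a \<Rightarrow> 'a)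
     \<Rightarrow> (real \<Rightarrow> real \<Rightarrow> 'a \<Rightarrow>\<^sub>L 'a) \<Rightarrow> bool" where
  "second_order_evolution_system b D A C0 Bt S \<longleftrightarrow>
     generates_cosine_family D A C0 \<and>
     admissible_perturbation A C0 Bt \<and>
     closure D = UNIV \<and>
     (\<forall>t. closed_operator D (\<lambda>x. A x + Bt t x)) \<and>
     associated_evolution_operator b A C0 Bt S \<and>
     evolution_Z1 b S \<and>
     evolution_Z2 b D (\<lambda>t x. A x + Bt t x) S \<and>
     evolution_Z3 b D (\<lambda>t x. A x + Bt t x) S"


section \<open>The multivalued map\<close>

definition upper_semicontinuous :: "('a::topological_space \<Rightarrow> 'b::topological_space set) \<Rightarrow> bool" where
  "upper_semicontinuous G \<longleftrightarrow>
     (\<forall>x0. G x0 \<noteq> {} \<and> closed (G x0) \<and>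
        (\<forall>V. open V \<and> G x0 \<subseteq> V \<longrightarrow> (\<exists>W. open W \<and> x0 \<in> W \<and> (\<forall>x\<in>W. G x \<subseteq> V))))"

definition measurable_multimap_on :: "real set \<Rightarrow> (real \<Rightarrow> 'a::topological_space set) \<Rightarrow> bool" where
  "measurable_multimap_on J G \<longleftrightarrow>
     (\<forall>V. open V \<longrightarrow> {t \<in> J. G t \<inter> V \<noteq> {}} \<in> sets (lebesgue_on J))"

definition selections :: "real \<Rightarrow> (real \<Rightarrow> 'a::real_normed_vector \<Rightarrow> 'a set) \<Rightarrow> (real \<Rightarrow> 'a) \<Rightarrow> (real \<Rightarrow> 'a) set" where
  "selections b F x = {f \<in> L1_on {0..b}. \<forall>t\<in>{0..b}. f t \<in> F t (x t)}"

definition admissible_multimap :: "real \<Rightarrow> (real \<Rightarrow> 'a::real_normed_vector \<Rightarrow> 'a set) \<Rightarrow> bool" where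
  "admissible_multimap b F \<longleftrightarrow>
     (\<forall>t\<in>{0..b}. \<forall>x. F t x \<noteq> {} \<and> bounded (F t x) \<and> closed (F t x) \<and> convex (F t x)) \<and>
     (\<forall>x. measurable_multimap_on {0..b} (\<lambda>t. F t x)) \<and>
     (\<forall>t\<in>{0..b}. upper_semicontinuous (F t)) \<and>
     (\<forall>x. continuous_on {0..b} x \<longrightarrow> selections b F x \<noteq> {})"


section \<open>The control\<close>

definition gramian ::
  "real \<Rightarrow> (real \<Rightarrow> real \<Rightarrow> 'a::{real_inner,complete_space} \<Rightarrow>\<^sub>L 'a)
     \<Rightarrow> ('u::{real_inner,complete_space} \<Rightarrow>\<^sub>L 'a) \<Rightarrow> 'a \<Rightarrow>\<^sub>L 'a" where
  "gramian b S B = integral {0..b} (\<lambda>s. S b s o\<^sub>L B o\<^sub>L adj B o\<^sub>L adj (S b s))"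

definition resolvent_op :: "real \<Rightarrow> ('a::real_normed_vector \<Rightarrow>\<^sub>L 'a) \<Rightarrow> 'a \<Rightarrow>\<^sub>L 'a" where
  "resolvent_op a Y = op_inverse (a *\<^sub>R id_blinfun + Y)"

definition steering_control ::
  "real \<Rightarrow> (real \<Rightarrow> real \<Rightarrow> 'a::{real_inner,complete_space} \<Rightarrow>\<^sub>L 'a)
     \<Rightarrow> ('u::{real_inner,complete_space} \<Rightarrow>\<^sub>L 'a) \<Rightarrow> 'a \<Rightarrow> 'a \<Rightarrow> 'a \<Rightarrow> real \<Rightarrow> (real \<Rightarrow> 'a) \<Rightarrow> real \<Rightarrow> 'u" where
  "steering_control b S B x0 y0 xb a f t =
     adj B (adj (S b t) (resolvent_op a (gramian b S B)
       (xb - evolution_C b S b 0 x0 - S b 0 y0 - integral {0..b} (\<lambda>s. S b s (f s)))))"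

end

theory Submission
  imports Defs
begin

text \<open>
  A mild solution is a fixed point: with \<open>\<Phi> f\<close> the trajectory produced by a source term \<open>f\<close> together with
  the control that belongs to \<open>f\<close>, an integrable \<open>f\<close> is sought with \<open>f t \<in> F t (\<Phi> f t)\<close>. The map \<open>\<Phi>\<close> is
  affine, and since the regularized resolvent satisfies \<open>norm (R w) \<le> norm w / a\<close>, the trajectory is
  bounded by a constant plus \<open>N * (1 + N\<^sup>2 * norm B\<^sup>2 * b / a)\<close> times the \<open>L\<^sup>1\<close> norm of \<open>f\<close>. By the
  smallness condition, for some large \<open>r\<close> the sources dominated by \<open>L r\<close> produce trajectories in the ball
  of radius \<open>r\<close>, and selections along such trajectories are dominated by \<open>L r\<close> again.

  These trajectories form a totally bounded set. The Volterra equation and Gronwall's inequality bound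
  \<open>S(t,s)\<close> from \<open>X\<close> into \<open>E\<close> (\<open>evolution_bounded_into_E\<close>), which requires a uniform bound for the perturbation
  and hence completeness of \<open>E\<close> and the uniform boundedness principle. On \<open>E\<close> the identity is the limit
  in norm of the compact operators \<open>h\<^sup>-\<^sup>1 S\<^sub>0(h)\<close>, so all values of the trajectories are
  uniformly approximated by these operators (\<open>evolution_approximation\<close>). By (Z1) and uniform boundedness again,
  \<open>S\<close> is Lipschitz continuous in the operator norm, and \<open>S(t,t) = 0\<close> makes the trajectories equi-Lipschitz
  even though the sources are only integrable (\<open>duhamel_Lipschitz\<close>).

  On a totally bounded convex set, an arbitrary selection has points that are convex combinations of
  values of the selection at nearby points (\<open>convexified_approximate_fixed_point\<close>, which rests on Kuhn's lemma).
  This gives sources \<open>f\<^sub>n\<close> that are convex combinations of selections along trajectories close to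
  \<open>\<Phi> f\<^sub>n\<close>. Along a subsequence the trajectories \<open>\<Phi> f\<^sub>n\<close> converge uniformly. The sources need not
  converge, but some convex combinations of their tails converge almost everywhere
  (\<open>forward_convex_combinations_converge\<close>). As \<open>\<Phi>\<close> is affine and continuous on \<open>L\<^sup>1\<close>, the limit \<open>f\<close> has the
  limit trajectory, and upper semicontinuity together with the closed convex values of \<open>F\<close> gives
  \<open>f t \<in> F t (\<Phi> f t)\<close> almost everywhere (\<open>integral_inclusion_solvable\<close>).
\<close>

section \<open>Hilbert space operators\<close>

lemma norm_diff_square: "(norm (x - y))\<^sup>2 = (norm x)\<^sup>2 - 2 * (x \<bullet> y) + (norm y)\<^sup>2"
  by (simp add: power2_norm_eq_inner inner_diff_left inner_diff_right inner_commute)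

text \<open>Any minimizing sequence of \<open>z \<mapsto> norm z ^ 2 / 2 - \<phi> z\<close> is Cauchy by the
  parallelogram law; its limit is the representing vector because the derivative of the
  functional vanishes there.\<close>

lemma riesz_representation:
  fixes \<phi> :: "'a::{real_inner,complete_space} \<Rightarrow> real"
  assumes "bounded_linear \<phi>"
  shows "\<exists>z. \<forall>x. \<phi> x = x \<bullet> z"
proof -
  interpret bounded_linear \<phi> by fact
  define J where "J z = (norm z)\<^sup>2 / 2 - \<phi> z" for z
  obtain K where K: "\<And>x. norm (\<phi> x) \<le> norm x * K" "K > 0"
    using pos_bounded by blast
  have lb: "J z \<ge> - (K\<^sup>2 / 2)" for z
  proof -
    have "\<phi> z \<le> norm z * K" using K(1)[of z] by simp
    moreover have "0 \<le> (norm z - K)\<^sup>2" by simp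
    then have "norm z * K \<le> (norm z)\<^sup>2 / 2 + K\<^sup>2 / 2"
      by (simp add: power2_eq_square algebra_simps)
    ultimately show ?thesis by (simp add: J_def)
  qed
  define m where "m = (INF z. J z)"
  have bdd: "bdd_below (range J)" using lb by (auto intro!: bdd_belowI)
  have m_le: "m \<le> J z" for z unfolding m_def by (rule cINF_lower[OF bdd]) simp
  have "\<exists>z. J z < m + 1 / real (Suc n)" for n
  proof -
    have "m < m + 1 / real (Suc n)" by simp
    then show ?thesis unfolding m_def by (subst (asm) cINF_less_iff[OF _ bdd]) auto
  qed
  then obtain w where w: "\<And>n. J (w n) < m + 1 / real (Suc n)" by metis
  have par: "(norm (x - y))\<^sup>2 = 4 * J x + 4 * J y - 8 * J ((1/2) *\<^sub>R (x + y))" for x y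
  proof -
    have "(norm ((1/2) *\<^sub>R (x + y)))\<^sup>2 = (norm (x + y))\<^sup>2 / 4"
      by (simp add: power_divide)
    then show ?thesis
      unfolding J_def by (simp add: scaleR add power2_norm_eq_inner algebra_simps inner_commute)
  qed
  have dist_w: "(norm (w i - w j))\<^sup>2 < 4 / real (Suc i) + 4 / real (Suc j)" for i j
  proof -
    have "4 * J (w k) < 4 * m + 4 / real (Suc k)" for k
      using mult_strict_left_mono[OF w[of k], of 4] by (simp add: algebra_simps)
    from this[of i] this[of j] show ?thesis
      unfolding par using m_le[of "(1/2) *\<^sub>R (w i + w j)"] by linarith
  qed
  have "Cauchy w"
  proof (rule metric_CauchyI)
    fix e :: real assume e: "e > 0"
    obtain M :: nat where M: "real M > 8 / e\<^sup>2" using reals_Archimedean2 by blast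
    show "\<exists>M. \<forall>m\<ge>M. \<forall>n\<ge>M. dist (w m) (w n) < e"
    proof (intro exI allI impI)
      fix i j assume ij: "M \<le> i" "M \<le> j"
      have pos: "real M > 0" using M e by (meson divide_pos_pos less_trans zero_less_numeral zero_less_power)
      have "4 / real (Suc i) \<le> 4 / real M" "4 / real (Suc j) \<le> 4 / real M"
        using ij pos by (auto intro!: divide_left_mono mult_pos_pos)
      then have "(norm (w i - w j))\<^sup>2 < 8 / real M" using dist_w[of i j] by simp
      also have "\<dots> < e\<^sup>2" using M pos e by (simp add: field_simps)
      finally have "norm (w i - w j) < e" using e power2_less_imp_less[of "norm (w i - w j)" e] by simp
      then show "dist (w i) (w j) < e" by (simp add: dist_norm)
    qed
  qed
  then obtain z where z: "w \<longlonglongrightarrow> z" using Cauchy_convergent_iff convergent_def by blast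
  have "(\<lambda>n. J (w n)) \<longlonglongrightarrow> J z"
    unfolding J_def by (intro tendsto_intros z tendsto) simp
  moreover have "(\<lambda>n. J (w n)) \<longlonglongrightarrow> m"
  proof (rule real_tendsto_sandwich)
    show "\<forall>\<^sub>F n in sequentially. m \<le> J (w n)" using m_le by simp
    show "\<forall>\<^sub>F n in sequentially. J (w n) \<le> m + 1 / real (Suc n)"
      using w by (simp add: less_imp_le)
    show "(\<lambda>n. m + 1 / real (Suc n)) \<longlonglongrightarrow> m"
      using tendsto_add[OF tendsto_const LIMSEQ_inverse_real_of_nat, of m]
      by (simp add: inverse_eq_divide)
  qed simp
  ultimately have Jz: "J z = m" using LIMSEQ_unique by blast
  have "\<phi> x = x \<bullet> z" for x
  proof -
    define d where "d = x \<bullet> z - \<phi> x"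
    have expand: "J (z + t *\<^sub>R x) = m + t * d + t\<^sup>2 * (norm x)\<^sup>2 / 2" for t
    proof -
      have "(norm (z + t *\<^sub>R x))\<^sup>2 = (norm z)\<^sup>2 + 2 * t * (x \<bullet> z) + t\<^sup>2 * (norm x)\<^sup>2"
        using norm_diff_square[of z "(- t) *\<^sub>R x"] by (simp add: power_mult_distrib inner_commute)
      then show ?thesis
        unfolding Jz[symmetric] J_def d_def by (simp add: add scaleR algebra_simps)
    qed
    have nonneg: "0 \<le> t * d + t\<^sup>2 * (norm x)\<^sup>2 / 2" for t
      using m_le[of "z + t *\<^sub>R x"] expand[of t] by simp
    define c where "c = 1 + (norm x)\<^sup>2"
    have c: "c > 0" unfolding c_def by (simp add: add_pos_nonneg)
    have "0 \<le> (- d / c) * d + (- d / c)\<^sup>2 * (c / 2)"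
    proof -
      have "(- d / c)\<^sup>2 * (norm x)\<^sup>2 / 2 \<le> (- d / c)\<^sup>2 * (c / 2)"
        unfolding c_def by (simp add: mult_left_mono divide_right_mono)
      then show ?thesis using nonneg[of "- d / c"] by linarith
    qed
    then have "d\<^sup>2 \<le> 0" using c by (simp add: power2_eq_square field_simps)
    then show ?thesis unfolding d_def by simp
  qed
  then show ?thesis by blast
qed

text \<open>\<^const>\<open>adjoint\<close> is defined by choice; the Riesz representation supplies a witness.\<close>

lemma adjoint_inner:
  fixes T :: "'a::{real_inner,complete_space} \<Rightarrow>\<^sub>L 'b::{real_inner,complete_space}"
  shows "T x \<bullet> y = x \<bullet> adjoint T y"
proof -
  have "\<exists>z. \<forall>x. T x \<bullet> y = x \<bullet> z" for y
    by (rule riesz_representation) 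
      (intro bounded_linear_inner_left_comp blinfun.bounded_linear_right)
  then have "\<exists>f'. \<forall>x y. T x \<bullet> y = x \<bullet> f' y" by metis
  then show ?thesis unfolding adjoint_def by (rule someI2_ex) blast
qed

lemma adj_apply: "blinfun_apply (adj T) = adjoint (blinfun_apply T)"
  and norm_adj_le: "norm (adj T) \<le> norm T"
  for T :: "'a::{real_inner,complete_space} \<Rightarrow>\<^sub>L 'b::{real_inner,complete_space}"
proof -
  have add: "adjoint T (x + y) = adjoint T x + adjoint T y" for x y
    by (rule vector_eq_ldot[THEN iffD1]) (simp add: adjoint_inner[symmetric] inner_add_right)
  have scale: "adjoint T (r *\<^sub>R x) = r *\<^sub>R adjoint T x" for r x
    by (rule vector_eq_ldot[THEN iffD1]) (simp add: adjoint_inner[symmetric])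
  have bound: "norm (adjoint T y) \<le> norm y * norm T" for y
  proof (cases "adjoint T y = 0")
    case False
    have "(norm (adjoint T y))\<^sup>2 = T (adjoint T y) \<bullet> y"
      by (simp add: adjoint_inner power2_norm_eq_inner)
    also have "\<dots> \<le> norm (T (adjoint T y)) * norm y" by (rule norm_cauchy_schwarz)
    also have "\<dots> \<le> (norm T * norm (adjoint T y)) * norm y"
      by (intro mult_right_mono norm_blinfun) simp
    finally show ?thesis using False by (simp add: power2_eq_square mult.commute)
  qed simp
  have bl: "bounded_linear (adjoint T)"
    by (rule bounded_linear_intro[OF add scale bound])
  show eq: "blinfun_apply (adj T) = adjoint T"
    unfolding adj_def by (rule bounded_linear_Blinfun_apply[OF bl])
  show "norm (adj T) \<le> norm T"
    by (rule norm_blinfun_bound) (use bound eq in \<open>auto simp: mult.commute\<close>)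
qed

lemma adj_inner: "T x \<bullet> y = x \<bullet> adj T y"
  for T :: "'a::{real_inner,complete_space} \<Rightarrow>\<^sub>L 'b::{real_inner,complete_space}"
  by (simp add: adjoint_inner adj_apply)

lemma adj_diff: "adj (T - T') = adj T - adj T'"
  for T T' :: "'a::{real_inner,complete_space} \<Rightarrow>\<^sub>L 'b::{real_inner,complete_space}"
proof (rule blinfun_eqI)
  fix y
  show "adj (T - T') y = (adj T - adj T') y"
    by (rule vector_eq_ldot[THEN iffD1])
      (simp add: adj_inner[symmetric] blinfun.diff_left inner_diff_right inner_diff_left)
qed

text \<open>For small \<open>\<lambda>\<close> the map \<open>x \<mapsto> x - \<lambda> (T x - w)\<close> is a contraction, and its fixed
  point solves \<open>T x = w\<close>.\<close>

lemma coercive_inverse: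
  fixes T :: "'a::{real_inner,complete_space} \<Rightarrow>\<^sub>L 'a"
  assumes a: "a > 0" and coercive: "\<And>x. a * (norm x)\<^sup>2 \<le> T x \<bullet> x"
  shows "op_inverse T o\<^sub>L T = id_blinfun" "T o\<^sub>L op_inverse T = id_blinfun"
    and "norm (op_inverse T w) \<le> norm w / a"
proof -
  have low: "a * norm x \<le> norm (T x)" for x
  proof (cases "x = 0")
    case False
    have "a * norm x * norm x \<le> norm (T x) * norm x"
      using coercive[of x] norm_cauchy_schwarz[of "T x" x] by (simp add: power2_eq_square)
    then show ?thesis using False by simp
  qed simp
  have inj: "T x = T y \<Longrightarrow> x = y" for x y
    using low[of "x - y"] a by (simp add: blinfun.diff_right mult_le_0_iff)
  have surj: "\<exists>x. T x = w" for w
  proof -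
    define M where "M = max a (norm T)"
    have M: "M > 0" "norm (T x) \<le> M * norm x" for x
    proof -
      show "M > 0" using a by (simp add: M_def)
      have "norm (T x) \<le> norm T * norm x" by (rule norm_blinfun)
      also have "\<dots> \<le> M * norm x" by (rule mult_right_mono) (auto simp: M_def)
      finally show "norm (T x) \<le> M * norm x" .
    qed
    define l where "l = a / M\<^sup>2"
    have l: "l > 0" using a M by (simp add: l_def)
    define c where "c = sqrt (1 - a\<^sup>2 / M\<^sup>2)"
    have aM: "a\<^sup>2 / M\<^sup>2 \<le> 1" "a\<^sup>2 / M\<^sup>2 > 0"
      using a M by (auto simp: M_def power_mono divide_le_eq_1)
    then have c: "0 \<le> c" "c < 1" "c\<^sup>2 = 1 - a\<^sup>2 / M\<^sup>2" by (auto simp: c_def)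
    have contr: "norm (x - l *\<^sub>R T x) \<le> c * norm x" for x
    proof -
      have "(norm (x - l *\<^sub>R T x))\<^sup>2 = (norm x)\<^sup>2 - 2 * l * (T x \<bullet> x) + l\<^sup>2 * (norm (T x))\<^sup>2"
        by (simp add: norm_diff_square power_mult_distrib inner_commute)
      also have "\<dots> \<le> (norm x)\<^sup>2 - 2 * l * (a * (norm x)\<^sup>2) + l\<^sup>2 * (M * norm x)\<^sup>2"
        using l coercive[of x] M(2)[of x]
        by (intro add_mono diff_mono mult_left_mono power_mono) auto
      also have "\<dots> = c\<^sup>2 * (norm x)\<^sup>2"
      proof -
        have "l * M\<^sup>2 = a" "a\<^sup>2 / M\<^sup>2 = l * a" using M(1) by (auto simp: l_def power2_eq_square)
        then have "l\<^sup>2 * (M * norm x)\<^sup>2 = l * a * (norm x)\<^sup>2" "c\<^sup>2 = 1 - l * a"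
          using c(3) by (simp_all add: power2_eq_square algebra_simps)
        then show ?thesis by (simp only: ring_distribs mult_1_left mult_2 mult.assoc)
      qed
      finally have "(norm (x - l *\<^sub>R T x))\<^sup>2 \<le> (c * norm x)\<^sup>2" by (simp add: power_mult_distrib)
      then show ?thesis by (rule power2_le_imp_le) (use c in simp)
    qed
    have "\<exists>!x. x - l *\<^sub>R (T x - w) = x"
    proof (rule banach_fix_type[OF c(1,2)], intro allI)
      fix x y :: 'a
      have "(x - l *\<^sub>R (T x - w)) - (y - l *\<^sub>R (T y - w)) = (x - y) - l *\<^sub>R T (x - y)"
        by (simp add: blinfun.diff_right algebra_simps)
      then show "dist (x - l *\<^sub>R (T x - w)) (y - l *\<^sub>R (T y - w)) \<le> c * dist x y"
        using contr[of "x - y"] by (simp only: dist_norm)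
    qed
    then show ?thesis using l by auto
  qed
  define R where "R w = (THE x. T x = w)" for w
  have TR: "T (R w) = w" for w
    unfolding R_def by (rule theI') (use inj surj in metis)
  have RT: "R (T x) = x" for x using TR[of "T x"] inj by blast
  have normR: "norm (R w) \<le> norm w / a" for w
    using low[of "R w"] a TR by (simp add: field_simps)
  have "bounded_linear R"
  proof (rule bounded_linear_intro)
    show "R (x + y) = R x + R y" for x y by (rule inj) (simp add: TR blinfun.add_right)
    show "R (r *\<^sub>R x) = r *\<^sub>R R x" for r x by (rule inj) (simp add: TR blinfun.scaleR_right)
    show "norm (R x) \<le> norm x * (1 / a)" for x using normR by simp
  qed
  then have app: "blinfun_apply (Blinfun R) = R" by (rule bounded_linear_Blinfun_apply)
  have eq: "op_inverse T = Blinfun R"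
    unfolding op_inverse_def
  proof (rule the_equality)
    show "Blinfun R o\<^sub>L T = id_blinfun \<and> T o\<^sub>L Blinfun R = id_blinfun"
      by (auto intro!: blinfun_eqI simp: app RT TR)
    fix Q assume Q: "Q o\<^sub>L T = id_blinfun \<and> T o\<^sub>L Q = id_blinfun"
    show "Q = Blinfun R"
    proof (rule blinfun_eqI)
      fix w
      have "T (Q w) = w" using Q by (metis blinfun_apply_blinfun_compose id_blinfun.rep_eq)
      then show "Q w = Blinfun R w" using TR inj app by metis
    qed
  qed
  show "op_inverse T o\<^sub>L T = id_blinfun" "T o\<^sub>L op_inverse T = id_blinfun"
    unfolding eq by (auto intro!: blinfun_eqI simp: app RT TR)
  show "norm (op_inverse T w) \<le> norm w / a"
    unfolding eq app by (rule normR)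
qed

text \<open>The Gramian is an integral of operators \<open>G\<^sub>s G\<^sub>s\<^sup>*\<close>, hence positive semidefinite; if
  the integral did not exist, it would be zero by convention.\<close>

lemma gramian_nonneg: "0 \<le> gramian b S B x \<bullet> x"
proof (cases "(\<lambda>s. S b s o\<^sub>L B o\<^sub>L adj B o\<^sub>L adj (S b s)) integrable_on {0..b}")
  case True
  have bl: "bounded_linear (\<lambda>T::'a \<Rightarrow>\<^sub>L 'a. T x \<bullet> x)"
    by (intro bounded_linear_inner_left_comp blinfun.bounded_linear_left)
  have "((\<lambda>s. (S b s o\<^sub>L B o\<^sub>L adj B o\<^sub>L adj (S b s)) x \<bullet> x) has_integral gramian b S B x \<bullet> x) {0..b}"
    using has_integral_linear[OF integrable_integral[OF True] bl]
    by (simp add: o_def gramian_def)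
  moreover have "(S b s o\<^sub>L B o\<^sub>L adj B o\<^sub>L adj (S b s)) x \<bullet> x = (norm (adj B (adj (S b s) x)))\<^sup>2" for s
    by (simp add: adj_inner[of "S b s"] adj_inner[of B] power2_norm_eq_inner)
  ultimately have "((\<lambda>s. (norm (adj B (adj (S b s) x)))\<^sup>2) has_integral gramian b S B x \<bullet> x) {0..b}"
    by (simp only:)
  then show ?thesis by (rule has_integral_nonneg) simp
qed (simp add: gramian_def not_integrable_integral)

lemma norm_resolvent_gramian_le:
  assumes "a > 0"
  shows "norm (resolvent_op a (gramian b S B) w) \<le> norm w / a"
  unfolding resolvent_op_def
  by (rule coercive_inverse(3)[OF assms])
    (use gramian_nonneg in \<open>auto simp: blinfun.add_left blinfun.scaleR_left inner_add_left power2_norm_eq_inner\<close>)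

text \<open>The inverse of the isometry \<^const>\<open>blinfun_inner_right\<close> of a Hilbert space onto its dual.\<close>

definition riesz :: "('a::{real_inner,complete_space} \<Rightarrow>\<^sub>L real) \<Rightarrow> 'a" where
  "riesz \<phi> = (SOME z. \<forall>x. \<phi> x = x \<bullet> z)"

lemma inner_riesz: "x \<bullet> riesz \<phi> = \<phi> x"
proof -
  have "\<exists>z. \<forall>x. \<phi> x = x \<bullet> z" by (rule riesz_representation) (rule blinfun.bounded_linear_right)
  then have "\<forall>x. \<phi> x = x \<bullet> riesz \<phi>" unfolding riesz_def by (rule someI_ex)
  then show ?thesis by simp
qed

lemma riesz_inner [simp]: "riesz (blinfun_inner_right x) = x"
  by (rule vector_eq_ldot[THEN iffD1]) (simp add: inner_riesz inner_commute)

lemma inner_right_riesz [simp]: "blinfun_inner_right (riesz \<phi>) = \<phi>"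
  by (rule blinfun_eqI) (simp add: inner_riesz inner_commute)

lemma bounded_linear_riesz: "bounded_linear riesz"
proof (rule bounded_linear_intro)
  show "riesz (x + y) = riesz x + riesz y" for x y :: "'a \<Rightarrow>\<^sub>L real"
    by (rule vector_eq_ldot[THEN iffD1]) (simp add: inner_riesz inner_add_right blinfun.add_left)
  show "riesz (r *\<^sub>R x) = r *\<^sub>R riesz x" for r and x :: "'a \<Rightarrow>\<^sub>L real"
    by (rule vector_eq_ldot[THEN iffD1]) (simp add: inner_riesz blinfun.scaleR_left)
  show "norm (riesz \<phi>) \<le> norm \<phi> * 1" for \<phi> :: "'a \<Rightarrow>\<^sub>L real"
  proof (cases "riesz \<phi> = 0")
    case False
    have "norm (riesz \<phi>) * norm (riesz \<phi>) = \<phi> (riesz \<phi>)"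
      using inner_riesz[of "riesz \<phi>" \<phi>] by (simp add: power2_norm_eq_inner flip: power2_eq_square)
    also have "\<dots> \<le> norm \<phi> * norm (riesz \<phi>)" using norm_blinfun[of \<phi> "riesz \<phi>"] by simp
    finally show ?thesis using False by simp
  qed simp
qed

section \<open>Integration in Hilbert spaces\<close>

text \<open>By the Riesz isometry, integrals in a Hilbert space are integrals in its dual, from which the
  calculus of integrals in Banach spaces carries over.\<close>

lemma has_integral_dual:
  fixes f :: "'n::euclidean_space \<Rightarrow> 'x::{real_inner,complete_space}"
  shows "((\<lambda>x. blinfun_inner_right (f x)) has_integral J) S \<longleftrightarrow> (f has_integral riesz J) S"
proof
  assume "((\<lambda>x. blinfun_inner_right (f x)) has_integral J) S"
  from has_integral_linear[OF this bounded_linear_riesz] show "(f has_integral riesz J) S"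
    by (simp add: o_def)
next
  assume "(f has_integral riesz J) S"
  from has_integral_linear[OF this bounded_linear_blinfun_inner_right]
  show "((\<lambda>x. blinfun_inner_right (f x)) has_integral J) S"
    by (simp add: o_def)
qed

lemma integrable_on_dual:
  fixes f :: "'n::euclidean_space \<Rightarrow> 'x::{real_inner,complete_space}"
  shows "(\<lambda>x. blinfun_inner_right (f x)) integrable_on S \<longleftrightarrow> f integrable_on S"
  unfolding integrable_on_def has_integral_dual by (metis riesz_inner)

lemma integral_dual:
  fixes f :: "'n::euclidean_space \<Rightarrow> 'x::{real_inner,complete_space}"
  assumes "f integrable_on S"
  shows "integral S (\<lambda>x. blinfun_inner_right (f x)) = blinfun_inner_right (integral S f)"
  using assms by (intro integral_unique) (simp add: has_integral_dual integrable_integral)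

lemma norm_blinfun_inner_right: "norm (blinfun_inner_right x) = norm x"
proof (rule antisym)
  show "norm (blinfun_inner_right x) \<le> norm x"
    by (rule norm_blinfun_bound) (simp_all add: Cauchy_Schwarz_ineq2)
  show "norm x \<le> norm (blinfun_inner_right x)"
  proof (cases "x = 0")
    case False
    have "norm x * norm x \<le> norm (blinfun_inner_right x) * norm x"
      using norm_blinfun[of "blinfun_inner_right x" x]
      by (simp add: power2_norm_eq_inner flip: power2_eq_square)
    then show ?thesis using False by simp
  qed simp
qed

context
  fixes f :: "real \<Rightarrow> 'x::{real_inner,complete_space}"
begin

lemma hilbert_integrable_continuous:
  assumes "continuous_on {a..b} f" shows "f integrable_on {a..b}"
  using integrable_continuous_real[of a b "\<lambda>x. blinfun_inner_right (f x)"] assms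
  by (simp add: integrable_on_dual bounded_linear.continuous_on[OF bounded_linear_blinfun_inner_right])

lemma hilbert_integrable_subinterval:
  assumes "f integrable_on {a..b}" "{c..d} \<subseteq> {a..b}" shows "f integrable_on {c..d}"
  using integrable_subinterval_real[of "\<lambda>x. blinfun_inner_right (f x)" a b c d] assms
  by (simp add: integrable_on_dual)

lemma hilbert_integral_combine:
  assumes "a \<le> c" "c \<le> b" "f integrable_on {a..b}"
  shows "integral {a..c} f + integral {c..b} f = integral {a..b} f"
proof -
  have "f integrable_on {a..c}" "f integrable_on {c..b}"
    using assms by (auto intro: hilbert_integrable_subinterval)
  then have "blinfun_inner_right (integral {a..c} f + integral {c..b} f)
      = blinfun_inner_right (integral {a..b} f)"
    using Henstock_Kurzweil_Integration.integral_combine[of a c b "\<lambda>x. blinfun_inner_right (f x)"] assms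
    by (simp add: integrable_on_dual integral_dual linear_add
        bounded_linear.linear[OF bounded_linear_blinfun_inner_right])
  then show ?thesis by (metis riesz_inner)
qed

text \<open>A function that is not integrable has integral \<open>0\<close>, so the bound holds for it as well.\<close>

lemma hilbert_integral_norm_bound:
  assumes "g integrable_on S" "\<And>x. x \<in> S \<Longrightarrow> norm (f x) \<le> g x"
  shows "norm (integral S f) \<le> integral S g"
proof (cases "f integrable_on S")
  case True
  have "norm (integral S (\<lambda>x. blinfun_inner_right (f x))) \<le> integral S g"
    by (rule Henstock_Kurzweil_Integration.integral_norm_bound_integral)
      (use assms True in \<open>auto simp: integrable_on_dual norm_blinfun_inner_right\<close>)
  then show ?thesis using True by (simp add: integral_dual norm_blinfun_inner_right)
next
  case False
  have "0 \<le> integral S g"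
    by (rule Henstock_Kurzweil_Integration.integral_nonneg)
      (use assms in \<open>auto intro: order_trans[OF norm_ge_zero]\<close>)
  then show ?thesis using False by (simp add: not_integrable_integral)
qed

lemma hilbert_integral_has_vector_derivative:
  assumes "continuous_on {a..b} f" "x \<in> {a..b}"
  shows "((\<lambda>u. integral {a..u} f) has_vector_derivative f x) (at x within {a..b})"
proof -
  have "((\<lambda>u. integral {a..u} (\<lambda>x. blinfun_inner_right (f x))) has_vector_derivative
      blinfun_inner_right (f x)) (at x within {a..b})"
    by (rule integral_has_vector_derivative)
      (use assms in \<open>auto simp: bounded_linear.continuous_on[OF bounded_linear_blinfun_inner_right]\<close>)
  then have "((\<lambda>u. riesz (integral {a..u} (\<lambda>x. blinfun_inner_right (f x)))) has_vector_derivative f x)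
      (at x within {a..b})"
    using bounded_linear.has_vector_derivative[OF bounded_linear_riesz] by fastforce
  then show ?thesis
  proof (rule has_vector_derivative_transform[OF assms(2), rotated])
    fix u assume that: "u \<in> {a..b}"
    then show "integral {a..u} f = riesz (integral {a..u} (\<lambda>x. blinfun_inner_right (f x)))"
    by (subst integral_dual)
      (use that assms(1) in \<open>auto intro!: hilbert_integrable_continuous intro: continuous_on_subset\<close>)
  qed
qed

end

subsection \<open>Approximation by simple functions\<close>

abbreviation (input) "vol \<equiv> Henstock_Kurzweil_Integration.content"

abbreviation (input) "leb a b \<equiv> lebesgue_on {a..b::real}"

text \<open>Lebesgue measure is complete, so measurability is insensitive to null sets.\<close>

lemma measurable_lebesgue_on_AE:
  fixes f g :: "real \<Rightarrow> real"
  assumes f: "f \<in> borel_measurable (leb a b)" and eq: "AE t in leb a b. f t = g t"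
  shows "g \<in> borel_measurable (leb a b)"
proof -
  have "(\<lambda>t. if t \<in> {a..b} then f t else 0) \<in> borel_measurable lebesgue"
    by (rule borel_measurable_if_I[OF f]) simp
  moreover have "AE t in lebesgue. (if t \<in> {a..b} then f t else 0) = (if t \<in> {a..b} then g t else 0)"
    using eq by (subst (asm) AE_restrict_space_iff) (auto elim!: eventually_mono)
  ultimately have "(\<lambda>t. if t \<in> {a..b} then g t else 0) \<in> borel_measurable lebesgue"
    by (rule borel_measurable_AE)
  then have "(\<lambda>t. if t \<in> {a..b} then g t else 0) \<in> borel_measurable (leb a b)"
    by (rule measurable_restrict_space1)
  then show ?thesis by (rule measurable_cong[THEN iffD1, rotated]) simp
qed

lemma integrable_lebesgue_on_AE:
  fixes f g :: "real \<Rightarrow> real"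
  assumes "integrable (leb a b) f" "AE t in leb a b. f t = g t"
  shows "integrable (leb a b) g" "(LINT t|leb a b. g t) = (LINT t|leb a b. f t)"
proof -
  have m: "g \<in> borel_measurable (leb a b)"
    using measurable_lebesgue_on_AE assms by blast
  show "integrable (leb a b) g" using integrable_cong_AE_imp[OF assms(1) m] assms(2) by simp
  show "(LINT t|leb a b. g t) = (LINT t|leb a b. f t)"
    by (rule integral_cong_AE) (use m assms in \<open>auto elim!: eventually_mono\<close>)
qed

lemma measurable_AE_limit:
  fixes u :: "nat \<Rightarrow> real \<Rightarrow> real"
  assumes m: "\<And>n. u n \<in> borel_measurable (leb a b)" and lim: "AE t in leb a b. (\<lambda>n. u n t) \<longlonglongrightarrow> v t"
  shows "v \<in> borel_measurable (leb a b)"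
proof (rule measurable_lebesgue_on_AE)
  show "(\<lambda>t. lim (\<lambda>n. u n t)) \<in> borel_measurable (leb a b)"
    by (rule borel_measurable_lim_metric[OF m])
  show "AE t in leb a b. lim (\<lambda>n. u n t) = v t"
    using lim by eventually_elim (rule limI)
qed

text \<open>By monotone convergence the sum has a finite integral.\<close>

lemma AE_summable_of_integrals:
  fixes g :: "nat \<Rightarrow> 'a \<Rightarrow> real"
  assumes int: "\<And>n. integrable M (g n)" and nn: "\<And>n t. t \<in> space M \<Longrightarrow> 0 \<le> g n t"
    and le: "\<And>n. (LINT t|M. g n t) \<le> (1/2) ^ n"
  shows "AE t in M. summable (\<lambda>n. g n t)"
proof -
  have [measurable]: "\<And>n. g n \<in> borel_measurable M" using int by auto
  have "(\<integral>\<^sup>+t. (\<Sum>n. ennreal (g n t)) \<partial>M) = (\<Sum>n. \<integral>\<^sup>+t. ennreal (g n t) \<partial>M)"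
    by (rule nn_integral_suminf) simp
  also have "\<dots> = (\<Sum>n. ennreal (LINT t|M. g n t))"
    by (intro suminf_cong nn_integral_eq_integral int) (auto intro!: AE_I2 nn)
  also have "\<dots> \<le> (\<Sum>n. ennreal ((1/2) ^ n))"
    by (intro suminf_le ennreal_leI le summableI)
  also have "\<dots> < \<infinity>"
    by (subst suminf_ennreal2) (auto intro: complete_algebra_summable_geometric)
  finally have "AE t in M. (\<Sum>n. ennreal (g n t)) \<noteq> \<infinity>"
    by (intro nn_integral_PInf_AE) auto
  then show ?thesis
    using AE_space
  proof eventually_elim
    case (elim t)
    then show ?case
      by (intro summable_suminf_not_top) (auto intro: nn)
  qed
qed

text \<open>Bounding the distance to simple functions by integrable real functions, instead of
  integrating it, avoids all measurability questions for \<open>f\<close> in a non-separable space.\<close>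

definition L1_approximable :: "real \<Rightarrow> real \<Rightarrow> (real \<Rightarrow> 'a::real_normed_vector) \<Rightarrow> bool" where
  "L1_approximable a b f \<longleftrightarrow> (\<forall>e>0. \<exists>\<phi> g. simple_function (leb a b) \<phi> \<and> integrable (leb a b) g \<and>
     (\<forall>t\<in>{a..b}. norm (f t - \<phi> t) \<le> g t) \<and> (LINT t|leb a b. g t) < e)"

lemma L1_approximableE:
  assumes "L1_approximable a b f" "e > 0"
  obtains \<phi> g where "simple_function (leb a b) \<phi>" "integrable (leb a b) g"
    "\<forall>t\<in>{a..b}. norm (f t - \<phi> t) \<le> g t" "(LINT t|leb a b. g t) < e"
  using assms unfolding L1_approximable_def by blast

lemma L1_approximable_simple: "simple_function (leb a b) f \<Longrightarrow> L1_approximable a b f"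
  unfolding L1_approximable_def
  by (intro allI impI exI[of _ f] exI[of _ "\<lambda>_. 0"]) auto

lemma L1_approximable_cong:
  assumes "\<And>t. t \<in> {a..b} \<Longrightarrow> f t = g t"
  shows "L1_approximable a b f \<longleftrightarrow> L1_approximable a b g"
proof -
  have "(\<forall>t\<in>{a..b}. norm (f t - \<phi> t) \<le> k t) \<longleftrightarrow> (\<forall>t\<in>{a..b}. norm (g t - \<phi> t) \<le> k t)" for \<phi> k
    by (rule ball_cong) (use assms in auto)
  then show ?thesis unfolding L1_approximable_def by (simp only:)
qed

text \<open>The dominating function is enlarged on a null set to obtain a bound everywhere.\<close>

lemma L1_approximable_limit:
  assumes "\<And>e. e > 0 \<Longrightarrow> \<exists>h g. L1_approximable a b h \<and> integrable (leb a b) g \<and>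
      (AE t in leb a b. norm (f t - h t) \<le> g t) \<and> (LINT t|leb a b. g t) < e"
  shows "L1_approximable a b f"
  unfolding L1_approximable_def
proof (intro allI impI)
  fix e :: real assume "e > 0"
  then have e2: "e / 2 > 0" by simp
  from assms[OF e2] obtain h g where h: "L1_approximable a b h" and g: "integrable (leb a b) g"
    "AE t in leb a b. norm (f t - h t) \<le> g t" "(LINT t|leb a b. g t) < e / 2" by blast
  obtain \<phi> g' where \<phi>: "simple_function (leb a b) \<phi>" and g': "integrable (leb a b) g'"
    "\<forall>t\<in>{a..b}. norm (h t - \<phi> t) \<le> g' t" "(LINT t|leb a b. g' t) < e / 2"
    by (rule L1_approximableE[OF h e2])
  define G where "G t = max (g t + g' t) (norm (f t - \<phi> t))" for t
  have int: "integrable (leb a b) (\<lambda>t. g t + g' t)" using g(1) g'(1) by simp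
  have "AE t in leb a b. t \<in> {a..b}" using AE_space[of "leb a b"] by simp
  with g(2) have eq: "AE t in leb a b. g t + g' t = G t"
  proof eventually_elim
    case (elim t)
    have "norm (f t - \<phi> t) \<le> norm (f t - h t) + norm (h t - \<phi> t)"
      by (metis diff_add_cancel add_diff_eq norm_triangle_ineq)
    moreover have "norm (h t - \<phi> t) \<le> g' t" using g'(2) elim(2) by blast
    ultimately show ?case using elim(1) by (simp add: G_def)
  qed
  from integrable_lebesgue_on_AE[OF int eq]
  have "integrable (leb a b) G" "(LINT t|leb a b. G t) < e"
    using g g' by auto
  with \<phi> show "\<exists>\<phi> g. simple_function (leb a b) \<phi> \<and> integrable (leb a b) g \<and>
     (\<forall>t\<in>{a..b}. norm (f t - \<phi> t) \<le> g t) \<and> (LINT t|leb a b. g t) < e"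
    by (intro exI[of _ \<phi>] exI[of _ G]) (auto simp: G_def)
qed

lemma L1_approximable_add:
  assumes "L1_approximable a b f" "L1_approximable a b h"
  shows "L1_approximable a b (\<lambda>t. f t + h t)"
  unfolding L1_approximable_def
proof (intro allI impI)
  fix e :: real assume "e > 0"
  then have e2: "e / 2 > 0" by simp
  obtain \<phi> g where 1: "simple_function (leb a b) \<phi>" "integrable (leb a b) g"
     "\<forall>t\<in>{a..b}. norm (f t - \<phi> t) \<le> g t" "(LINT t|leb a b. g t) < e / 2"
    by (rule L1_approximableE[OF assms(1) e2])
  obtain \<psi> k where 2: "simple_function (leb a b) \<psi>" "integrable (leb a b) k"
     "\<forall>t\<in>{a..b}. norm (h t - \<psi> t) \<le> k t" "(LINT t|leb a b. k t) < e / 2"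
    by (rule L1_approximableE[OF assms(2) e2])
  show "\<exists>\<phi> g. simple_function (leb a b) \<phi> \<and> integrable (leb a b) g \<and>
     (\<forall>t\<in>{a..b}. norm (f t + h t - \<phi> t) \<le> g t) \<and> (LINT t|leb a b. g t) < e"
  proof (intro exI conjI ballI)
    show "simple_function (leb a b) (\<lambda>t. \<phi> t + \<psi> t)" using 1 2 by simp
    show "integrable (leb a b) (\<lambda>t. g t + k t)" using 1 2 by simp
    show "(LINT t|leb a b. g t + k t) < e" using 1 2 by simp
    show "norm (f t + h t - (\<phi> t + \<psi> t)) \<le> g t + k t" if "t \<in> {a..b}" for t
      unfolding add_diff_add by (rule norm_triangle_mono) (use 1 2 that in auto)
  qed
qed

lemma L1_approximable_blinfun:
  assumes "L1_approximable a b f"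
  shows "L1_approximable a b (\<lambda>t. blinfun_apply T (f t))"
  unfolding L1_approximable_def
proof (intro allI impI)
  fix e :: real assume e: "e > 0"
  define K where "K = norm T + 1"
  have K: "K > 0" "norm T \<le> K" by (auto simp: K_def add_nonneg_pos)
  obtain \<phi> g where 1: "simple_function (leb a b) \<phi>" "integrable (leb a b) g"
     "\<forall>t\<in>{a..b}. norm (f t - \<phi> t) \<le> g t" "(LINT t|leb a b. g t) < e / K"
    by (rule L1_approximableE[OF assms divide_pos_pos[OF e K(1)]])
  show "\<exists>\<phi> g. simple_function (leb a b) \<phi> \<and> integrable (leb a b) g \<and>
     (\<forall>t\<in>{a..b}. norm (T (f t) - \<phi> t) \<le> g t) \<and> (LINT t|leb a b. g t) < e"
  proof (intro exI conjI ballI)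
    show "simple_function (leb a b) (\<lambda>t. T (\<phi> t))"
      using simple_function_compose[OF 1(1), of "blinfun_apply T"] by (simp add: o_def)
    show "integrable (leb a b) (\<lambda>t. K * g t)" using 1 by simp
    show "(LINT t|leb a b. K * g t) < e" using 1 K by (simp add: field_simps)
    show "norm (T (f t) - T (\<phi> t)) \<le> K * g t" if "t \<in> {a..b}" for t
    proof -
      have "norm (T (f t - \<phi> t)) \<le> norm T * norm (f t - \<phi> t)" by (rule norm_blinfun)
      also have "\<dots> \<le> K * g t" using K 1(3) that by (intro mult_mono) auto
      finally show ?thesis by (simp add: blinfun.diff_right)
    qed
  qed
qed

lemma L1_approximable_scaleR: "L1_approximable a b f \<Longrightarrow> L1_approximable a b (\<lambda>t. c *\<^sub>R f t)"
  using L1_approximable_blinfun[of a b f "c *\<^sub>R id_blinfun"] by (simp add: blinfun.scaleR_left)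

lemma L1_approximable_diff:
  "L1_approximable a b f \<Longrightarrow> L1_approximable a b h \<Longrightarrow> L1_approximable a b (\<lambda>t. f t - h t)"
  using L1_approximable_add[of a b f "\<lambda>t. (-1) *\<^sub>R h t"] L1_approximable_scaleR[of a b h "-1"] by simp

lemma L1_approximable_sum:
  assumes "finite I" "\<And>i. i \<in> I \<Longrightarrow> L1_approximable a b (f i)"
  shows "L1_approximable a b (\<lambda>t. \<Sum>i\<in>I. f i t)"
  using assms by (induction I) (auto intro: L1_approximable_add L1_approximable_simple)

lemma L1_approximable_indicator:
  assumes f: "L1_approximable a b f" and A: "A \<in> sets (leb a b)"
  shows "L1_approximable a b (\<lambda>t. indicat_real A t *\<^sub>R f t)"
  unfolding L1_approximable_def
proof (intro allI impI)
  fix e :: real assume e: "e > 0"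
  obtain \<phi> g where 1: "simple_function (leb a b) \<phi>" "integrable (leb a b) g"
     "\<forall>t\<in>{a..b}. norm (f t - \<phi> t) \<le> g t" "(LINT t|leb a b. g t) < e"
    by (rule L1_approximableE[OF f e])
  have "norm (indicat_real A t *\<^sub>R f t - indicat_real A t *\<^sub>R \<phi> t) \<le> g t" if "t \<in> {a..b}" for t
  proof -
    have "norm (f t - \<phi> t) \<le> g t" using 1(3) that by blast
    moreover from this have "0 \<le> g t" by (rule order_trans[OF norm_ge_zero])
    ultimately show ?thesis by (simp add: indicator_def)
  qed
  moreover have "simple_function (leb a b) (\<lambda>t. indicat_real A t *\<^sub>R \<phi> t)"
    by (rule simple_function_compose2[OF simple_function_indicator[OF A] 1(1)])
  ultimately show "\<exists>\<phi> g. simple_function (leb a b) \<phi> \<and> integrable (leb a b) g \<and>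
     (\<forall>t\<in>{a..b}. norm (indicat_real A t *\<^sub>R f t - \<phi> t) \<le> g t) \<and> (LINT t|leb a b. g t) < e"
    using 1 by blast
qed

lemma LINT_const: "a \<le> b \<Longrightarrow> (LINT t|leb a b. c) = (b - a) * (c::real)"
  by (simp add: measure_restrict_space)

lemma L1_approximable_continuous:
  fixes f :: "real \<Rightarrow> 'a::real_normed_vector"
  assumes ab: "a \<le> b" and f: "continuous_on {a..b} f"
  shows "L1_approximable a b f"
proof (rule L1_approximable_limit)
  fix e :: real assume e: "e > 0"
  define e' where "e' = e / (2 * (b - a + 1))"
  have e': "e' > 0" using e ab by (simp add: e'_def)
  have "uniformly_continuous_on {a..b} f" by (rule compact_uniformly_continuous[OF f]) simp
  then obtain d where d: "d > 0"
    "\<And>x y. x \<in> {a..b} \<Longrightarrow> y \<in> {a..b} \<Longrightarrow> dist y x < d \<Longrightarrow> dist (f y) (f x) < e'"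
    unfolding uniformly_continuous_on_def using e' by metis
  \<comment> \<open>\<open>p\<close> numbers the cells of a grid of width \<open>d\<close>; the step function takes the value at the left end\<close>
  define p where "p t = \<lfloor>(t - a) / d\<rfloor>" for t
  have p_meas: "p \<in> leb a b \<rightarrow>\<^sub>M count_space UNIV"
  proof -
    have "(\<lambda>t. (t - a) / d) \<in> borel \<rightarrow>\<^sub>M borel" by measurable
    then have "p \<in> borel \<rightarrow>\<^sub>M count_space UNIV"
      unfolding p_def by (rule measurable_compose[OF _ measurable_real_floor])
    then show ?thesis
      by (intro measurable_restrict_space1 measurable_completion) simp
  qed
  have "p ` {a..b} \<subseteq> {0..p b}"
    using d(1) by (auto simp: p_def intro!: floor_mono divide_right_mono)
  then have p_simple: "simple_function (leb a b) p"
    using p_meas by (simp add: simple_function_eq_measurable finite_subset)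
  define \<phi> where "\<phi> t = f (a + d * of_int (p t))" for t
  have "simple_function (leb a b) \<phi>"
    using simple_function_compose[OF p_simple, of "\<lambda>k. f (a + d * of_int k)"]
    by (simp add: o_def \<phi>_def[abs_def])
  moreover have "norm (f t - \<phi> t) \<le> e'" if t: "t \<in> {a..b}" for t
  proof -
    have 1: "real_of_int (p t) \<le> (t - a) / d" "(t - a) / d < real_of_int (p t) + 1" "0 \<le> p t"
      using t d(1) unfolding p_def by (auto simp: floor_correct)
    then have "d * of_int (p t) \<le> t - a" "t - a < d * of_int (p t) + d"
      using d(1) by (auto simp: field_simps)
    moreover have "0 \<le> d * of_int (p t)" using d(1) 1(3) by simp
    ultimately have "a + d * of_int (p t) \<in> {a..b}" "dist t (a + d * of_int (p t)) < d"
      using t by (auto simp: dist_real_def)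
    from d(2)[OF this(1) t this(2)] show ?thesis by (simp add: \<phi>_def dist_norm)
  qed
  moreover have "(LINT t|leb a b. e') < e"
  proof -
    have "(b - a) * e' < (2 * (b - a + 1)) * e'"
      using ab e' by (intro mult_strict_right_mono) auto
    also have "\<dots> = e" using ab by (simp add: e'_def)
    finally show ?thesis using ab by (simp only: LINT_const)
  qed
  ultimately show "\<exists>h g. L1_approximable a b h \<and> integrable (leb a b) g \<and>
      (AE t in leb a b. norm (f t - h t) \<le> g t) \<and> (LINT t|leb a b. g t) < e"
    by (intro exI[of _ \<phi>] exI[of _ "\<lambda>_. e'"]) (auto intro!: AE_I2 L1_approximable_simple)
qed

lemma simple_function_indicator_sum:
  fixes F :: "real \<Rightarrow> 'y \<Rightarrow> 'z::real_vector"
  assumes \<phi>: "simple_function (leb a b) \<phi>" and t: "t \<in> {a..b}"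
  shows "F t (\<phi> t) = (\<Sum>y\<in>\<phi> ` {a..b}. indicat_real (\<phi> -` {y} \<inter> {a..b}) t *\<^sub>R F t y)"
proof -
  have fin: "finite (\<phi> ` {a..b})" using simple_functionD(1)[OF \<phi>] by simp
  have "(\<Sum>y\<in>\<phi> ` {a..b}. indicat_real (\<phi> -` {y} \<inter> {a..b}) t *\<^sub>R F t y)
      = (\<Sum>y\<in>\<phi> ` {a..b}. if y = \<phi> t then F t y else 0)"
    using t by (intro sum.cong) (auto simp: indicator_def)
  also have "\<dots> = F t (\<phi> t)" using fin t by (subst sum.delta) auto
  finally show ?thesis by simp
qed

text \<open>On a simple function, \<open>S\<close> acts as a finite sum of continuous functions \<open>t \<mapsto> S t y\<close>, each cut off
  to a measurable set.\<close>

lemma L1_approximable_operator: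
  fixes S :: "real \<Rightarrow> 'a::real_normed_vector \<Rightarrow>\<^sub>L 'b::real_normed_vector"
  assumes ab: "a \<le> b" and S: "continuous_on {a..b} S" and f: "L1_approximable a b f"
  shows "L1_approximable a b (\<lambda>s. S s (f s))"
proof (rule L1_approximable_limit)
  fix e :: real assume e: "e > 0"
  have "compact (S ` {a..b})" by (rule compact_continuous_image[OF S]) simp
  then obtain K where K: "K > 0" "\<And>t. t \<in> {a..b} \<Longrightarrow> norm (S t) \<le> K"
    using compact_imp_bounded[of "S ` {a..b}"] by (auto simp: bounded_pos)
  obtain \<phi> g where 1: "simple_function (leb a b) \<phi>" "integrable (leb a b) g"
     "\<forall>t\<in>{a..b}. norm (f t - \<phi> t) \<le> g t" "(LINT t|leb a b. g t) < e / K"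
    by (rule L1_approximableE[OF f divide_pos_pos[OF e K(1)]])
  have "L1_approximable a b (\<lambda>t. \<Sum>y\<in>\<phi> ` {a..b}. indicat_real (\<phi> -` {y} \<inter> {a..b}) t *\<^sub>R S t y)"
  proof (intro L1_approximable_sum L1_approximable_indicator L1_approximable_continuous ab)
    show "finite (\<phi> ` {a..b})" using simple_functionD(1)[OF 1(1)] by simp
    show "\<phi> -` {y} \<inter> {a..b} \<in> sets (leb a b)" for y using simple_functionD(2)[OF 1(1), of "{y}"] by simp
    show "continuous_on {a..b} (\<lambda>t. S t y)" for y by (intro continuous_intros S)
  qed
  then have "L1_approximable a b (\<lambda>t. S t (\<phi> t))"
    by (rule L1_approximable_cong[THEN iffD1, rotated])
      (simp add: simple_function_indicator_sum[OF 1(1), of _ "\<lambda>t. blinfun_apply (S t)"])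
  moreover have "integrable (leb a b) (\<lambda>t. K * g t)" "(LINT t|leb a b. K * g t) < e"
    using 1 K by (auto simp: field_simps)
  moreover have "norm (S t (f t) - S t (\<phi> t)) \<le> K * g t" if "t \<in> {a..b}" for t
  proof -
    have "norm (S t (f t - \<phi> t)) \<le> norm (S t) * norm (f t - \<phi> t)" by (rule norm_blinfun)
    also have "\<dots> \<le> K * g t" using K 1(3) that by (intro mult_mono) auto
    finally show ?thesis by (simp add: blinfun.diff_right)
  qed
  ultimately show "\<exists>h g. L1_approximable a b h \<and> integrable (leb a b) g \<and>
      (AE t in leb a b. norm (S t (f t) - h t) \<le> g t) \<and> (LINT t|leb a b. g t) < e"
    by (intro exI[of _ "\<lambda>t. S t (\<phi> t)"] exI[of _ "\<lambda>t. K * g t"]) (auto intro!: AE_I2)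
qed

lemma integrable_on_simple:
  fixes \<phi> :: "real \<Rightarrow> 'a::real_normed_vector"
  assumes \<phi>: "simple_function (leb a b) \<phi>"
  shows "\<phi> integrable_on {a..b}"
proof -
  have "(\<lambda>t. \<Sum>y\<in>\<phi> ` {a..b}. indicat_real (\<phi> -` {y} \<inter> {a..b}) t *\<^sub>R y) integrable_on {a..b}"
  proof (rule Henstock_Kurzweil_Integration.integrable_sum)
    show "finite (\<phi> ` {a..b})" using simple_functionD(1)[OF \<phi>] by simp
    fix y
    have "\<phi> -` {y} \<inter> {a..b} \<in> sets (leb a b)" using simple_functionD(2)[OF \<phi>, of "{y}"] by simp
    then have m: "indicat_real (\<phi> -` {y} \<inter> {a..b}) \<in> borel_measurable (leb a b)" by simp
    have "integrable (leb a b) (indicat_real (\<phi> -` {y} \<inter> {a..b}))"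
      by (rule Bochner_Integration.integrable_bound[of _ "\<lambda>_. 1::real", OF _ m]) (auto intro!: AE_I2 simp: indicator_def)
    then have "indicat_real (\<phi> -` {y} \<inter> {a..b}) integrable_on {a..b}"
      by (rule integrable_on_lebesgue_on) simp
    then show "(\<lambda>t. indicat_real (\<phi> -` {y} \<inter> {a..b}) t *\<^sub>R y) integrable_on {a..b}"
      by (rule integrable_on_scaleR_left)
  qed
  then show ?thesis
    by (rule Henstock_Kurzweil_Integration.integrable_eq) (rule simple_function_indicator_sum[OF \<phi>, of _ "\<lambda>t y. y", symmetric])
qed

lemma riemann_sum_diff_le:
  fixes f \<phi> :: "real \<Rightarrow> 'a::real_normed_vector"
  assumes D: "D tagged_division_of cbox a b" and le: "\<And>t. t \<in> {a..b} \<Longrightarrow> norm (f t - \<phi> t) \<le> g t"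
  shows "norm ((\<Sum>(x, K)\<in>D. vol K *\<^sub>R f x) - (\<Sum>(x, K)\<in>D. vol K *\<^sub>R \<phi> x)) \<le> (\<Sum>(x, K)\<in>D. vol K *\<^sub>R g x)"
proof -
  have "(\<Sum>p\<in>D. vol (snd p) *\<^sub>R f (fst p)) - (\<Sum>p\<in>D. vol (snd p) *\<^sub>R \<phi> (fst p))
      = (\<Sum>p\<in>D. vol (snd p) *\<^sub>R f (fst p) - vol (snd p) *\<^sub>R \<phi> (fst p))"
    by (rule sum_subtractf[symmetric])
  also have "norm \<dots> \<le> (\<Sum>p\<in>D. vol (snd p) *\<^sub>R g (fst p))"
  proof (rule sum_norm_le)
    fix p assume "p \<in> D"
    then have "(fst p, snd p) \<in> D" by simp
    then have "fst p \<in> {a..b}" using tag_in_interval[OF D] by fastforce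
    then have "vol (snd p) * norm (f (fst p) - \<phi> (fst p)) \<le> vol (snd p) * g (fst p)"
      using le by (intro mult_left_mono) auto
    then show "norm (vol (snd p) *\<^sub>R f (fst p) - vol (snd p) *\<^sub>R \<phi> (fst p)) \<le> vol (snd p) *\<^sub>R g (fst p)"
      unfolding scaleR_diff_right[symmetric] norm_scaleR by simp
  qed
  finally show ?thesis by (simp only: case_prod_unfold)
qed

text \<open>Riemann sums of \<open>f\<close> differ from those of a nearby simple function by at most a Riemann
  sum of the dominating function \<open>g\<close>, which is close to the small integral of \<open>g\<close>.\<close>

lemma L1_approximable_integrable_on:
  fixes f :: "real \<Rightarrow> 'a::{real_normed_vector,complete_space}"
  assumes "L1_approximable a b f"
  shows "f integrable_on {a..b}"
  unfolding box_real(2)[symmetric] integrable_Cauchy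
proof (intro allI impI)
  fix e :: real assume e: "e > 0"
  then have e4: "e / 4 > 0" "e / 8 > 0" by auto
  obtain \<phi> g where 1: "simple_function (leb a b) \<phi>" "integrable (leb a b) g"
     "\<forall>t\<in>{a..b}. norm (f t - \<phi> t) \<le> g t" "(LINT t|leb a b. g t) < e / 4"
    by (rule L1_approximableE[OF assms e4(1)])
  let ?R = "\<lambda>h D. \<Sum>(x, K)\<in>D. vol K *\<^sub>R h x"
  have "\<phi> integrable_on cbox a b" using integrable_on_simple[OF 1(1)] by simp
  from this[unfolded integrable_Cauchy, rule_format, OF e4(1)]
  obtain \<gamma>1 where \<gamma>1: "gauge \<gamma>1" and cauchy1: "\<forall>D1 D2. D1 tagged_division_of cbox a b \<and> \<gamma>1 fine D1 \<and>
      D2 tagged_division_of cbox a b \<and> \<gamma>1 fine D2 \<longrightarrow> norm (?R \<phi> D1 - ?R \<phi> D2) < e / 4"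
    by (elim exE conjE)
  have "(g has_integral (LINT t|leb a b. g t)) {a..b}"
    by (rule has_integral_integral_lebesgue_on[OF 1(2)]) simp
  from this[unfolded has_integral_real, rule_format, OF e4(2)]
  obtain \<gamma>2 where \<gamma>2: "gauge \<gamma>2"
    "\<And>D. D tagged_division_of cbox a b \<Longrightarrow> \<gamma>2 fine D \<Longrightarrow> norm (?R g D - (LINT t|leb a b. g t)) < e / 8"
    by auto
  define \<gamma> where "\<gamma> x = \<gamma>1 x \<inter> \<gamma>2 x" for x
  have close: "norm (?R f D - ?R \<phi> D) < 3 * e / 8"
    if D: "D tagged_division_of cbox a b" "\<gamma>2 fine D" for D
  proof -
    have "norm (?R f D - ?R \<phi> D) \<le> ?R g D"
      by (rule riemann_sum_diff_le[OF D(1)]) (use 1(3) in blast)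
    also have "\<dots> < e / 4 + e / 8" using \<gamma>2(2)[OF D] 1(4) unfolding real_norm_def by linarith
    finally show ?thesis by simp
  qed
  have three: "norm (x - z) < e"
    if "norm (x - y) < 3 * e / 8" "norm (y - w) < e / 4" "norm (z - w) < 3 * e / 8" for x y z w :: 'a
  proof -
    have "norm ((x - y) + (y - w) - (z - w)) \<le> norm (x - y) + norm (y - w) + norm (z - w)"
      using norm_triangle_ineq4[of "x - y + (y - w)" "z - w"] norm_triangle_ineq[of "x - y" "y - w"]
      by linarith
    also have "\<dots> < e" using that by linarith
    finally show ?thesis by simp
  qed
  have R: "norm (?R f D1 - ?R f D2) < e"
    if "D1 tagged_division_of cbox a b" "\<gamma> fine D1" "D2 tagged_division_of cbox a b" "\<gamma> fine D2" for D1 D2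
  proof -
    have fine: "\<gamma>1 fine D1" "\<gamma>2 fine D1" "\<gamma>1 fine D2" "\<gamma>2 fine D2"
      using that unfolding \<gamma>_def fine_Int by auto
    show ?thesis
      by (rule three[OF close[OF that(1) fine(2)] cauchy1[rule_format, OF conjI, OF that(1) conjI, OF fine(1) conjI, OF that(3) fine(3)]
            close[OF that(3) fine(4)]])
  qed
  have "gauge \<gamma>" unfolding \<gamma>_def by (rule gauge_Int[OF \<gamma>1 \<gamma>2(1)])
  with R show "\<exists>\<gamma>. gauge \<gamma> \<and> (\<forall>D1 D2. D1 tagged_division_of cbox a b \<and> \<gamma> fine D1 \<and>
      D2 tagged_division_of cbox a b \<and> \<gamma> fine D2 \<longrightarrow> norm (?R f D1 - ?R f D2) < e)"
    by (intro exI[of _ \<gamma>] conjI allI impI) (assumption, elim conjE, rule R)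
qed

lemma norm_integral_le_LINT:
  fixes f :: "real \<Rightarrow> 'x::{real_inner,complete_space}"
  assumes g: "integrable (leb a b) g" and cd: "{c..d} \<subseteq> {a..b}"
    and le: "\<And>t. t \<in> {c..d} \<Longrightarrow> norm (f t) \<le> g t" and nn: "\<And>t. t \<in> {a..b} \<Longrightarrow> 0 \<le> g t"
  shows "norm (integral {c..d} f) \<le> (LINT t|leb a b. g t)"
proof -
  have gi: "g integrable_on {a..b}" by (rule integrable_on_lebesgue_on[OF g]) simp
  then have gi': "g integrable_on {c..d}" using cd by (rule integrable_subinterval_real)
  have "norm (integral {c..d} f) \<le> integral {c..d} g"
    by (rule hilbert_integral_norm_bound[OF gi' le])
  also have "\<dots> \<le> integral {a..b} g"
    by (rule integral_subset_le[OF cd gi' gi]) (use nn in blast)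
  also have "\<dots> = (LINT t|leb a b. g t)"
    by (rule lebesgue_integral_eq_integral[symmetric, OF g]) simp
  finally show ?thesis .
qed

subsection \<open>Bochner integrable functions\<close>

text \<open>Truncating the given simple functions at \<open>2 * norm (f t)\<close> keeps them simple and convergent and
  makes dominated convergence applicable.\<close>

lemma L1_on_imp_approximable:
  assumes f: "f \<in> L1_on {a..b}"
  shows "L1_approximable a b f"
proof (rule L1_approximable_limit)
  fix e :: real assume e: "e > 0"
  obtain \<phi> where \<phi>: "\<And>n. simple_function (leb a b) (\<phi> n)"
    "AE t in leb a b. (\<lambda>n. \<phi> n t) \<longlonglongrightarrow> f t"
    using f unfolding L1_on_def strongly_measurable_on_def by blast
  have int: "integrable (leb a b) (\<lambda>t. norm (f t))" using f by (simp add: L1_on_def)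
  define \<psi> where "\<psi> n t = (if norm (\<phi> n t) \<le> 2 * norm (f t) then \<phi> n t else 0)" for n t
  have \<psi>: "simple_function (leb a b) (\<psi> n)" for n
    unfolding \<psi>_def
  proof (rule simple_function_If[OF \<phi>(1)])
    have "(\<lambda>t. norm (\<phi> n t)) \<in> borel_measurable (leb a b)"
      using simple_function_compose[OF \<phi>(1)[of n], of norm]
      by (intro borel_measurable_simple_function) (simp add: o_def)
    then show "{t \<in> space (leb a b). norm (\<phi> n t) \<le> 2 * norm (f t)} \<in> sets (leb a b)"
      using int by (intro borel_measurable_le) auto
  qed simp
  \<comment> \<open>the truncation is eventually inactive where \<open>f\<close> does not vanish\<close>
  have lim: "AE t in leb a b. (\<lambda>n. \<psi> n t) \<longlonglongrightarrow> f t"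
    using \<phi>(2)
  proof eventually_elim
    case (elim t)
    show ?case
    proof (cases "f t = 0")
      case True
      then have "\<psi> n t = 0" for n by (simp add: \<psi>_def)
      then show ?thesis using True by simp
    next
      case False
      have "(\<lambda>n. norm (\<phi> n t)) \<longlonglongrightarrow> norm (f t)" by (rule tendsto_norm[OF elim])
      moreover have "norm (f t) < 2 * norm (f t)" using False by simp
      ultimately have "\<forall>\<^sub>F n in sequentially. norm (\<phi> n t) < 2 * norm (f t)"
        by (rule order_tendstoD)
      then have "\<forall>\<^sub>F n in sequentially. \<phi> n t = \<psi> n t"
        by eventually_elim (simp add: \<psi>_def)
      then show ?thesis using elim by (rule Lim_transform_eventually[rotated])
    qed
  qed
  have m: "(\<lambda>t. norm (f t - \<psi> n t)) \<in> borel_measurable (leb a b)" for n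
  proof (rule measurable_AE_limit)
    show "(\<lambda>t. norm (\<phi> m t - \<psi> n t)) \<in> borel_measurable (leb a b)" for m
      by (intro borel_measurable_simple_function simple_function_compose2[OF \<phi>(1) \<psi>])
    show "AE t in leb a b. (\<lambda>m. norm (\<phi> m t - \<psi> n t)) \<longlonglongrightarrow> norm (f t - \<psi> n t)"
      using \<phi>(2) by eventually_elim (intro tendsto_intros)
  qed
  have bound: "norm (f t - \<psi> n t) \<le> 3 * norm (f t)" for n t
  proof -
    have "norm (\<psi> n t) \<le> 2 * norm (f t)" by (simp add: \<psi>_def)
    then show ?thesis using norm_triangle_ineq4[of "f t" "\<psi> n t"] by linarith
  qed
  have conv: "(\<lambda>n. LINT t|leb a b. norm (f t - \<psi> n t)) \<longlonglongrightarrow> (LINT t|leb a b. (0::real))"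
  proof (rule integral_dominated_convergence[where w = "\<lambda>t. 3 * norm (f t)"])
    show "integrable (leb a b) (\<lambda>t. 3 * norm (f t))" using int by simp
    show "AE t in leb a b. (\<lambda>n. norm (f t - \<psi> n t)) \<longlonglongrightarrow> 0"
      using lim
    proof eventually_elim
      case (elim t)
      have "(\<lambda>n. norm (f t - \<psi> n t)) \<longlonglongrightarrow> norm (f t - f t)" by (intro tendsto_intros elim)
      then show ?case by simp
    qed
  qed (use m bound in auto)
  then have "\<forall>\<^sub>F n in sequentially. (LINT t|leb a b. norm (f t - \<psi> n t)) < e"
    by (rule order_tendstoD) (use e in simp)
  then obtain n where n: "(LINT t|leb a b. norm (f t - \<psi> n t)) < e"
    by (auto simp: eventually_sequentially)
  have "integrable (leb a b) (\<lambda>t. norm (f t - \<psi> n t))"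
    by (rule Bochner_Integration.integrable_bound[of _ "\<lambda>t. 3 * norm (f t)"]) (use int m bound in auto)
  with n show "\<exists>h g. L1_approximable a b h \<and> integrable (leb a b) g \<and>
      (AE t in leb a b. norm (f t - h t) \<le> g t) \<and> (LINT t|leb a b. g t) < e"
    by (intro exI[of _ "\<psi> n"] exI[of _ "\<lambda>t. norm (f t - \<psi> n t)"])
      (auto intro!: L1_approximable_simple \<psi>)
qed

lemma integrable_simple_norm:
  fixes \<phi> :: "real \<Rightarrow> 'a::real_normed_vector"
  assumes "simple_function (leb a b) \<phi>"
  shows "integrable (leb a b) (\<lambda>t. norm (\<phi> t))"
proof -
  have s: "simple_function (leb a b) (\<lambda>t. norm (\<phi> t))"
    using simple_function_compose[OF assms, of norm] by (simp add: o_def)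
  have fin: "finite ((\<lambda>t. norm (\<phi> t)) ` {a..b})" using simple_functionD(1)[OF s] by simp
  define C where "C = Max (insert 0 ((\<lambda>t. norm (\<phi> t)) ` {a..b}))"
  have C: "norm (\<phi> t) \<le> C" if "t \<in> {a..b}" for t
    unfolding C_def using fin that by (intro Max_ge) auto
  show ?thesis
    by (rule Bochner_Integration.integrable_bound[of _ "\<lambda>_. C"])
      (use C borel_measurable_simple_function[OF s] in \<open>auto intro!: AE_I2 order_trans[OF _ abs_ge_self]\<close>)
qed

text \<open>Dominating functions with summable integrals tend to zero almost everywhere.\<close>

lemma approximable_imp_L1_on:
  assumes f: "L1_approximable a b f"
  shows "f \<in> L1_on {a..b}"
proof -
  have "\<exists>\<phi> g. simple_function (leb a b) \<phi> \<and> integrable (leb a b) g \<and>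
     (\<forall>t\<in>{a..b}. norm (f t - \<phi> t) \<le> g t) \<and> (LINT t|leb a b. g t) < (1/2) ^ n" for n :: nat
    using f unfolding L1_approximable_def by (elim allE[of _ "(1/2) ^ n"]) simp
  then obtain \<phi> g where \<phi>: "\<And>n. simple_function (leb a b) (\<phi> n)" and g: "\<And>n. integrable (leb a b) (g n)"
    and le: "\<And>n t. t \<in> {a..b} \<Longrightarrow> norm (f t - \<phi> n t) \<le> g n t"
    and small: "\<And>n. (LINT t|leb a b. g n t) < (1/2) ^ n"
    by metis
  have nn: "0 \<le> g n t" if "t \<in> {a..b}" for n t
    using order_trans[OF norm_ge_zero le[OF that]] .
  have "AE t in leb a b. summable (\<lambda>n. g n t)"
    by (rule AE_summable_of_integrals) (use g small nn in \<open>auto intro: less_imp_le\<close>)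
  then have "AE t in leb a b. (\<lambda>n. \<phi> n t) \<longlonglongrightarrow> f t"
    using AE_space
  proof eventually_elim
    case (elim t)
    then have t: "t \<in> {a..b}" and g0: "(\<lambda>n. g n t) \<longlonglongrightarrow> 0" using summable_LIMSEQ_zero by auto
    have "(\<lambda>n. norm (\<phi> n t - f t)) \<longlonglongrightarrow> 0"
      by (rule tendsto_sandwich[OF _ _ tendsto_const g0]) (use le[OF t] in \<open>auto simp: norm_minus_commute\<close>)
    then show ?case by (simp add: tendsto_norm_zero_iff LIM_zero_iff)
  qed
  then have lim: "AE t in leb a b. (\<lambda>n. \<phi> n t) \<longlonglongrightarrow> f t" .
  have meas: "(\<lambda>t. norm (f t)) \<in> borel_measurable (leb a b)"
  proof (rule measurable_AE_limit)
    show "(\<lambda>t. norm (\<phi> n t)) \<in> borel_measurable (leb a b)" for n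
      using integrable_simple_norm[OF \<phi>] by auto
    show "AE t in leb a b. (\<lambda>n. norm (\<phi> n t)) \<longlonglongrightarrow> norm (f t)"
      using lim by eventually_elim (rule tendsto_norm)
  qed
  have "norm (f t) \<le> norm (\<phi> 0 t) + g 0 t" if "t \<in> {a..b}" for t
    using le[OF that, of 0] norm_triangle_ineq2[of "f t" "\<phi> 0 t"] by linarith
  then have le0: "norm (norm (f t)) \<le> norm (norm (\<phi> 0 t) + g 0 t)" if "t \<in> {a..b}" for t
    unfolding real_norm_def using that abs_ge_self[of "norm (\<phi> 0 t) + g 0 t"] by fastforce
  have "integrable (leb a b) (\<lambda>t. norm (\<phi> 0 t) + g 0 t)"
    by (rule Bochner_Integration.integrable_add[OF integrable_simple_norm[OF \<phi>] g])
  then have "integrable (leb a b) (\<lambda>t. norm (f t))"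
    by (rule Bochner_Integration.integrable_bound[OF _ meas]) (rule AE_I2, use le0 in simp)
  then show ?thesis
    unfolding L1_on_def strongly_measurable_on_def using \<phi> lim by auto
qed

lemma L1_on_iff_approximable: "f \<in> L1_on {a..b} \<longleftrightarrow> L1_approximable a b f"
  using L1_on_imp_approximable approximable_imp_L1_on by blast

lemma L1_on_norm_integrable: "f \<in> L1_on {a..b} \<Longrightarrow> integrable (leb a b) (\<lambda>t. norm (f t))"
  by (simp add: L1_on_def)

lemma L1_on_diff: "f \<in> L1_on {a..b} \<Longrightarrow> h \<in> L1_on {a..b} \<Longrightarrow> (\<lambda>t. f t - h t) \<in> L1_on {a..b}"
  by (simp add: L1_on_iff_approximable L1_approximable_diff)

text \<open>The function \<open>norm (f t - g n t)\<close> is measurable because it is the limit of the functions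
  \<open>norm (g m t - g n t)\<close> as \<open>m\<close> grows.\<close>

lemma L1_on_dominated_limit:
  assumes g: "\<And>n. g n \<in> L1_on {a..b}" and lim: "AE t in leb a b. (\<lambda>n. g n t) \<longlonglongrightarrow> f t"
    and l: "integrable (leb a b) l" and le: "\<And>n. AE t in leb a b. norm (g n t) \<le> l t"
  shows "f \<in> L1_on {a..b}" "AE t in leb a b. norm (f t) \<le> l t" "(\<lambda>n. LINT t|leb a b. norm (f t - g n t)) \<longlonglongrightarrow> 0"
proof -
  show f_le: "AE t in leb a b. norm (f t) \<le> l t"
  proof -
    have "AE t in leb a b. \<forall>n. norm (g n t) \<le> l t" using le by (simp add: AE_all_countable)
    with lim show ?thesis
    proof eventually_elim
      case (elim t)
      show ?case by (rule Lim_bounded[OF tendsto_norm[OF elim(1)], of 0]) (use elim(2) in auto)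
    qed
  qed
  have le': "AE t in leb a b. norm (f t - g n t) \<le> 2 * l t" for n
    using f_le le[of n]
  proof eventually_elim
    case (elim t)
    then show ?case using norm_triangle_ineq4[of "f t" "g n t"] by linarith
  qed
  have m: "(\<lambda>t. norm (f t - g n t)) \<in> borel_measurable (leb a b)" for n
  proof (rule measurable_AE_limit)
    show "(\<lambda>t. norm (g m t - g n t)) \<in> borel_measurable (leb a b)" for m
      using L1_on_norm_integrable[OF L1_on_diff[OF g g]] by auto
    show "AE t in leb a b. (\<lambda>m. norm (g m t - g n t)) \<longlonglongrightarrow> norm (f t - g n t)"
      using lim by eventually_elim (intro tendsto_intros)
  qed
  have int: "integrable (leb a b) (\<lambda>t. norm (f t - g n t))" for n
    by (rule Bochner_Integration.integrable_bound[of _ "\<lambda>t. 2 * l t"])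
      (use l m le'[of n] in \<open>auto elim!: eventually_mono\<close>)
  have "(\<lambda>n. LINT t|leb a b. norm (f t - g n t)) \<longlonglongrightarrow> (LINT t|leb a b. (0::real))"
  proof (rule integral_dominated_convergence[where w = "\<lambda>t. 2 * l t"])
    show "AE t in leb a b. (\<lambda>n. norm (f t - g n t)) \<longlonglongrightarrow> 0"
      using lim
    proof eventually_elim
      case (elim t)
      have "(\<lambda>n. norm (f t - g n t)) \<longlonglongrightarrow> norm (f t - f t)" by (intro tendsto_intros elim)
      then show ?case by simp
    qed
  qed (use l m le' in auto)
  then show conv: "(\<lambda>n. LINT t|leb a b. norm (f t - g n t)) \<longlonglongrightarrow> 0" by simp
  show "f \<in> L1_on {a..b}"
    unfolding L1_on_iff_approximable
  proof (rule L1_approximable_limit)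
    fix e :: real assume "e > 0"
    then have "\<forall>\<^sub>F n in sequentially. (LINT t|leb a b. norm (f t - g n t)) < e"
      by (intro order_tendstoD[OF conv])
    then obtain n where "(LINT t|leb a b. norm (f t - g n t)) < e" by (auto simp: eventually_sequentially)
    then show "\<exists>h g. L1_approximable a b h \<and> integrable (leb a b) g \<and>
      (AE t in leb a b. norm (f t - h t) \<le> g t) \<and> (LINT t|leb a b. g t) < e"
      using g[of n] int[of n] unfolding L1_on_iff_approximable
      by (intro exI[of _ "g n"] exI[of _ "\<lambda>t. norm (f t - g n t)"]) auto
  qed
qed

subsection \<open>Convergence of forward convex combinations\<close>

text \<open>The convex hull of \<open>f n, f (n + 1), \<dots>\<close>. The weights are defined on all indices and vanish
  outside a finite range, so that two combinations can be written over a common range.\<close>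

definition tail_convex_combs :: "(nat \<Rightarrow> real \<Rightarrow> 'a::real_vector) \<Rightarrow> nat \<Rightarrow> (real \<Rightarrow> 'a) set" where
  "tail_convex_combs f n = {u. \<exists>m \<alpha>. (\<forall>k. 0 \<le> \<alpha> k) \<and> (\<forall>k. k < n \<or> m \<le> k \<longrightarrow> \<alpha> k = 0) \<and>
     (\<Sum>k<m. \<alpha> k) = 1 \<and> u = (\<lambda>t. \<Sum>k<m. \<alpha> k *\<^sub>R f k t)}"

lemma tail_convex_combsE:
  assumes "u \<in> tail_convex_combs f n"
  obtains m \<alpha> where "\<forall>k. 0 \<le> \<alpha> k" "\<forall>k. k < n \<or> m \<le> k \<longrightarrow> \<alpha> k = 0" "(\<Sum>k<m. \<alpha> k) = 1"
    "u = (\<lambda>t. \<Sum>k<m. \<alpha> k *\<^sub>R f k t)"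
  using assms unfolding tail_convex_combs_def by blast

lemma tail_convex_combs_self: "f n \<in> tail_convex_combs f n"
proof -
  have "(\<Sum>k<Suc n. (if k = n then 1 else 0) *\<^sub>R f k t) = f n t" for t
    by (simp add: if_distrib[of "\<lambda>c. c *\<^sub>R _"] cong: if_cong)
  then show ?thesis
    unfolding tail_convex_combs_def
    by (intro CollectI exI[of _ "Suc n"] exI[of _ "\<lambda>k. if k = n then 1 else 0"]) auto
qed

lemma tail_convex_combs_mono: "n \<le> n' \<Longrightarrow> tail_convex_combs f n' \<subseteq> tail_convex_combs f n"
  unfolding tail_convex_combs_def by (smt (verit) Collect_mono_iff order_less_le_trans)

lemma tail_convex_combs_midpoint:
  assumes u: "u \<in> tail_convex_combs f n" and v: "v \<in> tail_convex_combs f n"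
  shows "(\<lambda>t. (1/2) *\<^sub>R (u t + v t)) \<in> tail_convex_combs f n"
proof -
  obtain m \<alpha> where 1: "\<forall>k. 0 \<le> \<alpha> k" "\<forall>k. k < n \<or> m \<le> k \<longrightarrow> \<alpha> k = 0" "(\<Sum>k<m. \<alpha> k) = 1"
    "u = (\<lambda>t. \<Sum>k<m. \<alpha> k *\<^sub>R f k t)" using u by (rule tail_convex_combsE)
  obtain m' \<beta> where 2: "\<forall>k. 0 \<le> \<beta> k" "\<forall>k. k < n \<or> m' \<le> k \<longrightarrow> \<beta> k = 0" "(\<Sum>k<m'. \<beta> k) = 1"
    "v = (\<lambda>t. \<Sum>k<m'. \<beta> k *\<^sub>R f k t)" using v by (rule tail_convex_combsE)
  define M where "M = max m m'"
  have \<alpha>: "(\<Sum>k<M. \<alpha> k) = 1" "u t = (\<Sum>k<M. \<alpha> k *\<^sub>R f k t)" for t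
  proof -
    show "(\<Sum>k<M. \<alpha> k) = 1"
      unfolding 1(3)[symmetric] by (rule sum.mono_neutral_right) (use 1(2) in \<open>auto simp: M_def\<close>)
    show "u t = (\<Sum>k<M. \<alpha> k *\<^sub>R f k t)"
      unfolding 1(4) by (rule sum.mono_neutral_left) (use 1(2) in \<open>auto simp: M_def\<close>)
  qed
  have \<beta>: "(\<Sum>k<M. \<beta> k) = 1" "v t = (\<Sum>k<M. \<beta> k *\<^sub>R f k t)" for t
  proof -
    show "(\<Sum>k<M. \<beta> k) = 1"
      unfolding 2(3)[symmetric] by (rule sum.mono_neutral_right) (use 2(2) in \<open>auto simp: M_def\<close>)
    show "v t = (\<Sum>k<M. \<beta> k *\<^sub>R f k t)"
      unfolding 2(4) by (rule sum.mono_neutral_left) (use 2(2) in \<open>auto simp: M_def\<close>)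
  qed
  show ?thesis
    unfolding tail_convex_combs_def
  proof (intro CollectI exI conjI)
    show "\<forall>k. 0 \<le> (\<alpha> k + \<beta> k) / 2" using 1(1) 2(1) by auto
    show "\<forall>k. k < n \<or> M \<le> k \<longrightarrow> (\<alpha> k + \<beta> k) / 2 = 0" using 1(2) 2(2) by (auto simp: M_def)
    show "(\<Sum>k<M. (\<alpha> k + \<beta> k) / 2) = 1"
      using \<alpha>(1) \<beta>(1) by (simp add: sum_divide_distrib[symmetric] sum.distrib)
    show "(\<lambda>t. (1/2) *\<^sub>R (u t + v t)) = (\<lambda>t. \<Sum>k<M. ((\<alpha> k + \<beta> k) / 2) *\<^sub>R f k t)"
      unfolding \<alpha>(2) \<beta>(2)
      by (simp add: sum.distrib[symmetric] scaleR_sum_right scaleR_add_left[symmetric] add_divide_distrib)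
  qed
qed

lemma tail_convex_combs_mem:
  assumes u: "u \<in> tail_convex_combs f n" and V: "convex V" and mem: "\<And>k. n \<le> k \<Longrightarrow> f k t \<in> V"
  shows "u t \<in> V"
proof -
  obtain m \<alpha> where 1: "\<forall>k. 0 \<le> \<alpha> k" "\<forall>k. k < n \<or> m \<le> k \<longrightarrow> \<alpha> k = 0" "(\<Sum>k<m. \<alpha> k) = 1"
    "u = (\<lambda>t. \<Sum>k<m. \<alpha> k *\<^sub>R f k t)" using u by (rule tail_convex_combsE)
  have "(\<Sum>k\<in>{n..<m}. \<alpha> k) = (\<Sum>k<m. \<alpha> k)"
    "(\<Sum>k\<in>{n..<m}. \<alpha> k *\<^sub>R f k t) = (\<Sum>k<m. \<alpha> k *\<^sub>R f k t)"
    by (rule sum.mono_neutral_left; use 1(2) in auto)+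
  moreover have "(\<Sum>k\<in>{n..<m}. \<alpha> k) = 1 \<Longrightarrow> (\<Sum>k\<in>{n..<m}. \<alpha> k *\<^sub>R f k t) \<in> V"
    by (rule convex_sum[OF _ V]) (use 1(1) mem in auto)
  ultimately show ?thesis using 1(3,4) by simp
qed

lemma tail_convex_combs_L1:
  assumes "\<And>n. f n \<in> L1_on {a..b}" "u \<in> tail_convex_combs f n"
  shows "u \<in> L1_on {a..b}"
  using assms(2)
proof (rule tail_convex_combsE)
  fix m \<alpha> assume "u = (\<lambda>t. \<Sum>k<m. \<alpha> k *\<^sub>R f k t)"
  then show ?thesis
    using assms(1) by (auto simp: L1_on_iff_approximable intro!: L1_approximable_sum L1_approximable_scaleR)
qed

lemma convergent_if_summable_increments:
  fixes x :: "nat \<Rightarrow> 'a::{real_normed_vector,complete_space}"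
  assumes "summable (\<lambda>k. norm (x (Suc k) - x k))"
  shows "convergent x"
proof -
  define s where "s n = (\<Sum>k<n. norm (x (Suc k) - x k))" for n
  have le: "norm (x m - x n) \<le> s m - s n" if "n \<le> m" for m n
    using that
  proof (induction rule: dec_induct)
    case (step m)
    have "norm (x (Suc m) - x n) \<le> norm (x (Suc m) - x m) + norm (x m - x n)"
      using norm_triangle_ineq[of "x (Suc m) - x m" "x m - x n"] by simp
    then show ?case using step by (simp add: s_def)
  qed simp
  have "Cauchy s"
    using assms unfolding s_def summable_iff_convergent by (rule convergent_Cauchy)
  have "Cauchy x"
  proof (rule metric_CauchyI)
    fix e :: real assume "e > 0"
    then obtain M where M: "\<And>m n. m \<ge> M \<Longrightarrow> n \<ge> M \<Longrightarrow> dist (s m) (s n) < e"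
      using \<open>Cauchy s\<close> unfolding Cauchy_def by blast
    show "\<exists>M. \<forall>m\<ge>M. \<forall>n\<ge>M. dist (x m) (x n) < e"
    proof (intro exI[of _ M] allI impI)
      fix m n assume mn: "M \<le> m" "M \<le> n"
      have "dist (x m) (x n) \<le> dist (s m) (s n)"
      proof (cases "n \<le> m")
        case True then show ?thesis using le[OF True] by (simp add: dist_norm)
      next
        case False
        then have "norm (x n - x m) \<le> s n - s m" by (intro le) simp
        then show ?thesis by (simp add: dist_norm norm_minus_commute)
      qed
      then show "dist (x m) (x n) < e" using M[OF mn] by simp
    qed
  qed
  then show ?thesis using Cauchy_convergent_iff by blast
qed

text \<open>Dividing by \<open>l + 1\<close> turns the integrable bound \<open>l\<close> into a bound in a weighted \<open>L\<^sup>2\<close> space.\<close>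

lemma weighted_square_integrable:
  assumes u: "u \<in> L1_on {a..b}" and l: "integrable (leb a b) l" "\<And>t. t \<in> {a..b} \<Longrightarrow> 0 \<le> l t"
    and le: "AE t in leb a b. norm (u t) \<le> c * l t"
  shows "integrable (leb a b) (\<lambda>t. (norm (u t))\<^sup>2 / (l t + 1))"
    and "(LINT t|leb a b. (norm (u t))\<^sup>2 / (l t + 1)) \<le> c\<^sup>2 * (LINT t|leb a b. l t)"
proof -
  have [measurable]: "(\<lambda>t. norm (u t)) \<in> borel_measurable (leb a b)" "l \<in> borel_measurable (leb a b)"
    using L1_on_norm_integrable[OF u] l by auto
  have bd: "AE t in leb a b. 0 \<le> (norm (u t))\<^sup>2 / (l t + 1) \<and> (norm (u t))\<^sup>2 / (l t + 1) \<le> c\<^sup>2 * l t"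
    using le AE_space
  proof eventually_elim
    case (elim t)
    then have t: "0 \<le> l t" using l(2) by simp
    have "(norm (u t))\<^sup>2 \<le> (c * l t)\<^sup>2" using elim by (intro power_mono) auto
    also have "\<dots> \<le> (c\<^sup>2 * l t) * (l t + 1)"
      using t by (simp add: power_mult_distrib power2_eq_square[of "l t"] mult.assoc mult_left_mono)
    finally show ?case using t by (simp add: divide_le_eq)
  qed
  show 1: "integrable (leb a b) (\<lambda>t. (norm (u t))\<^sup>2 / (l t + 1))"
  proof (rule Bochner_Integration.integrable_bound)
    show "integrable (leb a b) (\<lambda>t. c\<^sup>2 * l t)" using l by simp
    show "AE t in leb a b. norm ((norm (u t))\<^sup>2 / (l t + 1)) \<le> norm (c\<^sup>2 * l t)"
      using bd by eventually_elim (simp only: real_norm_def, linarith)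
  qed measurable
  have "(LINT t|leb a b. (norm (u t))\<^sup>2 / (l t + 1)) \<le> (LINT t|leb a b. c\<^sup>2 * l t)"
    by (rule integral_mono_AE[OF 1]) (use l bd in \<open>auto elim!: eventually_mono\<close>)
  then show "(LINT t|leb a b. (norm (u t))\<^sup>2 / (l t + 1)) \<le> c\<^sup>2 * (LINT t|leb a b. l t)" by simp
qed

text \<open>In place of the Cauchy-Schwarz inequality, this integrates \<open>v \<le> v\<^sup>2 / (\<eta> q) + \<eta> q\<close> with
  \<open>v = norm (u t)\<close> and \<open>q = l t + 1\<close>.\<close>

lemma norm_integral_le_weighted_square:
  assumes u: "u \<in> L1_on {a..b}" and l: "integrable (leb a b) l" "\<And>t. t \<in> {a..b} \<Longrightarrow> 0 \<le> l t"
    and sq: "integrable (leb a b) (\<lambda>t. (norm (u t))\<^sup>2 / (l t + 1))" and \<eta>: "\<eta> > 0"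
  shows "(LINT t|leb a b. norm (u t))
    \<le> (LINT t|leb a b. (norm (u t))\<^sup>2 / (l t + 1)) / \<eta> + \<eta> * (LINT t|leb a b. l t + 1)"
proof -
  have pt: "norm (u t) \<le> (norm (u t))\<^sup>2 / (l t + 1) / \<eta> + \<eta> * (l t + 1)" if "t \<in> {a..b}" for t
  proof -
    have p: "\<eta> * (l t + 1) > 0" using l(2)[OF that] \<eta> by simp
    have q: "0 \<le> (norm (u t))\<^sup>2 / (l t + 1) / \<eta>" using l(2)[OF that] \<eta> by simp
    show ?thesis
    proof (cases "norm (u t) \<le> \<eta> * (l t + 1)")
      case False
      then have "norm (u t) * (\<eta> * (l t + 1)) \<le> norm (u t) * norm (u t)" by (intro mult_left_mono) auto
      then have "norm (u t) \<le> (norm (u t))\<^sup>2 / (\<eta> * (l t + 1))"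
        using p by (simp add: le_divide_eq power2_eq_square)
      then show ?thesis using p by (simp add: mult.commute)
    qed (use q in simp)
  qed
  have int: "integrable (leb a b) (\<lambda>t. (norm (u t))\<^sup>2 / (l t + 1) / \<eta>)"
    "integrable (leb a b) (\<lambda>t. \<eta> * (l t + 1))"
    by (rule integrable_divide[OF sq]) (use l(1) in auto)
  have "(LINT t|leb a b. norm (u t)) \<le> (LINT t|leb a b. (norm (u t))\<^sup>2 / (l t + 1) / \<eta> + \<eta> * (l t + 1))"
    by (rule integral_mono[OF L1_on_norm_integrable[OF u] Bochner_Integration.integrable_add[OF int]])
      (use pt in simp)
  also have "\<dots> = (LINT t|leb a b. (norm (u t))\<^sup>2 / (l t + 1)) / \<eta> + \<eta> * (LINT t|leb a b. l t + 1)"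
    by (simp only: Bochner_Integration.integral_add[OF int] integral_divide_zero integral_mult_right_zero)
  finally show ?thesis .
qed

text \<open>Choosing from the convex hull of each tail an almost minimizer of the weighted square
  norm gives a Cauchy sequence by the parallelogram law: the midpoint of two late choices lies
  in the hull of an early tail and cannot have much smaller norm. This replaces weak
  compactness in \<open>L\<^sup>1\<close> together with Mazur's lemma.\<close>

theorem forward_convex_combinations_converge:
  fixes f :: "nat \<Rightarrow> real \<Rightarrow> 'x::{real_inner,complete_space}"
  assumes f: "\<And>n. f n \<in> L1_on {a..b}" and l: "integrable (leb a b) l" "\<And>t. t \<in> {a..b} \<Longrightarrow> 0 \<le> l t"
    and le: "\<And>n. AE t in leb a b. norm (f n t) \<le> l t"
  obtains h g where "\<And>n. g n \<in> tail_convex_combs f n" "AE t in leb a b. (\<lambda>n. g n t) \<longlonglongrightarrow> h t"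
proof -
  define C where "C n = tail_convex_combs f n" for n
  define J where "J u = (LINT t|leb a b. (norm (u t :: 'x))\<^sup>2 / (l t + 1))" for u
  define \<Lambda> where "\<Lambda> = (LINT t|leb a b. l t + 1)"
  have \<Lambda>: "\<Lambda> \<ge> 0" unfolding \<Lambda>_def
    by (rule Bochner_Integration.integral_nonneg) (use l in auto)
  have L1: "u \<in> L1_on {a..b}" if "u \<in> C n" for u n
    using tail_convex_combs_L1[OF f] that by (auto simp: C_def)
  have bound: "AE t in leb a b. norm (u t) \<le> 1 * l t" if "u \<in> C n" for u n
  proof -
    have "AE t in leb a b. \<forall>n. norm (f n t) \<le> l t" using le by (simp add: AE_all_countable)
    then show ?thesis
    proof eventually_elim
      case (elim t)
      have "u t \<in> cball 0 (l t)"
        by (rule tail_convex_combs_mem[OF that[unfolded C_def] convex_cball]) (use elim in auto)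
      then show ?case by simp
    qed
  qed
  have diff_bound: "AE t in leb a b. norm (u t - v t) \<le> 2 * l t" if "u \<in> C n" "v \<in> C m" for u v n m
    using bound[OF that(1)] bound[OF that(2)]
  proof eventually_elim
    case (elim t)
    then show ?case using norm_triangle_ineq4[of "u t" "v t"] by linarith
  qed
  have int: "integrable (leb a b) (\<lambda>t. (norm (u t))\<^sup>2 / (l t + 1))" if "u \<in> C n" for u n
    by (rule weighted_square_integrable(1)[OF L1[OF that] l bound[OF that]])
  have int_diff: "integrable (leb a b) (\<lambda>t. (norm (u t - v t))\<^sup>2 / (l t + 1))"
    if "u \<in> C n" "v \<in> C m" for u v n m
    by (rule weighted_square_integrable(1)[OF L1_on_diff[OF L1[OF that(1)] L1[OF that(2)]] l diff_bound[OF that]])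
  have J_nonneg: "0 \<le> J u" for u
    unfolding J_def using l(2) by (intro Bochner_Integration.integral_nonneg) auto
  have J_le: "J u \<le> (LINT t|leb a b. l t)" if "u \<in> C n" for u n
    using weighted_square_integrable(2)[OF L1[OF that] l bound[OF that]] by (simp add: J_def)
  define d where "d n = Inf (J ` C n)" for n
  have bdd: "bdd_below (J ` C n)" for n using J_nonneg by (auto intro: bdd_belowI[of _ 0])
  have ne: "f n \<in> C n" for n by (simp add: C_def tail_convex_combs_self)
  have d_le: "d n \<le> J u" if "u \<in> C n" for u n
    unfolding d_def using that bdd by (auto intro: cInf_lower)
  have sub: "C m \<subseteq> C n" if "n \<le> m" for n m
    unfolding C_def using that by (rule tail_convex_combs_mono)
  have "incseq d"
    unfolding incseq_def d_def
  proof (intro allI impI)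
    fix m n :: nat assume "m \<le> n"
    then show "Inf (J ` C m) \<le> Inf (J ` C n)"
      using ne[of n] by (intro cInf_superset_mono bdd image_mono sub) blast+
  qed
  moreover have "\<forall>n. d n \<le> (LINT t|leb a b. l t)"
    using d_le[OF ne] J_le[OF ne] order_trans by blast
  ultimately obtain D where D: "d \<longlonglongrightarrow> D" "\<forall>i. d i \<le> D" by (rule incseq_convergent)
  have "\<exists>u\<in>C n. J u < d n + 1 / real (Suc n)" for n
  proof -
    have "\<exists>y\<in>J ` C n. y < d n + 1 / real (Suc n)"
      using ne[of n] unfolding d_def by (intro cInf_lessD) auto
    then show ?thesis by blast
  qed
  then obtain g where g: "\<And>n. g n \<in> C n" "\<And>n. J (g n) < d n + 1 / real (Suc n)" by metis
  have parallelogram: "J (\<lambda>t. u t - v t) = 2 * J u + 2 * J v - 4 * J (\<lambda>t. (1/2) *\<^sub>R (u t + v t))"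
    if uv: "u \<in> C n" "v \<in> C n" for u v n
  proof -
    define w where "w t = (1/2) *\<^sub>R (u t + v t)" for t
    have w: "w \<in> C n" using tail_convex_combs_midpoint uv by (simp add: C_def w_def[abs_def])
    have pt: "(norm (u t - v t))\<^sup>2 / (l t + 1) = 2 * ((norm (u t))\<^sup>2 / (l t + 1)) + 2 * ((norm (v t))\<^sup>2 / (l t + 1))
        - 4 * ((norm (w t))\<^sup>2 / (l t + 1))" for t
    proof -
      have w2: "(norm (w t))\<^sup>2 = (norm (u t + v t))\<^sup>2 / 4" by (simp add: w_def power_divide)
      have "(norm (u t - v t))\<^sup>2 = 2 * (norm (u t))\<^sup>2 + 2 * (norm (v t))\<^sup>2 - 4 * (norm (w t))\<^sup>2"
      proof -
        have "(norm (u t + v t))\<^sup>2 = (norm (u t))\<^sup>2 + 2 * (u t \<bullet> v t) + (norm (v t))\<^sup>2"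
          using norm_diff_square[of "u t" "- v t"] by simp
        then show ?thesis using w2 norm_diff_square[of "u t" "v t"] by linarith
      qed
      then show ?thesis by (simp add: add_divide_distrib diff_divide_distrib)
    qed
    note ints = integrable_mult_right[OF int[OF uv(1)], of 2] integrable_mult_right[OF int[OF uv(2)], of 2]
      integrable_mult_right[OF int[OF w], of 4]
    show ?thesis
      unfolding J_def w_def[symmetric] pt
      by (simp only: Bochner_Integration.integral_diff[OF Bochner_Integration.integrable_add[OF ints(1,2)] ints(3)]
          Bochner_Integration.integral_add[OF ints(1,2)] integral_mult_right_zero)
  qed
  have cauchy: "J (\<lambda>t. g n t - g m t) \<le> 2 * (D - d n) + 4 / real (Suc n)" if nm: "n \<le> m" for n m
  proof -
    have gm: "g m \<in> C n" using g(1) sub[OF nm] by blast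
    have "(\<lambda>t. (1/2) *\<^sub>R (g n t + g m t)) \<in> C n"
      using tail_convex_combs_midpoint g(1)[of n] gm unfolding C_def by blast
    then have "d n \<le> J (\<lambda>t. (1/2) *\<^sub>R (g n t + g m t))" by (rule d_le)
    moreover have "1 / real (Suc m) \<le> 1 / real (Suc n)" using nm by (simp add: frac_le)
    moreover have "d m \<le> D" using D(2) by blast
    ultimately have "J (\<lambda>t. g n t - g m t) \<le> 2 * (D - d n) + 4 * (1 / real (Suc n))"
      using parallelogram[OF g(1)[of n] gm] g(2)[of n] g(2)[of m] by argo
    then show ?thesis by simp
  qed
  have L1_cauchy: "\<exists>N. \<forall>n m. N \<le> n \<and> n \<le> m \<longrightarrow> (LINT t|leb a b. norm (g n t - g m t)) \<le> e" if e: "e > 0" for e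
  proof -
    define \<eta> where "\<eta> = (e / 2) / (\<Lambda> + 1)"
    have \<eta>: "\<eta> > 0" using e \<Lambda> by (simp add: \<eta>_def)
    have "(\<lambda>n. 2 * (D - d n) + 4 * inverse (real (Suc n))) \<longlonglongrightarrow> 2 * (D - D) + 4 * 0"
      by (intro tendsto_intros D LIMSEQ_inverse_real_of_nat)
    then have "\<forall>\<^sub>F n in sequentially. 2 * (D - d n) + 4 * inverse (real (Suc n)) < \<eta> * (e / 2)"
      by (rule order_tendstoD) (use \<eta> e in simp)
    then obtain N where N: "\<And>n. n \<ge> N \<Longrightarrow> 2 * (D - d n) + 4 / real (Suc n) < \<eta> * (e / 2)"
      unfolding eventually_sequentially by (auto simp: inverse_eq_divide)
    show ?thesis
    proof (intro exI[of _ N] allI impI, elim conjE)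
      fix n m assume nm: "N \<le> n" "n \<le> m"
      have "(LINT t|leb a b. norm (g n t - g m t)) \<le> J (\<lambda>t. g n t - g m t) / \<eta> + \<eta> * \<Lambda>"
        unfolding J_def \<Lambda>_def
        by (rule norm_integral_le_weighted_square[OF L1_on_diff[OF L1[OF g(1)] L1[OF g(1)]] l _ \<eta>])
          (assumption, rule int_diff[OF g(1) g(1)])
      also have "\<dots> \<le> e / 2 + e / 2"
      proof (rule add_mono)
        have "J (\<lambda>t. g n t - g m t) \<le> \<eta> * (e / 2)" using cauchy[OF nm(2)] N[OF nm(1)] by simp
        then show "J (\<lambda>t. g n t - g m t) / \<eta> \<le> e / 2" using \<eta> by (simp add: divide_le_eq mult.commute)
        have "\<eta> * \<Lambda> \<le> \<eta> * (\<Lambda> + 1)" using \<eta> by (intro mult_left_mono) auto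
        also have "\<dots> = e / 2"
        proof -
          have "x / y * y = x" if "y \<noteq> 0" for x y :: real using that by simp
          then show ?thesis unfolding \<eta>_def by this (use \<Lambda> in simp)
        qed
        finally show "\<eta> * \<Lambda> \<le> e / 2" .
      qed
      finally show "(LINT t|leb a b. norm (g n t - g m t)) \<le> e" by simp
    qed
  qed
  have "\<exists>N. \<forall>n m. N \<le> n \<and> n \<le> m \<longrightarrow> (LINT t|leb a b. norm (g n t - g m t)) \<le> (1/2) ^ k" for k :: nat
    by (rule L1_cauchy) simp
  then obtain N where N: "\<And>k n m. N k \<le> n \<Longrightarrow> n \<le> m \<Longrightarrow> (LINT t|leb a b. norm (g n t - g m t)) \<le> (1/2) ^ k"
    by metis
  \<comment> \<open>an increasing choice of indices above \<open>k\<close> and \<open>N k\<close>\<close>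
  define r where "r k = k + (\<Sum>j\<le>k. N j)" for k
  have r: "N k \<le> r k" "k \<le> r k" "r k \<le> r (Suc k)" for k
  proof -
    have "N k \<le> (\<Sum>j\<le>k. N j)" by (rule member_le_sum) auto
    then show "N k \<le> r k" by (simp add: r_def)
  qed (auto simp: r_def)
  have "AE t in leb a b. summable (\<lambda>k. norm (g (r k) t - g (r (Suc k)) t))"
    by (rule AE_summable_of_integrals)
      (use L1_on_norm_integrable[OF L1_on_diff[OF L1[OF g(1)] L1[OF g(1)]]] N r in auto)
  then have "AE t in leb a b. (\<lambda>k. g (r k) t) \<longlonglongrightarrow> lim (\<lambda>k. g (r k) t)"
  proof eventually_elim
    case (elim t)
    then have "convergent (\<lambda>k. g (r k) t)"
      by (intro convergent_if_summable_increments) (simp add: norm_minus_commute)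
    then show ?case by (simp add: convergent_LIMSEQ_iff)
  qed
  moreover have "g (r k) \<in> tail_convex_combs f k" for k
    using g(1)[of "r k"] sub[OF r(2)[of k]] by (auto simp: C_def)
  ultimately show thesis by (rule that[rotated])
qed

section \<open>Uniform boundedness\<close>

text \<open>This is the gliding hump argument: in any ball around any point, each operator attains at least
  two thirds of its norm times the radius, so steps of geometrically decreasing size can be added up
  to a vector that violates pointwise boundedness. It is carried out on a subspace \<open>V\<close> that is
  complete for a norm \<open>p\<close> of its own, which is needed for the space \<open>E\<close> below. The ratio \<open>1/9\<close> makes
  the tail after step \<open>n\<close>, at most \<open>3 * (1/9) ^ (n + 1)\<close>, half as large as the gain at that step, and
  operator norms of at least \<open>18 ^ n\<close> then outgrow the decreasing steps.\<close>

lemma uniform_boundedness_subspace: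
  fixes p :: "'a::real_vector \<Rightarrow> real" and T :: "'i \<Rightarrow> 'a \<Rightarrow> 'b::real_normed_vector"
  assumes V: "subspace V"
    and p_nonneg: "\<And>x. x \<in> V \<Longrightarrow> 0 \<le> p x"
    and p_scale: "\<And>c x. x \<in> V \<Longrightarrow> p (c *\<^sub>R x) = \<bar>c\<bar> * p x"
    and complete: "\<And>e. (\<And>n. e n \<in> V) \<Longrightarrow> (\<And>n. p (e n) \<le> (1/9) ^ n) \<Longrightarrow>
        \<exists>x\<in>V. \<forall>n. p (x - (\<Sum>k<n. e k)) \<le> 3 * (1/9) ^ n"
    and T_add: "\<And>i x y. i \<in> I \<Longrightarrow> x \<in> V \<Longrightarrow> y \<in> V \<Longrightarrow> T i (x + y) = T i x + T i y"
    and T_scale: "\<And>i c x. i \<in> I \<Longrightarrow> x \<in> V \<Longrightarrow> T i (c *\<^sub>R x) = c *\<^sub>R T i x"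
    and T_bounded: "\<And>i. i \<in> I \<Longrightarrow> \<exists>K. \<forall>x\<in>V. norm (T i x) \<le> K * p x"
    and pointwise: "\<And>x. x \<in> V \<Longrightarrow> \<exists>K. \<forall>i\<in>I. norm (T i x) \<le> K"
  shows "\<exists>K. \<forall>i\<in>I. \<forall>x\<in>V. norm (T i x) \<le> K * p x"
proof (rule ccontr)
  assume unbounded: "\<not> ?thesis"
  define P where "P i = {norm (T i x) | x. x \<in> V \<and> p x \<le> 1}" for i
  define Q where "Q i = Sup (P i)" for i
  have bdd: "bdd_above (P i)" if i: "i \<in> I" for i
  proof -
    obtain K where K: "\<And>x. x \<in> V \<Longrightarrow> norm (T i x) \<le> K * p x" using T_bounded[OF i] by blast
    have "y \<le> \<bar>K\<bar>" if y: "y \<in> P i" for y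
    proof -
      obtain x where x: "y = norm (T i x)" "x \<in> V" "p x \<le> 1" using y unfolding P_def by blast
      have "y \<le> K * p x" using K x by simp
      also have "\<dots> \<le> \<bar>K\<bar> * 1" using p_nonneg[OF x(2)] x(3) by (intro mult_mono) auto
      finally show ?thesis by simp
    qed
    then show ?thesis by (rule bdd_aboveI)
  qed
  have zero: "0 \<in> V" using V by (simp add: subspace_0)
  have p0: "p 0 = 0" using p_scale[OF zero, of 0] by simp
  have P_ne: "P i \<noteq> {}" for i unfolding P_def using zero p0 by force
  have Q_bound: "norm (T i x) \<le> Q i * p x" if i: "i \<in> I" and x: "x \<in> V" for i x
  proof (cases "p x = 0")
    case True
    then show ?thesis using T_bounded[OF i] x by fastforce
  next
    case False
    then have pos: "p x > 0" using p_nonneg[OF x] by simp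
    have "norm (T i ((1 / p x) *\<^sub>R x)) \<in> P i"
      unfolding P_def using x V pos by (force simp: p_scale subspace_scale)
    then have "norm (T i ((1 / p x) *\<^sub>R x)) \<le> Q i" unfolding Q_def using bdd[OF i] by (rule cSup_upper)
    then show ?thesis using pos by (simp add: T_scale[OF i x] field_simps)
  qed
  have "\<exists>i\<in>I. Q i \<ge> 18 ^ n" for n :: nat
  proof (rule ccontr)
    assume "\<not> ?thesis"
    then have Q_le: "\<And>i. i \<in> I \<Longrightarrow> Q i \<le> 18 ^ n" by force
    have "norm (T i x) \<le> 18 ^ n * p x" if "i \<in> I" "x \<in> V" for i x
      using Q_bound[OF that] mult_right_mono[OF Q_le[OF that(1)] p_nonneg[OF that(2)]] by linarith
    then show False using unbounded by blast
  qed
  then obtain i where i: "\<And>n. i n \<in> I" "\<And>n. Q (i n) \<ge> 18 ^ n" by metis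
  have Q_pos: "Q (i n) > 0" for n using i(2)[of n] by (rule less_le_trans[rotated]) simp
  have "\<exists>y\<in>V. p y \<le> (1/9) ^ n \<and> 2/3 * Q (i n) * (1/9) ^ n \<le> norm (T (i n) (x + y))"
    if x: "x \<in> V" for x n
  proof -
    have "2/3 * Q (i n) < Q (i n)" using Q_pos[of n] by simp
    then have "\<exists>y\<in>P (i n). 2/3 * Q (i n) < y"
      unfolding Q_def[of "i n"] using less_cSup_iff[OF P_ne bdd[OF i(1)]] by blast
    then obtain z where z: "z \<in> V" "p z \<le> 1" "2/3 * Q (i n) < norm (T (i n) z)"
      unfolding P_def by blast
    define r :: real where "r = (1/9) ^ n"
    have r: "r > 0" by (simp add: r_def)
    define y where "y = r *\<^sub>R z"
    have y: "y \<in> V" "- y \<in> V" using z(1) V by (auto simp: y_def subspace_scale subspace_neg)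
    have py: "p y \<le> r" "p (- y) \<le> r"
      using p_scale[OF z(1), of r] p_scale[OF z(1), of "- r"] z(2) r by (auto simp: y_def)
    have Ty: "norm (T (i n) y) = r * norm (T (i n) z)" using r by (simp add: y_def T_scale[OF i(1) z(1)])
    have neg: "T (i n) (- y) = - T (i n) y" using T_scale[OF i(1)[of n] y(1), of "-1"] by simp
    have "T (i n) y + T (i n) y = T (i n) (x + y) - T (i n) (x + - y)"
      by (simp only: T_add[OF i(1) x y(1)] T_add[OF i(1) x y(2)] neg) simp
    then have "norm (T (i n) y + T (i n) y) \<le> norm (T (i n) (x + y)) + norm (T (i n) (x + - y))"
      by (simp only: norm_triangle_ineq4)
    moreover have "norm (T (i n) y + T (i n) y) = 2 * (r * norm (T (i n) z))"
      unfolding Ty[symmetric] scaleR_2[symmetric] by simp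
    ultimately have "r * norm (T (i n) z) \<le> norm (T (i n) (x + y)) \<or>
        r * norm (T (i n) z) \<le> norm (T (i n) (x + - y))" by linarith
    moreover have "2/3 * Q (i n) * r \<le> r * norm (T (i n) z)" using z(3) r by simp
    ultimately show ?thesis
      unfolding r_def[symmetric] using y py by (meson order_trans)
  qed
  then obtain Y where Y: "\<And>x n. x \<in> V \<Longrightarrow> Y x n \<in> V" "\<And>x n. x \<in> V \<Longrightarrow> p (Y x n) \<le> (1/9) ^ n"
    "\<And>x n. x \<in> V \<Longrightarrow> 2/3 * Q (i n) * (1/9) ^ n \<le> norm (T (i n) (x + Y x n))"
    by metis
  define s where "s = rec_nat 0 (\<lambda>n x. x + Y x n)"
  have s: "s 0 = 0" "\<And>n. s (Suc n) = s n + Y (s n) n" by (simp_all add: s_def)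
  have sV: "s n \<in> V" for n by (induction n) (auto simp: s zero intro!: subspace_add[OF V] Y)
  have s_sum: "s n = (\<Sum>k<n. Y (s k) k)" for n by (induction n) (auto simp: s)
  obtain x where x: "x \<in> V" "\<And>n. p (x - s n) \<le> 3 * (1/9) ^ n"
    using complete[of "\<lambda>n. Y (s n) n"] Y(1,2)[OF sV] unfolding s_sum[symmetric] by blast
  have lower: "1/3 * 2 ^ n \<le> norm (T (i n) x)" for n
  proof -
    have xs: "x - s (Suc n) \<in> V" using x(1) sV V by (simp add: subspace_diff)
    have "norm (T (i n) (x - s (Suc n))) \<le> Q (i n) * p (x - s (Suc n))" by (rule Q_bound[OF i(1) xs])
    also have "\<dots> \<le> Q (i n) * (3 * (1/9) ^ Suc n)" by (rule mult_left_mono[OF x(2)]) (use Q_pos[of n] in simp)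
    finally have 1: "norm (T (i n) (x - s (Suc n))) \<le> 1/3 * (Q (i n) * (1/9) ^ n)" by simp
    have 2: "2/3 * (Q (i n) * (1/9) ^ n) \<le> norm (T (i n) (s (Suc n)))" using Y(3)[OF sV, of n n] by (simp add: s)
    have "T (i n) x = T (i n) (s (Suc n)) + T (i n) (x - s (Suc n))"
      using T_add[OF i(1) sV[of "Suc n"] xs] by simp
    then have 3: "norm (T (i n) (s (Suc n))) - norm (T (i n) (x - s (Suc n))) \<le> norm (T (i n) x)"
      by (metis norm_diff_ineq)
    have "18 ^ n * (1/9) ^ n \<le> Q (i n) * (1/9) ^ n" using i(2) by (intro mult_right_mono) auto
    then have "2 ^ n \<le> Q (i n) * (1/9) ^ n" by (simp flip: power_mult_distrib)
    then show ?thesis using 1 2 3 by linarith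
  qed
  obtain K where K: "\<And>j. j \<in> I \<Longrightarrow> norm (T j x) \<le> K" using pointwise[OF x(1)] by blast
  obtain n where "3 * K < (2 :: real) ^ n" using real_arch_pow[of 2 "3 * K"] by auto
  then show False using lower[of n] K[OF i(1), of n] by linarith
qed

lemma geometric_increments_limit:
  fixes e :: "nat \<Rightarrow> 'a::{real_normed_vector,complete_space}"
  assumes e: "\<And>n. norm (e n) \<le> c * (1/9) ^ n"
  obtains x where "(\<lambda>n. \<Sum>k<n. e k) \<longlonglongrightarrow> x" "\<And>n. norm (x - (\<Sum>k<n. e k)) \<le> c * (3/2 * (1/9) ^ n)"
proof -
  have "summable (\<lambda>k. c * (1/9 :: real) ^ k)" by (intro summable_mult complete_algebra_summable_geometric) simp
  then have "summable (\<lambda>k. norm (e k))" by (rule summable_comparison_test'[of _ 0]) (use e in auto)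
  then have "convergent (\<lambda>n. \<Sum>k<n. e k)" by (intro convergent_if_summable_increments) simp
  then obtain x where x: "(\<lambda>n. \<Sum>k<n. e k) \<longlonglongrightarrow> x" by (auto simp: convergent_def)
  have c: "0 \<le> c" using order_trans[OF norm_ge_zero e[of 0]] by simp
  have step: "norm ((\<Sum>k<m. e k) - (\<Sum>k<n. e k)) \<le> c * (3/2 * (1/9) ^ n) - c * (3/2 * (1/9) ^ m)" if "n \<le> m" for n m
    using that
  proof (induction rule: dec_induct)
    case (step m)
    have "norm ((\<Sum>k<Suc m. e k) - (\<Sum>k<n. e k)) \<le> norm (e m) + norm ((\<Sum>k<m. e k) - (\<Sum>k<n. e k))"
      using norm_triangle_ineq[of "e m" "(\<Sum>k<m. e k) - (\<Sum>k<n. e k)"] by (simp add: algebra_simps)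
    moreover have "(0::real) \<le> (1/9) ^ m" by simp
    then have "c * (1/9) ^ m \<le> c * (3/2 * (1/9) ^ m) - c * (3/2 * (1/9) ^ Suc m)"
      using c by (simp add: right_diff_distrib[symmetric] mult_left_mono)
    ultimately show ?case using step.IH e[of m] by linarith
  qed simp
  have "norm (x - (\<Sum>k<n. e k)) \<le> c * (3/2 * (1/9) ^ n)" for n
  proof (rule Lim_bounded[of "\<lambda>m. norm ((\<Sum>k<m. e k) - (\<Sum>k<n. e k))" _ n])
    show "(\<lambda>m. norm ((\<Sum>k<m. e k) - (\<Sum>k<n. e k))) \<longlonglongrightarrow> norm (x - (\<Sum>k<n. e k))"
      by (intro tendsto_intros x)
    have "0 \<le> c * (3/2 * (1/9) ^ m)" for m using c by simp
    then show "\<forall>m\<ge>n. norm ((\<Sum>k<m. e k) - (\<Sum>k<n. e k)) \<le> c * (3/2 * (1/9) ^ n)"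
      using step by (smt (verit))
  qed
  with x show thesis by (rule that)
qed

lemma banach_steinhaus:
  fixes T :: "'i \<Rightarrow> 'a::{real_normed_vector,complete_space} \<Rightarrow>\<^sub>L 'b::real_normed_vector"
  assumes "\<And>x. \<exists>K. \<forall>i\<in>I. norm (T i x) \<le> K"
  obtains K where "\<And>i. i \<in> I \<Longrightarrow> norm (T i) \<le> K" "K > 0"
proof -
  have "\<exists>K. \<forall>i\<in>I. \<forall>x\<in>UNIV. norm (T i x) \<le> K * norm x"
  proof (rule uniform_boundedness_subspace)
    show "\<exists>x\<in>UNIV. \<forall>n. norm (x - (\<Sum>k<n. e k)) \<le> 3 * (1/9) ^ n"
      if e: "\<And>n. norm (e n) \<le> (1/9) ^ n" for e :: "nat \<Rightarrow> 'a"
    proof -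
      obtain x where x: "\<And>n. norm (x - (\<Sum>k<n. e k)) \<le> 1 * (3/2 * (1/9) ^ n)"
        by (rule geometric_increments_limit[of e 1]) (use e in auto)
      have "norm (x - (\<Sum>k<n. e k)) \<le> 3 * (1/9) ^ n" for n
        using x[of n] zero_le_power[of "1/9::real" n] by linarith
      then show ?thesis by blast
    qed
    show "\<exists>K. \<forall>x\<in>UNIV. norm (T i x) \<le> K * norm x" for i using norm_blinfun by blast
  qed (use assms in \<open>auto simp: blinfun.add_right blinfun.scaleR_right norm_triangle_ineq\<close>)
  then obtain K where K: "\<And>i x. i \<in> I \<Longrightarrow> norm (T i x) \<le> K * norm x" by blast
  have "norm (T i) \<le> \<bar>K\<bar> + 1" if "i \<in> I" for i
  proof (rule norm_blinfun_bound)
    show "norm (T i x) \<le> (\<bar>K\<bar> + 1) * norm x" for x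
      using K[OF that, of x] mult_right_mono[of K "\<bar>K\<bar> + 1" "norm x"] by fastforce
  qed simp
  moreover have "\<bar>K\<bar> + 1 > 0" by linarith
  ultimately show thesis using that by blast
qed

section \<open>Cosine families\<close>

lemma has_vector_derivative_Lipschitz:
  fixes f :: "real \<Rightarrow> 'a::real_normed_vector"
  assumes "\<And>t. t \<in> {a..b} \<Longrightarrow> (f has_vector_derivative f' t) (at t within {a..b})"
    and "\<And>t. t \<in> {a..b} \<Longrightarrow> norm (f' t) \<le> K" and "t \<in> {a..b}" "s \<in> {a..b}"
  shows "norm (f t - f s) \<le> K * \<bar>t - s\<bar>"
proof -
  have "norm (f t - f s) \<le> K * norm (t - s)"
  proof (rule differentiable_bound[of "{a..b}" f "\<lambda>t h. h *\<^sub>R f' t"])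
    show "(f has_derivative (\<lambda>h. h *\<^sub>R f' t)) (at t within {a..b})" if "t \<in> {a..b}" for t
      using assms(1)[OF that] by (simp add: has_vector_derivative_def)
    show "onorm (\<lambda>h. h *\<^sub>R f' t) \<le> K" if "t \<in> {a..b}" for t
      using assms(2)[OF that] by (simp add: onorm_scaleR_left onorm_id bounded_linear_ident)
  qed (use assms in auto)
  then show ?thesis by simp
qed

lemma derivative_eq_imp_eq:
  fixes f g :: "real \<Rightarrow> 'a::real_normed_vector"
  assumes f: "\<And>t. (f has_vector_derivative d t) (at t)" and g: "\<And>t. (g has_vector_derivative d t) (at t)"
    and 0: "f 0 = g 0"
  shows "f t = g t"
proof -
  define R where "R = \<bar>t\<bar>"
  have "norm ((f t - g t) - (f 0 - g 0)) \<le> 0 * \<bar>t - 0\<bar>"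
  proof (rule has_vector_derivative_Lipschitz[of "- R" R "\<lambda>t. f t - g t" "\<lambda>_. 0"])
    show "((\<lambda>t. f t - g t) has_vector_derivative 0) (at t within {- R..R})" for t
      using has_vector_derivative_diff[OF f[of t] g[of t]] by (auto intro: has_vector_derivative_at_within)
  qed (auto simp: R_def)
  then show ?thesis using 0 by simp
qed

lemma oriented_integral_has_vector_derivative:
  fixes w :: "real \<Rightarrow> 'x::{real_inner,complete_space}"
  assumes w: "continuous_on UNIV w"
  shows "((\<lambda>t. oriented_integral 0 t w) has_vector_derivative w t) (at t)"
proof -
  define R where "R = \<bar>t\<bar> + 1"
  define G where "G u = integral {- R..u} w" for u
  have cont: "continuous_on S w" for S using w by (rule continuous_on_subset) simp
  have "(G has_vector_derivative w t) (at t within {- R..R})"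
    unfolding G_def by (rule hilbert_integral_has_vector_derivative[OF cont]) (auto simp: R_def)
  then have "(G has_vector_derivative w t) (at t)"
    by (subst (asm) at_within_interior) (auto simp: R_def)
  then have "((\<lambda>u. G u - G 0) has_vector_derivative w t) (at t)"
    by (auto intro!: derivative_eq_intros)
  then show ?thesis
  proof (rule has_vector_derivative_transform_within_open[of _ _ _ "{- R<..<R}"])
    fix u assume that: "u \<in> {- R<..<R}"
    show "G u - G 0 = oriented_integral 0 u w"
  proof (cases "0 \<le> u")
    case True
    have "integral {- R..0} w + integral {0..u} w = integral {- R..u} w"
      using True that by (intro hilbert_integral_combine hilbert_integrable_continuous cont) auto
    then show ?thesis using True by (simp add: G_def oriented_integral_def algebra_simps)
  next
    case False
    have "integral {- R..u} w + integral {u..0} w = integral {- R..0} w"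
      using False that by (intro hilbert_integral_combine hilbert_integrable_continuous cont) auto
    then show ?thesis using False by (simp add: G_def oriented_integral_def algebra_simps)
  qed
  qed (auto simp: R_def)
qed

locale strongly_continuous_cosine_family =
  fixes C0 :: "real \<Rightarrow> 'x::{real_inner,complete_space} \<Rightarrow>\<^sub>L 'x"
  assumes cosine_family: "cosine_family C0"
begin

abbreviation S0 where "S0 \<equiv> sine_family C0"

lemma C_zero: "C0 0 = id_blinfun"
  and C_functional: "C0 (t + s) x + C0 (t - s) x = 2 *\<^sub>R C0 t (C0 s x)"
  and C_continuous: "continuous_on T (\<lambda>t. C0 t x)"
proof -
  have *: "C0 0 = id_blinfun" "\<forall>t s. C0 (t + s) + C0 (t - s) = 2 *\<^sub>R (C0 t o\<^sub>L C0 s)"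
     "\<forall>x. continuous_on UNIV (\<lambda>t. C0 t x)"
    using cosine_family unfolding cosine_family_def by blast+
  show "C0 0 = id_blinfun" by fact
  have "(C0 (t + s) + C0 (t - s)) x = (2 *\<^sub>R (C0 t o\<^sub>L C0 s)) x" using *(2) by simp
  then show "C0 (t + s) x + C0 (t - s) x = 2 *\<^sub>R C0 t (C0 s x)"
    by (simp add: blinfun.add_left blinfun.scaleR_left)
  show "continuous_on T (\<lambda>t. C0 t x)" using *(3) continuous_on_subset by blast
qed

lemma C_even: "C0 (- t) x = C0 t x"
  using C_functional[of 0 t x] by (simp add: C_zero scaleR_2)

lemma C_commute: "C0 t (C0 s x) = C0 s (C0 t x)"
proof -
  have "C0 (s - t) x = C0 (t - s) x" using C_even[of "t - s" x] by simp
  then have "2 *\<^sub>R C0 t (C0 s x) = 2 *\<^sub>R C0 s (C0 t x)"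
    using C_functional[of t s x] C_functional[of s t x] by (simp add: add.commute)
  then show ?thesis by simp
qed

lemma C_bounded:
  obtains M where "M > 0" "\<And>t. \<bar>t\<bar> \<le> R \<Longrightarrow> norm (C0 t) \<le> M"
proof -
  have "\<exists>K. \<forall>t\<in>{- R..R}. norm (C0 t x) \<le> K" for x
  proof -
    have "compact ((\<lambda>t. C0 t x) ` {- R..R})" by (rule compact_continuous_image[OF C_continuous]) simp
    from compact_imp_bounded[OF this] show ?thesis by (auto simp: bounded_iff)
  qed
  then obtain M where "\<And>t. t \<in> {- R..R} \<Longrightarrow> norm (C0 t) \<le> M" "M > 0" by (rule banach_steinhaus) blast
  then show thesis by (intro that[of M]) (auto simp: abs_le_iff)
qed

lemma S0_derivative: "((\<lambda>t. S0 t x) has_vector_derivative C0 t x) (at t)"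
  unfolding sine_family_def by (rule oriented_integral_has_vector_derivative[OF C_continuous])

lemma S0_zero [simp]: "S0 0 x = 0"
  by (simp add: sine_family_def oriented_integral_def)

lemma S0_shift_derivative:
  "((\<lambda>t. S0 (t + h) x) has_vector_derivative C0 (t + h) x) (at t)"
  "((\<lambda>t. S0 (h - t) x) has_vector_derivative - C0 (h - t) x) (at t)"
proof -
  have "((\<lambda>t. t + h) has_vector_derivative 1) (at t)" "((\<lambda>t. h - t) has_vector_derivative - 1) (at t)"
    by (auto intro!: derivative_eq_intros)
  note 1 = vector_diff_chain_at[OF this(1) S0_derivative] and 2 = vector_diff_chain_at[OF this(2) S0_derivative]
  show "((\<lambda>t. S0 (t + h) x) has_vector_derivative C0 (t + h) x) (at t)"
  "((\<lambda>t. S0 (h - t) x) has_vector_derivative - C0 (h - t) x) (at t)"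
    using 1 2 by (simp_all add: o_def)
qed

lemma S0_odd: "S0 (- t) x = - S0 t x"
proof -
  have "- S0 (0 - t) x = S0 t x"
  proof (rule derivative_eq_imp_eq[of "\<lambda>t. - S0 (0 - t) x" "\<lambda>t. C0 t x" "\<lambda>t. S0 t x"])
    show "((\<lambda>t. - S0 (0 - t) x) has_vector_derivative C0 t x) (at t)" for t
      using has_vector_derivative_minus[OF S0_shift_derivative(2)[of 0 x t]] by (simp add: C_even)
  qed (use S0_derivative in auto)
  then show ?thesis by (simp add: minus_equation_iff)
qed

lemma S0_add: "S0 t (x + y) = S0 t x + S0 t y"
proof (rule derivative_eq_imp_eq[of "\<lambda>t. S0 t (x + y)" "\<lambda>t. C0 t (x + y)" "\<lambda>t. S0 t x + S0 t y", OF S0_derivative])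
  show "((\<lambda>t. S0 t x + S0 t y) has_vector_derivative C0 t (x + y)) (at t)" for t
    using has_vector_derivative_add[OF S0_derivative S0_derivative] by (simp add: blinfun.add_right)
qed simp

lemma S0_scaleR: "S0 t (c *\<^sub>R x) = c *\<^sub>R S0 t x"
proof (rule derivative_eq_imp_eq[of "\<lambda>t. S0 t (c *\<^sub>R x)" "\<lambda>t. C0 t (c *\<^sub>R x)" "\<lambda>t. c *\<^sub>R S0 t x", OF S0_derivative])
  show "((\<lambda>t. c *\<^sub>R S0 t x) has_vector_derivative C0 t (c *\<^sub>R x)) (at t)" for t
    using bounded_linear.has_vector_derivative[OF bounded_linear_scaleR_right S0_derivative]
    by (simp add: blinfun.scaleR_right)
qed simp

lemma S0_Lipschitz:
  assumes M: "\<And>t. \<bar>t\<bar> \<le> R \<Longrightarrow> norm (C0 t) \<le> M" and "\<bar>t\<bar> \<le> R" "\<bar>s\<bar> \<le> R"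
  shows "norm (S0 t x - S0 s x) \<le> M * norm x * \<bar>t - s\<bar>"
proof (rule has_vector_derivative_Lipschitz[of "- R" R _ "\<lambda>t. C0 t x"])
  show "norm (C0 t x) \<le> M * norm x" if "t \<in> {- R..R}" for t
    using norm_blinfun[of "C0 t" x] mult_right_mono[OF M norm_ge_zero, of t x] that by (auto simp: abs_le_iff)
qed (use assms in \<open>auto intro: has_vector_derivative_at_within S0_derivative\<close>)

text \<open>Both sides have the same derivative with respect to \<open>u\<close> and vanish at \<open>0\<close>.\<close>

lemma C_S0: "C0 h (S0 u x) = (1/2) *\<^sub>R (S0 (u + h) x + S0 (u - h) x)"
proof (rule derivative_eq_imp_eq[of "\<lambda>u. C0 h (S0 u x)" "\<lambda>u. C0 h (C0 u x)"
    "\<lambda>u. (1/2) *\<^sub>R (S0 (u + h) x + S0 (u - h) x)"])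
  show "((\<lambda>u. C0 h (S0 u x)) has_vector_derivative C0 h (C0 u x)) (at u)" for u
    by (rule bounded_linear.has_vector_derivative[OF blinfun.bounded_linear_right S0_derivative])
  have der: "((\<lambda>u. (1/2) *\<^sub>R (S0 (u + h) x + S0 (u + - h) x)) has_vector_derivative
      (1/2) *\<^sub>R (C0 (u + h) x + C0 (u + - h) x)) (at u)" for u
    by (intro bounded_linear.has_vector_derivative[OF bounded_linear_scaleR_right]
        has_vector_derivative_add S0_shift_derivative)
  show "((\<lambda>u. (1/2) *\<^sub>R (S0 (u + h) x + S0 (u - h) x)) has_vector_derivative C0 h (C0 u x)) (at u)" for u
  proof -
    have "(1/2) *\<^sub>R (C0 (u + h) x + C0 (u + - h) x) = C0 h (C0 u x)"
      using C_functional[of u h x] C_commute[of u h x] by simp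
    with der[of u] show ?thesis by (simp only: diff_conv_add_uminus)
  qed
qed (simp add: S0_odd)

text \<open>On \<open>E\<close> this derivative exists, and it equals \<open>A S\<^sub>0(t)\<close>.\<close>

definition Cd where "Cd t x = vector_derivative (\<lambda>r. C0 r x) (at t)"

lemma E_iff: "x \<in> E_space C0 \<longleftrightarrow>
    (\<forall>t. ((\<lambda>t. C0 t x) has_vector_derivative Cd t x) (at t)) \<and> continuous_on UNIV (\<lambda>t. Cd t x)"
  unfolding E_space_def Cd_def C1_differentiable_on_eq vector_derivative_works by simp

lemma EI:
  assumes "\<And>t. ((\<lambda>t. C0 t x) has_vector_derivative d t) (at t)" "continuous_on UNIV d"
  shows "x \<in> E_space C0" "Cd t x = d t"
proof -
  show "x \<in> E_space C0" using assms unfolding E_space_def C1_differentiable_on_def by blast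
  show "Cd t x = d t" unfolding Cd_def by (rule vector_derivative_at[OF assms(1)])
qed

lemma Cd_derivative: "x \<in> E_space C0 \<Longrightarrow> ((\<lambda>t. C0 t x) has_vector_derivative Cd t x) (at t)"
  and Cd_continuous: "x \<in> E_space C0 \<Longrightarrow> continuous_on T (\<lambda>t. Cd t x)"
  using E_iff[of x] continuous_on_subset by auto

lemma E_add:
  assumes "x \<in> E_space C0" "y \<in> E_space C0"
  shows "x + y \<in> E_space C0" "Cd t (x + y) = Cd t x + Cd t y"
proof -
  have "((\<lambda>t. C0 t (x + y)) has_vector_derivative Cd t x + Cd t y) (at t)" for t
    using has_vector_derivative_add[OF Cd_derivative Cd_derivative, OF assms] by (simp add: blinfun.add_right)
  from EI[OF this] show "x + y \<in> E_space C0" "Cd t (x + y) = Cd t x + Cd t y"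
    using continuous_on_add[OF Cd_continuous Cd_continuous, OF assms] by auto
qed

lemma E_scaleR:
  assumes "x \<in> E_space C0"
  shows "c *\<^sub>R x \<in> E_space C0" "Cd t (c *\<^sub>R x) = c *\<^sub>R Cd t x"
proof -
  have "((\<lambda>t. C0 t (c *\<^sub>R x)) has_vector_derivative c *\<^sub>R Cd t x) (at t)" for t
    using bounded_linear.has_vector_derivative[OF bounded_linear_scaleR_right Cd_derivative, OF assms]
    by (simp add: blinfun.scaleR_right)
  from EI[OF this] show "c *\<^sub>R x \<in> E_space C0" "Cd t (c *\<^sub>R x) = c *\<^sub>R Cd t x"
    using continuous_on_scaleR[OF continuous_on_const Cd_continuous, OF assms] by auto
qed

lemma E_zero: "0 \<in> E_space C0"
  by (rule EI[where d = "\<lambda>_. 0"]) (auto simp: has_vector_derivative_const)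

lemma E_subspace: "subspace (E_space C0)"
  unfolding subspace_def using E_zero E_add(1) E_scaleR(1) by blast

lemma Cd_shift:
  assumes "x \<in> E_space C0"
  shows "((\<lambda>t. C0 (t + h) x) has_vector_derivative Cd (t + h) x) (at t)"
    "((\<lambda>t. C0 (h - t) x) has_vector_derivative - Cd (h - t) x) (at t)"
proof -
  have "((\<lambda>t. t + h) has_vector_derivative 1) (at t)" "((\<lambda>t. h - t) has_vector_derivative - 1) (at t)"
    by (auto intro!: derivative_eq_intros)
  note 1 = vector_diff_chain_at[OF this(1) Cd_derivative[OF assms]] and 2 = vector_diff_chain_at[OF this(2) Cd_derivative[OF assms]]
  show "((\<lambda>t. C0 (t + h) x) has_vector_derivative Cd (t + h) x) (at t)"
  "((\<lambda>t. C0 (h - t) x) has_vector_derivative - Cd (h - t) x) (at t)"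
    using 1 2 by (simp_all add: o_def)
qed

lemma Cd_odd: "x \<in> E_space C0 \<Longrightarrow> Cd (- t) x = - Cd t x"
  using vector_derivative_unique_at[OF Cd_derivative[of x t] Cd_shift(2)[of x 0 t, simplified, unfolded C_even]]
  by simp

lemma Cd_functional:
  assumes x: "x \<in> E_space C0"
  shows "Cd (t + s) x + Cd (t - s) x = 2 *\<^sub>R C0 s (Cd t x)"
proof -
  have "((\<lambda>t. C0 (t + s) x + C0 (t + - s) x) has_vector_derivative Cd (t + s) x + Cd (t + - s) x) (at t)"
    by (intro has_vector_derivative_add Cd_shift x)
  moreover have "((\<lambda>t. 2 *\<^sub>R C0 s (C0 t x)) has_vector_derivative 2 *\<^sub>R C0 s (Cd t x)) (at t)"
    by (intro bounded_linear.has_vector_derivative[OF bounded_linear_scaleR_right]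
        bounded_linear.has_vector_derivative[OF blinfun.bounded_linear_right] Cd_derivative x)
  moreover have "(\<lambda>t. C0 (t + s) x + C0 (t + - s) x) = (\<lambda>t. 2 *\<^sub>R C0 s (C0 t x))"
    using C_functional[of _ s x] C_commute[of _ s x] by auto
  ultimately show ?thesis using vector_derivative_unique_at by fastforce
qed

text \<open>Sine operators map \<open>X\<close> into \<open>E\<close>.\<close>

lemma S0_in_E:
  shows "S0 u x \<in> E_space C0" "Cd h (S0 u x) = (1/2) *\<^sub>R (C0 (u + h) x - C0 (u - h) x)"
proof -
  have "((\<lambda>h. (1/2) *\<^sub>R (S0 (h + u) x + S0 (u - h) x)) has_vector_derivative
      (1/2) *\<^sub>R (C0 (h + u) x + - C0 (u - h) x)) (at h)" for h
    by (intro bounded_linear.has_vector_derivative[OF bounded_linear_scaleR_right]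
        has_vector_derivative_add S0_shift_derivative)
  then have "((\<lambda>h. C0 h (S0 u x)) has_vector_derivative (1/2) *\<^sub>R (C0 (u + h) x - C0 (u - h) x)) (at h)" for h
    unfolding C_S0 by (simp add: add.commute[of u])
  moreover have "continuous_on UNIV (\<lambda>h. (1/2) *\<^sub>R (C0 (u + h) x - C0 (u - h) x))"
    by (intro continuous_intros continuous_on_compose2[OF C_continuous[of UNIV x]]) auto
  ultimately show "S0 u x \<in> E_space C0" "Cd h (S0 u x) = (1/2) *\<^sub>R (C0 (u + h) x - C0 (u - h) x)"
    by (rule EI)+
qed

end

text \<open>This identifies limits with a prescribed antiderivative of the uniform limit of the derivatives.\<close>

lemma antiderivative_of_uniform_limit:
  fixes f :: "nat \<Rightarrow> real \<Rightarrow> 'a::real_normed_vector"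
  assumes f: "\<And>n u. (f n has_vector_derivative d n u) (at u)"
    and F: "\<And>u. (F has_vector_derivative w u) (at u)"
    and le: "\<And>u n. \<bar>u\<bar> \<le> \<bar>t\<bar> \<Longrightarrow> norm (w u - d n u) \<le> \<epsilon> n" and \<epsilon>: "\<epsilon> \<longlonglongrightarrow> 0"
    and lim0: "(\<lambda>n. f n 0) \<longlonglongrightarrow> F 0"
  shows "(\<lambda>n. f n t) \<longlonglongrightarrow> F t"
proof -
  have close: "norm ((F t - f n t) - (F 0 - f n 0)) \<le> \<epsilon> n * \<bar>t - 0\<bar>" for n
  proof (rule has_vector_derivative_Lipschitz[of "- \<bar>t\<bar>" "\<bar>t\<bar>" "\<lambda>t. F t - f n t" "\<lambda>t. w t - d n t"])
    show "((\<lambda>t. F t - f n t) has_vector_derivative w u - d n u) (at u within {- \<bar>t\<bar>..\<bar>t\<bar>})" for u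
      by (rule has_vector_derivative_at_within[OF has_vector_derivative_diff[OF F f]])
    show "norm (w u - d n u) \<le> \<epsilon> n" if "u \<in> {- \<bar>t\<bar>..\<bar>t\<bar>}" for u
      by (rule le) (use that in \<open>simp add: abs_le_iff\<close>)
    show "t \<in> {- \<bar>t\<bar>..\<bar>t\<bar>}" unfolding atLeastAtMost_iff by linarith
  qed simp
  have "(\<lambda>n. (F t - f n t) - (F 0 - f n 0)) \<longlonglongrightarrow> 0"
  proof (rule Lim_null_comparison)
    show "\<forall>\<^sub>F n in sequentially. norm ((F t - f n t) - (F 0 - f n 0)) \<le> \<epsilon> n * \<bar>t - 0\<bar>"
      using close by simp
    show "(\<lambda>n. \<epsilon> n * \<bar>t - 0\<bar>) \<longlonglongrightarrow> 0" by (rule tendsto_mult_left_zero[OF \<epsilon>])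
  qed
  from tendsto_diff[OF tendsto_const[of "F t"] tendsto_add[OF this tendsto_diff[OF tendsto_const[of "F 0"] lim0]]]
  show ?thesis by simp
qed

subsection \<open>The space \<open>E\<close>\<close>

context strongly_continuous_cosine_family
begin

lemma Cd_bounded_E:
  assumes "x \<in> E_space C0"
  shows "bdd_above ((\<lambda>t. norm (Cd t x)) ` {0..1})"
proof -
  have "compact ((\<lambda>t. norm (Cd t x)) ` {0..1})"
    by (intro compact_continuous_image continuous_intros Cd_continuous[OF assms]) simp
  then show ?thesis by (intro bounded_imp_bdd_above compact_imp_bounded)
qed

text \<open>The norm of \<open>E\<close>, with \<open>A S\<^sub>0(t)\<close> written as the derivative of the cosine function.\<close>

definition pE where "pE x = norm x + (SUP t\<in>{0..1}. norm (Cd t x))"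

lemma Cd_le_pE:
  assumes x: "x \<in> E_space C0" and t: "t \<in> {0..1}"
  shows "norm x + norm (Cd t x) \<le> pE x"
  unfolding pE_def using cSUP_upper[OF t Cd_bounded_E[OF x]] by simp

lemma pE_le:
  assumes "\<And>t. t \<in> {0..1} \<Longrightarrow> norm x + norm (Cd t x) \<le> c"
  shows "pE x \<le> c"
proof -
  have "(SUP t\<in>{0..1}. norm (Cd t x)) \<le> c - norm x"
    by (rule cSUP_least) (use assms in \<open>auto simp: algebra_simps\<close>)
  then show ?thesis by (simp add: pE_def)
qed

lemma pE_ge: assumes "x \<in> E_space C0" shows "norm x \<le> pE x" "0 \<le> pE x"
proof -
  have "norm x + norm (Cd 0 x) \<le> pE x" by (rule Cd_le_pE[OF assms]) simp
  then show "norm x \<le> pE x" using norm_ge_zero[of "Cd 0 x"] by linarith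
  then show "0 \<le> pE x" using norm_ge_zero[of x] by linarith
qed

lemma pE_add:
  assumes x: "x \<in> E_space C0" and y: "y \<in> E_space C0"
  shows "pE (x + y) \<le> pE x + pE y"
proof (rule pE_le)
  fix t :: real assume t: "t \<in> {0..1}"
  show "norm (x + y) + norm (Cd t (x + y)) \<le> pE x + pE y"
    using Cd_le_pE[OF x t] Cd_le_pE[OF y t] norm_triangle_ineq[of x y] norm_triangle_ineq[of "Cd t x" "Cd t y"]
    unfolding E_add(2)[OF x y] by linarith
qed

lemma pE_scaleR:
  assumes x: "x \<in> E_space C0"
  shows "pE (c *\<^sub>R x) = \<bar>c\<bar> * pE x"
proof (rule antisym)
  have le: "pE (c *\<^sub>R x) \<le> \<bar>c\<bar> * pE x" if x: "x \<in> E_space C0" for c x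
  proof (rule pE_le)
    fix t :: real assume t: "t \<in> {0..1}"
    show "norm (c *\<^sub>R x) + norm (Cd t (c *\<^sub>R x)) \<le> \<bar>c\<bar> * pE x"
      using mult_left_mono[OF Cd_le_pE[OF x t], of "\<bar>c\<bar>"] unfolding E_scaleR(2)[OF x] by (simp add: algebra_simps)
  qed
  show "pE (c *\<^sub>R x) \<le> \<bar>c\<bar> * pE x" by (rule le[OF x])
  show "\<bar>c\<bar> * pE x \<le> pE (c *\<^sub>R x)"
  proof (cases "c = 0")
    case True
    then show ?thesis using pE_ge(2)[OF E_zero] by simp
  next
    case False
    have "pE (inverse c *\<^sub>R (c *\<^sub>R x)) \<le> \<bar>inverse c\<bar> * pE (c *\<^sub>R x)" by (rule le[OF E_scaleR(1)[OF x]])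
    then show ?thesis using False by (simp add: field_simps)
  qed
qed

text \<open>A Lipschitz bound can be checked under an integral sign, where derivatives need not exist.\<close>

lemma pE_Lipschitz:
  assumes x: "x \<in> E_space C0" and c: "\<And>h h'. h \<in> {0..1} \<Longrightarrow> h' \<in> {0..1} \<Longrightarrow> norm (C0 h x - C0 h' x) \<le> c * \<bar>h - h'\<bar>"
  shows "pE x \<le> norm x + c"
proof (rule pE_le)
  fix t :: real assume t: "t \<in> {0..1}"
  have der: "((\<lambda>h. C0 h x) has_vector_derivative Cd t x) (at t within {0..1})"
    by (rule has_vector_derivative_at_within[OF Cd_derivative[OF x]])
  define q where "q h = norm ((C0 h x - C0 t x) - (h - t) *\<^sub>R Cd t x) / norm (h - t)" for h
  have "(q \<longlongrightarrow> 0) (at t within {0..1})"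
    using der unfolding has_vector_derivative_def has_derivative_iff_norm q_def by blast
  then have "((\<lambda>h. c + q h) \<longlongrightarrow> c + 0) (at t within {0..1})" by (intro tendsto_intros)
  then have "norm (Cd t x) \<le> c + 0"
  proof (rule tendsto_lowerbound)
    show "\<forall>\<^sub>F h in at t within {0..1}. norm (Cd t x) \<le> c + q h"
      unfolding eventually_at
    proof (intro exI[of _ 1] conjI ballI impI)
      fix h assume h: "h \<in> {0..1}" "h \<noteq> t \<and> dist h t < 1"
      have "\<bar>h - t\<bar> * norm (Cd t x) = norm ((h - t) *\<^sub>R Cd t x)" by simp
      also have "\<dots> \<le> norm (C0 h x - C0 t x) + norm ((C0 h x - C0 t x) - (h - t) *\<^sub>R Cd t x)"
        using norm_triangle_ineq4[of "C0 h x - C0 t x" "(C0 h x - C0 t x) - (h - t) *\<^sub>R Cd t x"] by simp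
      also have "\<dots> \<le> c * \<bar>h - t\<bar> + \<bar>h - t\<bar> * q h"
        using c[OF h(1) t] h(2) by (simp add: q_def)
      also have "\<dots> = \<bar>h - t\<bar> * (c + q h)" by (simp add: algebra_simps)
      finally show "norm (Cd t x) \<le> c + q h" using h(2) by simp
    qed simp
    show "at t within {0..1} \<noteq> bot" using t by (simp add: trivial_limit_within islimpt_Icc)
  qed
  then show "norm x + norm (Cd t x) \<le> norm x + c" by simp
qed

lemma C0_Lipschitz_E:
  assumes x: "x \<in> E_space C0" and h: "h \<in> {0..1}" "h' \<in> {0..1}"
  shows "norm (C0 h x - C0 h' x) \<le> pE x * \<bar>h - h'\<bar>"
proof (rule has_vector_derivative_Lipschitz[OF _ _ h])
  show "((\<lambda>h. C0 h x) has_vector_derivative Cd t x) (at t within {0..1})" for t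
    by (rule has_vector_derivative_at_within[OF Cd_derivative[OF x]])
  show "norm (Cd t x) \<le> pE x" if "t \<in> {0..1}" for t
    using Cd_le_pE[OF x that] norm_ge_zero[of x] by linarith
qed

text \<open>The functional equation determines the derivative at \<open>t\<close> by its values at \<open>t - 1\<close> and \<open>t - 2\<close>, so
  bounds propagate from \<open>[-1,1]\<close> to every bounded interval.\<close>

lemma Cd_bounded:
  "\<exists>M>0. \<forall>x\<in>E_space C0. \<forall>t. \<bar>t\<bar> \<le> real (Suc n) \<longrightarrow> norm (Cd t x) \<le> M * pE x"
proof (induction n)
  case 0
  have "norm (Cd t x) \<le> 1 * pE x" if x: "x \<in> E_space C0" and t: "\<bar>t\<bar> \<le> 1" for x t
  proof -
    have "norm (Cd t x) = norm (Cd \<bar>t\<bar> x)" using Cd_odd[OF x, of t] by (simp add: abs_if)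
    moreover have "norm x + norm (Cd \<bar>t\<bar> x) \<le> pE x" by (rule Cd_le_pE[OF x]) (use t in simp)
    ultimately show ?thesis using norm_ge_zero[of x] by linarith
  qed
  then show ?case by (intro exI[of _ 1]) auto
next
  case (Suc n)
  then obtain M where M: "M > 0" "\<And>x t. x \<in> E_space C0 \<Longrightarrow> \<bar>t\<bar> \<le> real (Suc n) \<Longrightarrow> norm (Cd t x) \<le> M * pE x"
    by blast
  define M' where "M' = 2 * norm (C0 1) * M + M"
  have M': "M' > 0" "M \<le> M'" using M(1) by (auto simp: M'_def add_nonneg_pos)
  have pos: "norm (Cd t x) \<le> M' * pE x" if x: "x \<in> E_space C0" and t: "0 \<le> t" "t \<le> real (Suc (Suc n))" for x t
  proof (cases "t \<le> real (Suc n)")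
    case True
    then have "norm (Cd t x) \<le> M * pE x" using M(2)[OF x] t by simp
    also have "\<dots> \<le> M' * pE x" by (rule mult_right_mono[OF M'(2) pE_ge(2)[OF x]])
    finally show ?thesis .
  next
    case False
    have eq: "Cd t x = 2 *\<^sub>R C0 1 (Cd (t - 1) x) - Cd (t - 2) x"
      using Cd_functional[OF x, of "t - 1" 1] by (simp add: algebra_simps)
    have "norm (Cd t x) \<le> 2 * norm (C0 1 (Cd (t - 1) x)) + norm (Cd (t - 2) x)"
      unfolding eq using norm_triangle_ineq4[of "2 *\<^sub>R C0 1 (Cd (t - 1) x)" "Cd (t - 2) x"] by simp
    also have "\<dots> \<le> 2 * (norm (C0 1) * (M * pE x)) + M * pE x"
    proof (intro add_mono mult_left_mono)
      have "norm (C0 1 (Cd (t - 1) x)) \<le> norm (C0 1) * norm (Cd (t - 1) x)" by (rule norm_blinfun)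
      also have "\<dots> \<le> norm (C0 1) * (M * pE x)"
        by (intro mult_left_mono M(2)[OF x]) (use t False in \<open>auto simp: abs_le_iff\<close>)
      finally show "norm (C0 1 (Cd (t - 1) x)) \<le> norm (C0 1) * (M * pE x)" .
      show "norm (Cd (t - 2) x) \<le> M * pE x"
        by (rule M(2)[OF x]) (use t False in \<open>auto simp: abs_le_iff\<close>)
    qed simp
    also have "\<dots> = M' * pE x" by (simp add: M'_def algebra_simps)
    finally show ?thesis .
  qed
  have "norm (Cd t x) \<le> M' * pE x" if x: "x \<in> E_space C0" and t: "\<bar>t\<bar> \<le> real (Suc (Suc n))" for x t
  proof -
    have "norm (Cd t x) = norm (Cd \<bar>t\<bar> x)" using Cd_odd[OF x, of t] by (simp add: abs_if)
    then show ?thesis using pos[OF x, of "\<bar>t\<bar>"] t by simp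
  qed
  then show ?case using M'(1) by blast
qed

text \<open>The sums of the derivatives converge locally uniformly, and the limit is the derivative of
  the limit because it has the right antiderivative.\<close>

lemma E_complete:
  assumes e: "\<And>n. e n \<in> E_space C0" "\<And>n. pE (e n) \<le> (1/9) ^ n"
  shows "\<exists>x\<in>E_space C0. \<forall>n. pE (x - (\<Sum>k<n. e k)) \<le> 3 * (1/9) ^ n"
proof -
  define s where "s n = (\<Sum>k<n. e k)" for n
  have sE: "s n \<in> E_space C0" for n unfolding s_def by (intro subspace_sum[OF E_subspace] e)
  have Cd_s: "Cd t (s n) = (\<Sum>k<n. Cd t (e k))" for t n
  proof (induction n)
    case 0
    have "Cd t (0 *\<^sub>R 0) = 0" unfolding E_scaleR(2)[OF E_zero] by simp
    then show ?case by (simp add: s_def)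
  next
    case (Suc n)
    have "Cd t (s (Suc n)) = Cd t (s n) + Cd t (e n)" using E_add(2)[OF sE e(1)] by (simp add: s_def)
    then show ?case using Suc by simp
  qed
  have ne: "norm (e n) \<le> 1 * (1/9) ^ n" for n using pE_ge(1)[OF e(1), of n] e(2)[of n] by linarith
  obtain x where x: "s \<longlonglongrightarrow> x" "\<And>n. norm (x - s n) \<le> 1 * (3/2 * (1/9) ^ n)"
    unfolding s_def using geometric_increments_limit[of e 1, OF ne] by metis
  have "\<exists>w M. M > 0 \<and> (\<forall>t. \<bar>t\<bar> \<le> real (Suc m) \<longrightarrow> (\<lambda>n. Cd t (s n)) \<longlonglongrightarrow> w t \<and>
      (\<forall>n. norm (w t - Cd t (s n)) \<le> M * (3/2 * (1/9) ^ n)))" for m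
  proof -
    obtain M where M: "M > 0" "\<And>x t. x \<in> E_space C0 \<Longrightarrow> \<bar>t\<bar> \<le> real (Suc m) \<Longrightarrow> norm (Cd t x) \<le> M * pE x"
      using Cd_bounded[of m] by blast
    have "\<exists>w. (\<lambda>n. Cd t (s n)) \<longlonglongrightarrow> w \<and> (\<forall>n. norm (w - Cd t (s n)) \<le> M * (3/2 * (1/9) ^ n))"
      if t: "\<bar>t\<bar> \<le> real (Suc m)" for t
    proof -
      have "norm (Cd t (e n)) \<le> M * (1/9) ^ n" for n
        using M(2)[OF e(1) t, of n] mult_left_mono[OF e(2)[of n], of M] M(1) by linarith
      from geometric_increments_limit[of "\<lambda>n. Cd t (e n)" M, OF this]
      show ?thesis unfolding Cd_s by metis
    qed
    then show ?thesis using M(1) by metis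
  qed
  note lim = this
  define w where "w t = lim (\<lambda>n. Cd t (s n))" for t
  have w: "\<exists>M>0. \<forall>t. \<bar>t\<bar> \<le> real (Suc m) \<longrightarrow> (\<forall>n. norm (w t - Cd t (s n)) \<le> M * (3/2 * (1/9) ^ n))" for m
  proof -
    obtain v M where "M > 0" and *: "\<And>t. \<bar>t\<bar> \<le> real (Suc m) \<Longrightarrow> (\<lambda>n. Cd t (s n)) \<longlonglongrightarrow> v t \<and>
      (\<forall>n. norm (v t - Cd t (s n)) \<le> M * (3/2 * (1/9) ^ n))" using lim[of m] by metis
    moreover have "w t = v t" if "\<bar>t\<bar> \<le> real (Suc m)" for t
      unfolding w_def using *[OF that] by (intro limI) blast
    ultimately show ?thesis by metis
  qed
  then obtain M where M: "\<And>m. M m > 0"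
    "\<And>m t n. \<bar>t\<bar> \<le> real (Suc m) \<Longrightarrow> norm (w t - Cd t (s n)) \<le> M m * (3/2 * (1/9) ^ n)" by metis
  have pow0: "(\<lambda>n. c * (3/2 * (1/9 :: real) ^ n)) \<longlonglongrightarrow> 0" for c
    using tendsto_mult[OF tendsto_const tendsto_mult[OF tendsto_const LIMSEQ_power_zero[of "1/9::real"]], of c "3/2"]
    by simp
  have w_cont: "continuous_on UNIV w"
  proof -
    have "continuous_on {- real (Suc m)<..<real (Suc m)} w" for m
    proof (rule uniform_limit_theorem)
      show "\<forall>\<^sub>F n in sequentially. continuous_on {- real (Suc m)<..<real (Suc m)} (\<lambda>t. Cd t (s n))"
        using Cd_continuous[OF sE] by simp
      show "uniform_limit {- real (Suc m)<..<real (Suc m)} (\<lambda>n t. Cd t (s n)) w sequentially"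
      proof (rule uniform_limitI)
        fix \<epsilon> :: real assume "\<epsilon> > 0"
        with pow0[of "M m"] have "\<forall>\<^sub>F n in sequentially. M m * (3/2 * (1/9) ^ n) < \<epsilon>" by (rule order_tendstoD)
        then show "\<forall>\<^sub>F n in sequentially. \<forall>t\<in>{- real (Suc m)<..<real (Suc m)}. dist (Cd t (s n)) (w t) < \<epsilon>"
        proof eventually_elim
          case (elim n)
          show ?case
          proof
            fix t assume "t \<in> {- real (Suc m)<..<real (Suc m)}"
            then have "norm (w t - Cd t (s n)) \<le> M m * (3/2 * (1/9) ^ n)" by (intro M(2)) (auto simp: abs_le_iff)
            then show "dist (Cd t (s n)) (w t) < \<epsilon>" using elim by (simp add: dist_norm norm_minus_commute)
          qed
        qed
      qed
    qed simp
    then have "continuous_on (\<Union>m. {- real (Suc m)<..<real (Suc m)}) w" by (intro continuous_on_open_UN) auto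
    moreover have "(\<Union>m. {- real (Suc m)<..<real (Suc m)}) = UNIV"
    proof -
      have "\<exists>m. t \<in> {- real (Suc m)<..<real (Suc m)}" for t
      proof -
        obtain m where "\<bar>t\<bar> < real m" using reals_Archimedean2 by blast
        then show ?thesis by (intro exI[of _ m]) auto
      qed
      then show ?thesis by blast
    qed
    ultimately show ?thesis by simp
  qed
  define F where "F t = x + oriented_integral 0 t w" for t
  have F: "(F has_vector_derivative w t) (at t)" for t
    unfolding F_def using oriented_integral_has_vector_derivative[OF w_cont]
    by (auto intro!: derivative_eq_intros)
  have F0: "F 0 = x" by (simp add: F_def oriented_integral_def)
  have CF: "C0 t x = F t" for t
  proof -
    obtain m where m: "\<bar>t\<bar> < real m" using reals_Archimedean2 by blast
    have "(\<lambda>n. C0 t (s n)) \<longlonglongrightarrow> F t"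
    proof (rule antiderivative_of_uniform_limit)
      show "((\<lambda>t. C0 t (s n)) has_vector_derivative Cd u (s n)) (at u)" for n u
        by (rule Cd_derivative[OF sE])
      show "(F has_vector_derivative w u) (at u)" for u by (rule F)
      show "norm (w u - Cd u (s n)) \<le> M m * (3/2 * (1/9) ^ n)" if "\<bar>u\<bar> \<le> \<bar>t\<bar>" for u n
        by (rule M(2)) (use that m in simp)
      show "(\<lambda>n. M m * (3/2 * (1/9) ^ n)) \<longlonglongrightarrow> 0" by (rule pow0)
      show "(\<lambda>n. C0 0 (s n)) \<longlonglongrightarrow> F 0" using x(1) by (simp add: F0 C_zero)
    qed
    moreover have "(\<lambda>n. C0 t (s n)) \<longlonglongrightarrow> C0 t x" by (intro tendsto_intros x(1))
    ultimately show ?thesis by (rule LIMSEQ_unique[symmetric])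
  qed
  have xE: "x \<in> E_space C0" and Cdx: "Cd t x = w t" for t
    using EI[OF _ w_cont, of x] F unfolding CF by auto
  have "pE (x - s n) \<le> 3 * (1/9) ^ n" for n
  proof (rule pE_le)
    fix t :: real assume t: "t \<in> {0..1}"
    have "norm (Cd t (e n)) \<le> 1 * (1/9) ^ n" for n
      using Cd_le_pE[OF e(1) t, of n] e(2)[of n] norm_ge_zero[of "e n"] by linarith
    from geometric_increments_limit[of "\<lambda>n. Cd t (e n)" 1, OF this]
    obtain v where v: "(\<lambda>n. Cd t (s n)) \<longlonglongrightarrow> v" "\<And>n. norm (v - Cd t (s n)) \<le> 1 * (3/2 * (1/9) ^ n)"
      unfolding Cd_s by metis
    have "w t = v" unfolding w_def by (rule limI[OF v(1)])
    moreover have "Cd t (x - s n) = Cd t x - Cd t (s n)"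
      using E_add(2)[OF xE E_scaleR(1)[OF sE[of n], of "-1"]] E_scaleR(2)[OF sE[of n], of _ "-1"] by simp
    ultimately have "norm (Cd t (x - s n)) \<le> 3/2 * (1/9) ^ n" using v(2)[of n] by (simp add: Cdx)
    then show "norm (x - s n) + norm (Cd t (x - s n)) \<le> 3 * (1/9) ^ n" using x(2)[of n] by simp
  qed
  then show ?thesis using xE unfolding s_def by blast
qed

text \<open>Since \<open>C\<^sub>0\<close> is differentiable on \<open>E\<close> with bounded derivative, the unit ball of \<open>E\<close> is uniformly
  approximated by the compact operators \<open>h\<^sup>-\<^sup>1 S\<^sub>0(h)\<close>.\<close>

lemma E_approximation:
  assumes z: "z \<in> E_space C0" and h: "0 < h" "h \<le> 1"
  shows "norm (z - (1/h) *\<^sub>R S0 h z) \<le> h * pE z"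
proof -
  have der: "((\<lambda>u. u *\<^sub>R z - S0 u z) has_vector_derivative z - C0 u z) (at u within {0..h})" for u
  proof -
    have "((\<lambda>u. u *\<^sub>R z) has_vector_derivative z) (at u)"
      using has_vector_derivative_scaleR[OF DERIV_ident has_vector_derivative_const[of z "at u"]] by simp
    from has_vector_derivative_diff[OF this S0_derivative] show ?thesis by (rule has_vector_derivative_at_within)
  qed
  have bound: "norm (z - C0 u z) \<le> h * pE z" if u: "u \<in> {0..h}" for u
  proof -
    have "norm (C0 0 z - C0 u z) \<le> pE z * \<bar>0 - u\<bar>" by (rule C0_Lipschitz_E[OF z]) (use u h in auto)
    also have "\<dots> \<le> pE z * h" by (rule mult_left_mono[OF _ pE_ge(2)[OF z]]) (use u in auto)
    finally show ?thesis by (simp add: C_zero mult.commute)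
  qed
  have "norm ((h *\<^sub>R z - S0 h z) - (0 *\<^sub>R z - S0 0 z)) \<le> (h * pE z) * \<bar>h - 0\<bar>"
    by (rule has_vector_derivative_Lipschitz[OF der bound]) (use h in auto)
  then have "norm (h *\<^sub>R z - S0 h z) \<le> h * (h * pE z)" using h by (simp add: mult.commute)
  moreover have "norm (h *\<^sub>R z - S0 h z) = h * norm (z - (1/h) *\<^sub>R S0 h z)"
  proof -
    have "h *\<^sub>R z - S0 h z = h *\<^sub>R (z - (1/h) *\<^sub>R S0 h z)" using h by (simp add: scaleR_diff_right)
    then show ?thesis using h by simp
  qed
  ultimately show ?thesis using h by simp
qed

end

section \<open>The evolution operator\<close>

text \<open>The hypothesis is evaluated at a maximum point of \<open>\<phi> t * exp (- 2 k (t - s))\<close>; with the rate \<open>2 k\<close>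
  the integral term is at most half of the maximum and can be absorbed.\<close>

lemma gronwall_inequality:
  fixes \<phi> :: "real \<Rightarrow> real"
  assumes cont: "continuous_on {s..T} \<phi>" and nonneg: "\<And>t. t \<in> {s..T} \<Longrightarrow> 0 \<le> \<phi> t"
    and k: "k > 0" and le: "\<And>t. t \<in> {s..T} \<Longrightarrow> \<phi> t \<le> c + k * integral {s..t} \<phi>"
    and t: "t \<in> {s..T}"
  shows "\<phi> t \<le> 2 * c * exp (2 * k * (t - s))"
proof -
  define \<psi> where "\<psi> t = \<phi> t * exp (- (2 * k * (t - s)))" for t
  have "continuous_on {s..T} \<psi>" unfolding \<psi>_def by (intro continuous_intros cont)
  then obtain r where r: "r \<in> {s..T}" "\<And>t. t \<in> {s..T} \<Longrightarrow> \<psi> t \<le> \<psi> r"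
    using continuous_attains_sup[of "{s..T}" \<psi>] t by auto
  define m where "m = \<psi> r"
  have \<phi>: "\<phi> t = \<psi> t * exp (2 * k * (t - s))" for t by (simp add: \<psi>_def mult.assoc flip: exp_add)
  have m: "0 \<le> m" using nonneg[OF r(1)] by (simp add: m_def \<psi>_def)
  have \<phi>_le: "\<phi> \<tau> \<le> m * exp (2 * k * (\<tau> - s))" if "\<tau> \<in> {s..T}" for \<tau>
    using r(2)[OF that] by (simp add: \<phi> m_def)
  have I: "((\<lambda>\<tau>. m * exp (2 * k * (\<tau> - s))) has_integral
      (m * exp (2 * k * (r - s)) / (2 * k) - m * exp (2 * k * (s - s)) / (2 * k))) {s..r}"
  proof (rule fundamental_theorem_of_calculus)
    show "s \<le> r" using r by simp
    show "((\<lambda>\<tau>. m * exp (2 * k * (\<tau> - s)) / (2 * k)) has_vector_derivative m * exp (2 * k * (\<tau> - s)))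
        (at \<tau> within {s..r})" for \<tau>
      using k unfolding has_real_derivative_iff_has_vector_derivative[symmetric]
      by (auto intro!: derivative_eq_intros)
  qed
  have "continuous_on {s..r} \<phi>" by (rule continuous_on_subset[OF cont]) (use r(1) in auto)
  then have "integral {s..r} \<phi> \<le> m * exp (2 * k * (r - s)) / (2 * k) - m * exp (2 * k * (s - s)) / (2 * k)"
    using r(1) by (intro has_integral_le[OF integrable_integral I] integrable_continuous_real \<phi>_le) auto
  then have "k * integral {s..r} \<phi> \<le> k * (m * exp (2 * k * (r - s)) / (2 * k) - m / (2 * k))"
    using k by (intro mult_left_mono) auto
  also have "\<dots> = m * exp (2 * k * (r - s)) / 2 - m / 2" using k by (simp add: field_simps)
  finally have "m * exp (2 * k * (r - s)) \<le> c + (m * exp (2 * k * (r - s)) / 2 - m / 2)"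
    using le[OF r(1)] \<phi>[of r] by (simp add: m_def)
  then have "m * exp (2 * k * (r - s)) \<le> 2 * c" using m by linarith
  moreover have "m * 1 \<le> m * exp (2 * k * (r - s))"
    using m k r(1) by (intro mult_left_mono) auto
  ultimately have "m \<le> 2 * c" by linarith
  then have "m * exp (2 * k * (t - s)) \<le> 2 * c * exp (2 * k * (t - s))" by (intro mult_right_mono) auto
  then show ?thesis using \<phi>_le[OF t] by linarith
qed

text \<open>If \<open>f\<close> is not integrable, its integral is \<open>0\<close>. Hence the Volterra equation can be estimated before
  its integrand is known to be measurable.\<close>

lemma norm_blinfun_integral_le:
  fixes f :: "real \<Rightarrow> 'x::{real_inner,complete_space}" and T :: "'x \<Rightarrow>\<^sub>L 'x"
  assumes g: "g integrable_on S" and le: "\<And>x. x \<in> S \<Longrightarrow> norm (T (f x)) \<le> g x"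
  shows "norm (T (integral S f)) \<le> integral S g"
proof (cases "f integrable_on S")
  case True
  have "T (integral S f) = integral S (\<lambda>x. T (f x))"
    using integral_linear[OF True blinfun.bounded_linear_right[of T]] by (simp add: o_def)
  then show ?thesis using hilbert_integral_norm_bound[OF g le] by simp
next
  case False
  have "0 \<le> integral S g"
    by (rule Henstock_Kurzweil_Integration.integral_nonneg[OF g]) (use le norm_ge_zero order_trans in blast)
  then show ?thesis using False by (simp add: not_integrable_integral)
qed

context strongly_continuous_cosine_family
begin

text \<open>For \<open>x \<in> E\<close>, the orbit \<open>h \<mapsto> C\<^sub>0(h) S\<^sub>0(u) x\<close> is twice continuously differentiable, and \<open>A\<close> is its
  second derivative at \<open>0\<close>.\<close>

lemma generator_sine:
  assumes gen: "generates_cosine_family D A C0" and x: "x \<in> E_space C0"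
  shows "A (S0 u x) = Cd u x"
proof -
  define v where "v = S0 u x"
  define d where "d t = (1/2) *\<^sub>R (Cd (t + u) x + Cd (u - t) x)" for t
  have Cd_v: "(\<lambda>t. vector_derivative (\<lambda>r. C0 r v) (at t)) = (\<lambda>t. (1/2) *\<^sub>R (C0 (t + u) x - C0 (u - t) x))"
    using S0_in_E(2)[of _ u x] unfolding Cd_def v_def by (simp add: add.commute)
  have "((\<lambda>t. (1/2) *\<^sub>R (C0 (t + u) x - C0 (u - t) x)) has_vector_derivative
      (1/2) *\<^sub>R (Cd (t + u) x - - Cd (u - t) x)) (at t)" for t
    by (intro bounded_linear.has_vector_derivative[OF bounded_linear_scaleR_right]
        has_vector_derivative_diff Cd_shift x)
  then have der: "((\<lambda>t. vector_derivative (\<lambda>r. C0 r v) (at t)) has_vector_derivative d t) (at t)" for t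
    unfolding Cd_v d_def by simp
  have "continuous_on UNIV d"
    unfolding d_def by (intro continuous_intros continuous_on_compose2[OF Cd_continuous[OF x, of UNIV]]) auto
  then have "(\<lambda>t. vector_derivative (\<lambda>r. C0 r v) (at t)) C1_differentiable_on UNIV"
    using der unfolding C1_differentiable_on_def by blast
  then have "v \<in> D"
    using gen S0_in_E(1)[of u x] unfolding generates_cosine_family_def E_space_def v_def by blast
  then have "A v = vector_derivative (\<lambda>t. vector_derivative (\<lambda>r. C0 r v) (at t)) (at 0)"
    using gen unfolding generates_cosine_family_def by blast
  also have "\<dots> = d 0" by (rule vector_derivative_at[OF der])
  also have "\<dots> = Cd u x" by (simp add: d_def scaleR_2[symmetric])
  finally show ?thesis by (simp add: v_def)
qed

lemma E_norm_eq:
  assumes "generates_cosine_family D A C0" "x \<in> E_space C0"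
  shows "E_norm A C0 x = pE x"
  unfolding E_norm_def pE_def generator_sine[OF assms] ..

lemma perturbation_uniformly_bounded:
  assumes gen: "generates_cosine_family D A C0" and adm: "admissible_perturbation A C0 Bt"
  obtains K where "K > 0" "\<And>\<tau> x. \<tau> \<in> {0..b} \<Longrightarrow> x \<in> E_space C0 \<Longrightarrow> norm (Bt \<tau> x) \<le> K * pE x"
proof -
  have "\<exists>K. \<forall>\<tau>\<in>{0..b}. \<forall>x\<in>E_space C0. norm (Bt \<tau> x) \<le> K * pE x"
  proof (rule uniform_boundedness_subspace[OF E_subspace pE_ge(2) pE_scaleR E_complete])
    show "\<exists>K. \<forall>x\<in>E_space C0. norm (Bt \<tau> x) \<le> K * pE x" for \<tau>
      using adm E_norm_eq[OF gen] unfolding admissible_perturbation_def by metis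
    show "\<exists>K. \<forall>\<tau>\<in>{0..b}. norm (Bt \<tau> x) \<le> K" if x: "x \<in> E_space C0" for x
    proof -
      have "(\<lambda>t. Bt t x) C1_differentiable_on UNIV" using adm x unfolding admissible_perturbation_def by blast
      then have "continuous_on {0..b} (\<lambda>t. Bt t x)"
        using C1_differentiable_imp_continuous_on continuous_on_subset by blast
      then have "compact ((\<lambda>t. Bt t x) ` {0..b})" by (rule compact_continuous_image) simp
      from compact_imp_bounded[OF this] show ?thesis by (auto simp: bounded_iff)
    qed
  qed (use adm in \<open>auto simp: admissible_perturbation_def\<close>)
  then obtain K where K: "\<And>\<tau> x. \<tau> \<in> {0..b} \<Longrightarrow> x \<in> E_space C0 \<Longrightarrow> norm (Bt \<tau> x) \<le> K * pE x" by blast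
  have "norm (Bt \<tau> x) \<le> (\<bar>K\<bar> + 1) * pE x" if "\<tau> \<in> {0..b}" "x \<in> E_space C0" for \<tau> x
    using K[OF that] mult_right_mono[of K "\<bar>K\<bar> + 1", OF _ pE_ge(2)[OF that(2)]] by fastforce
  moreover have "\<bar>K\<bar> + 1 > 0" by linarith
  ultimately show thesis using that by blast
qed

lemma C0_diff_S0:
  assumes M: "\<And>t. \<bar>t\<bar> \<le> b + 1 \<Longrightarrow> norm (C0 t) \<le> M" and u: "u \<in> {0..b}" and h: "h \<in> {0..1}" "h' \<in> {0..1}"
  shows "norm ((C0 h - C0 h') (S0 u x)) \<le> M * norm x * \<bar>h - h'\<bar>"
proof -
  have "(C0 h - C0 h') (S0 u x) = (1/2) *\<^sub>R ((S0 (u + h) x - S0 (u + h') x) + (S0 (u - h) x - S0 (u - h') x))"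
    by (simp add: blinfun.diff_left C_S0 algebra_simps)
  also have "norm \<dots> \<le> (1/2) * (norm (S0 (u + h) x - S0 (u + h') x) + norm (S0 (u - h) x - S0 (u - h') x))"
    using norm_triangle_ineq by simp
  also have "\<dots> \<le> (1/2) * (M * norm x * \<bar>(u + h) - (u + h')\<bar> + M * norm x * \<bar>(u - h) - (u - h')\<bar>)"
    using u h by (intro mult_left_mono add_mono S0_Lipschitz[OF M]) (auto simp: abs_le_iff)
  also have "\<dots> = M * norm x * \<bar>h - h'\<bar>" by (simp add: abs_minus_commute)
  finally show ?thesis .
qed

text \<open>The Volterra equation and Gronwall's inequality bound \<open>S(t,s)\<close> from \<open>X\<close> into \<open>E\<close>: the sine
  function gains one derivative, which compensates the loss in the perturbation.\<close>

lemma evolution_bounded_into_E: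
  assumes b: "b > 0" and gen: "generates_cosine_family D A C0" and adm: "admissible_perturbation A C0 Bt"
    and S: "associated_evolution_operator b A C0 Bt S"
  obtains M where "M > 0" "\<And>s t y. 0 \<le> s \<Longrightarrow> s \<le> t \<Longrightarrow> t \<le> b \<Longrightarrow> y \<in> E_space C0 \<Longrightarrow>
      S t s y \<in> E_space C0 \<and> pE (S t s y) \<le> M * norm y"
proof -
  obtain K where K: "K > 0" "\<And>\<tau> x. \<tau> \<in> {0..b} \<Longrightarrow> x \<in> E_space C0 \<Longrightarrow> norm (Bt \<tau> x) \<le> K * pE x"
    using perturbation_uniformly_bounded[OF gen adm, of b] by blast
  obtain M where M: "M > 0" "\<And>t. \<bar>t\<bar> \<le> b + 1 \<Longrightarrow> norm (C0 t) \<le> M" using C_bounded[of "b + 1"] by blast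
  define c where "c = (b + 1) * M"
  have c: "c > 0" using b M(1) by (simp add: c_def)
  have S0_le: "norm (S0 u x) \<le> b * M * norm x" if "u \<in> {0..b}" for u x
  proof -
    have "norm (S0 u x - S0 0 x) \<le> M * norm x * \<bar>u - 0\<bar>"
      by (rule S0_Lipschitz[OF M(2)]) (use that in auto)
    also have "\<dots> \<le> M * norm x * b" using that M(1) by (intro mult_left_mono) auto
    finally show ?thesis by (simp add: mult_ac)
  qed
  have main: "S t s y \<in> E_space C0 \<and> pE (S t s y) \<le> (2 * c * exp (2 * (c * K) * b)) * norm y"
    if st: "0 \<le> s" "s \<le> t" "t \<le> b" and y: "y \<in> E_space C0" for s t y
  proof -
    define z where "z t = S t s y" for t
    have "volterra_solution b A C0 Bt s y z"
      using S st y unfolding associated_evolution_operator_def z_def by auto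
    then have zE: "\<And>t. t \<in> {0..b} \<Longrightarrow> z t \<in> E_space C0"
      and z_cont: "\<And>t. t \<in> {0..b} \<Longrightarrow> ((\<lambda>r. E_norm A C0 (z r - z t)) \<longlongrightarrow> 0) (at t within {0..b})"
      and z_eq: "\<And>t. t \<in> {0..b} \<Longrightarrow> z t = S0 (t - s) y +
        oriented_integral s t (\<lambda>\<tau>. S0 (t - \<tau>) (Bt \<tau> (z \<tau>)))"
      unfolding volterra_solution_def by blast+
    define \<phi> where "\<phi> t = pE (z t)" for t
    have \<phi>_cont: "continuous_on {0..b} \<phi>"
      unfolding continuous_on_def
    proof
      fix t assume t: "t \<in> {0..b}"
      have "((\<lambda>r. \<phi> r - \<phi> t) \<longlongrightarrow> 0) (at t within {0..b})"
      proof (rule Lim_null_comparison[OF _ z_cont[OF t]])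
        have "norm (\<phi> r - \<phi> t) \<le> E_norm A C0 (z r - z t)" if r: "r \<in> {0..b}" for r
        proof -
          have d: "z r - z t \<in> E_space C0" using subspace_diff[OF E_subspace zE[OF r] zE[OF t]] .
          have "pE (z r) \<le> pE (z r - z t) + pE (z t)" using pE_add[OF d zE[OF t]] by simp
          moreover have "pE (z t) \<le> pE (z r - z t) + pE (z r)"
            using pE_add[OF E_scaleR(1)[OF d, of "-1"] zE[OF r]] pE_scaleR[OF d, of "-1"] by simp
          ultimately show ?thesis unfolding \<phi>_def E_norm_eq[OF gen d] by (simp add: abs_le_iff)
        qed
        then show "\<forall>\<^sub>F r in at t within {0..b}. norm (\<phi> r - \<phi> t) \<le> E_norm A C0 (z r - z t)"
          unfolding eventually_at by (intro exI[of _ 1]) auto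
      qed
      then show "(\<phi> \<longlongrightarrow> \<phi> t) (at t within {0..b})" by (simp add: LIM_zero_iff)
    qed
    have \<phi>_nonneg: "0 \<le> \<phi> t" if "t \<in> {0..b}" for t unfolding \<phi>_def by (rule pE_ge(2)[OF zE[OF that]])
    have \<phi>_int: "\<phi> integrable_on {s..t}" if "t \<in> {s..b}" for t
      using st that by (intro integrable_continuous_real continuous_on_subset[OF \<phi>_cont]) auto
    have \<phi>_le: "\<phi> t \<le> c * norm y + (c * K) * integral {s..t} \<phi>" if t: "t \<in> {s..b}" for t
    proof -
      define f where "f \<tau> = S0 (t - \<tau>) (Bt \<tau> (z \<tau>))" for \<tau>
      have tb: "t \<in> {0..b}" using st t by auto
      have zt: "z t = S0 (t - s) y + integral {s..t} f"
        using z_eq[OF tb] t by (simp add: oriented_integral_def f_def[abs_def])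
      have Bt_le: "norm (Bt \<tau> (z \<tau>)) \<le> K * \<phi> \<tau>" if "\<tau> \<in> {s..t}" for \<tau>
        unfolding \<phi>_def using that st t by (intro K(2) zE) auto
      have ts: "t - s \<in> {0..b}" using t st by auto
      have f_le: "norm (f \<tau>) \<le> b * M * K * \<phi> \<tau>" if \<tau>: "\<tau> \<in> {s..t}" for \<tau>
      proof -
        have "norm (f \<tau>) \<le> b * M * norm (Bt \<tau> (z \<tau>))"
          unfolding f_def using \<tau> t st by (intro S0_le) auto
        also have "\<dots> \<le> b * M * (K * \<phi> \<tau>)" using Bt_le[OF \<tau>] b M(1) by (intro mult_left_mono) auto
        finally show ?thesis by (simp add: mult_ac)
      qed
      have "norm (z t) \<le> norm (S0 (t - s) y) + norm (integral {s..t} f)"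
        unfolding zt by (rule norm_triangle_ineq)
      also have "\<dots> \<le> b * M * norm y + integral {s..t} (\<lambda>\<tau>. b * M * K * \<phi> \<tau>)"
        by (intro add_mono S0_le[OF ts] hilbert_integral_norm_bound f_le integrable_on_mult_right \<phi>_int t)
      finally have norm_z: "norm (z t) \<le> b * M * norm y + b * M * K * integral {s..t} \<phi>" by simp
      have "pE (z t) \<le> norm (z t) + (M * norm y + M * K * integral {s..t} \<phi>)"
      proof (rule pE_Lipschitz[OF zE[OF tb]])
        fix h h' :: real assume h: "h \<in> {0..1}" "h' \<in> {0..1}"
        have Tf: "norm ((C0 h - C0 h') (f \<tau>)) \<le> M * K * \<bar>h - h'\<bar> * \<phi> \<tau>" if \<tau>: "\<tau> \<in> {s..t}" for \<tau>
        proof -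
          have "norm ((C0 h - C0 h') (f \<tau>)) \<le> M * norm (Bt \<tau> (z \<tau>)) * \<bar>h - h'\<bar>"
            unfolding f_def using \<tau> t st by (intro C0_diff_S0[OF M(2) _ h]) auto
          also have "\<dots> \<le> M * (K * \<phi> \<tau>) * \<bar>h - h'\<bar>"
            using Bt_le[OF \<tau>] M(1) by (intro mult_right_mono mult_left_mono) auto
          finally show ?thesis by (simp add: mult_ac)
        qed
        have "C0 h (z t) - C0 h' (z t) = (C0 h - C0 h') (S0 (t - s) y) + (C0 h - C0 h') (integral {s..t} f)"
          unfolding zt by (simp add: blinfun.diff_left blinfun.add_right)
        also have "norm \<dots> \<le> norm ((C0 h - C0 h') (S0 (t - s) y)) + norm ((C0 h - C0 h') (integral {s..t} f))"
          by (rule norm_triangle_ineq)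
        also have "\<dots> \<le> M * norm y * \<bar>h - h'\<bar> + integral {s..t} (\<lambda>\<tau>. M * K * \<bar>h - h'\<bar> * \<phi> \<tau>)"
          by (intro add_mono C0_diff_S0[OF M(2) ts h] norm_blinfun_integral_le Tf integrable_on_mult_right \<phi>_int t)
        also have "\<dots> = (M * norm y + M * K * integral {s..t} \<phi>) * \<bar>h - h'\<bar>"
          by (simp add: algebra_simps)
        finally show "norm (C0 h (z t) - C0 h' (z t)) \<le> (M * norm y + M * K * integral {s..t} \<phi>) * \<bar>h - h'\<bar>" .
      qed
      then have "\<phi> t \<le> (b * M * norm y + b * M * K * integral {s..t} \<phi>) + (M * norm y + M * K * integral {s..t} \<phi>)"
        using norm_z unfolding \<phi>_def by linarith
      also have "\<dots> = c * norm y + (c * K) * integral {s..t} \<phi>" by (simp add: c_def algebra_simps)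
      finally show ?thesis .
    qed
    have "\<phi> t \<le> 2 * (c * norm y) * exp (2 * (c * K) * (t - s))"
    proof (rule gronwall_inequality[where T = b])
      show "continuous_on {s..b} \<phi>" using st by (intro continuous_on_subset[OF \<phi>_cont]) auto
    qed (use st c K(1) \<phi>_le \<phi>_nonneg in auto)
    also have "\<dots> \<le> 2 * (c * norm y) * exp (2 * (c * K) * b)"
      using st c K(1) by (intro mult_left_mono) auto
    finally have "\<phi> t \<le> (2 * c * exp (2 * (c * K) * b)) * norm y" by (simp add: mult_ac)
    then show ?thesis using zE[of t] st by (simp add: \<phi>_def z_def)
  qed
  show thesis
    by (rule that[of "2 * c * exp (2 * (c * K) * b)"]) (use c main in auto)
qed

lemma bounded_linear_S0: "bounded_linear (S0 h)"
proof -
  obtain M where M: "\<And>t. \<bar>t\<bar> \<le> \<bar>h\<bar> \<Longrightarrow> norm (C0 t) \<le> M" using C_bounded[of "\<bar>h\<bar>"] by blast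
  show ?thesis
  proof (rule bounded_linear_intro[OF S0_add S0_scaleR])
    show "norm (S0 h x) \<le> norm x * (M * \<bar>h\<bar>)" for x
      using S0_Lipschitz[OF M, where t = h and s = 0 and x = x] by (simp add: mult_ac)
  qed
qed

text \<open>Both sides are continuous in \<open>y\<close>, so the estimate extends from the dense subspace \<open>E\<close> to \<open>X\<close>.\<close>

lemma evolution_approximation:
  assumes b: "b > 0" and gen: "generates_cosine_family D A C0" and adm: "admissible_perturbation A C0 Bt"
    and S: "associated_evolution_operator b A C0 Bt S" and dense: "closure D = UNIV"
  obtains M where "M > 0" "\<And>h s t y. 0 < h \<Longrightarrow> h \<le> 1 \<Longrightarrow> 0 \<le> s \<Longrightarrow> s \<le> t \<Longrightarrow> t \<le> b \<Longrightarrow>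
      norm (S t s y - (1/h) *\<^sub>R S0 h (S t s y)) \<le> h * M * norm y"
proof -
  obtain M where M: "M > 0" "\<And>s t y. 0 \<le> s \<Longrightarrow> s \<le> t \<Longrightarrow> t \<le> b \<Longrightarrow> y \<in> E_space C0 \<Longrightarrow>
      S t s y \<in> E_space C0 \<and> pE (S t s y) \<le> M * norm y"
    using evolution_bounded_into_E[OF b gen adm S] by blast
  have "D \<subseteq> E_space C0" using gen unfolding generates_cosine_family_def E_space_def by blast
  then have dense_E: "closure (E_space C0) = UNIV" using dense closure_mono by blast
  have "norm (S t s y - (1/h) *\<^sub>R S0 h (S t s y)) \<le> h * M * norm y"
    if h: "0 < h" "h \<le> 1" and st: "0 \<le> s" "s \<le> t" "t \<le> b" for h s t y
  proof -
    let ?W = "{y. norm (S t s y - (1/h) *\<^sub>R S0 h (S t s y)) \<le> h * M * norm y}"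
    have "E_space C0 \<subseteq> ?W"
    proof (rule subsetI, rule CollectI)
      fix y assume y: "y \<in> E_space C0"
      have "norm (S t s y - (1/h) *\<^sub>R S0 h (S t s y)) \<le> h * pE (S t s y)"
        by (rule E_approximation[OF _ h]) (use M(2)[OF st y] in blast)
      also have "\<dots> \<le> h * (M * norm y)" using M(2)[OF st y] h by (intro mult_left_mono) auto
      finally show "norm (S t s y - (1/h) *\<^sub>R S0 h (S t s y)) \<le> h * M * norm y" by (simp add: mult_ac)
    qed
    moreover have "closed ?W"
      by (intro closed_Collect_le continuous_intros bounded_linear.continuous_on[OF bounded_linear_S0])
    ultimately have "closure (E_space C0) \<subseteq> ?W" by (rule closure_minimal)
    then show ?thesis using dense_E by blast
  qed
  with M(1) show thesis by (rule that)
qed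

text \<open>These sets stand for compact sets in what follows: unlike an explicit compact set, membership
  passes to integrals because it is expressed by bounds on linear operators.\<close>

definition approximated_by_sine :: "real \<Rightarrow> 'x set" where
  "approximated_by_sine R = {v. norm v \<le> R \<and> (\<forall>h. 0 < h \<and> h \<le> 1 \<longrightarrow> norm (v - (1/h) *\<^sub>R S0 h v) \<le> h * R)}"

lemma approximated_by_sine_totally_bounded:
  assumes compact: "\<forall>t>0. compact_op (S0 t)" and e: "e > 0"
  shows "\<exists>Z. finite Z \<and> (\<forall>v\<in>approximated_by_sine R. \<exists>z\<in>Z. dist z v < e)"
proof -
  define h where "h = min 1 (e / (2 * (\<bar>R\<bar> + 1)))"
  have h: "0 < h" "h \<le> 1" using e by (auto simp: h_def)
  have hR: "h * R < e / 2 \<or> R \<le> 0"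
  proof -
    have "h * (\<bar>R\<bar> + 1) \<le> e / (2 * (\<bar>R\<bar> + 1)) * (\<bar>R\<bar> + 1)" by (rule mult_right_mono) (auto simp: h_def)
    also have "\<dots> = e / 2"
    proof -
      have "x / (2 * y) * y = x / 2" if "y > 0" for x y :: real using that by simp
      then show ?thesis by this linarith
    qed
    finally have "h * \<bar>R\<bar> + h \<le> e / 2" by (simp add: algebra_simps)
    moreover have "h * R \<le> h * \<bar>R\<bar>" using h by (intro mult_left_mono) auto
    ultimately show ?thesis using h by linarith
  qed
  have hR': "h * R < e / 2"
  proof (cases "R \<le> 0")
    case True
    then have "h * R \<le> 0" using h by (simp add: mult_nonneg_nonpos)
    then show ?thesis using e by linarith
  qed (use hR in blast)
  have "compact (closure (S0 h ` cball 0 R))"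
    using compact h bounded_cball unfolding compact_op_def by blast
  moreover have "h * (e / 2) > 0" using h e by simp
  ultimately obtain Z where Z: "finite Z" "closure (S0 h ` cball 0 R) \<subseteq> (\<Union>z\<in>Z. ball z (h * (e / 2)))"
    unfolding compact_eq_totally_bounded by blast
  have "\<exists>z\<in>(\<lambda>z. (1/h) *\<^sub>R z) ` Z. dist z v < e" if v: "v \<in> approximated_by_sine R" for v
  proof -
    have "S0 h v \<in> closure (S0 h ` cball 0 R)"
      using v by (intro subsetD[OF closure_subset] imageI) (simp add: approximated_by_sine_def)
    then obtain z where z: "z \<in> Z" "dist z (S0 h v) < h * (e / 2)" using Z(2) by auto
    have "dist ((1/h) *\<^sub>R z) ((1/h) *\<^sub>R S0 h v) = (1/h) * dist z (S0 h v)"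
      using h by (simp add: dist_norm flip: scaleR_diff_right)
    also have "\<dots> < e / 2" using z(2) h by (simp add: field_simps)
    finally have 1: "dist ((1/h) *\<^sub>R z) ((1/h) *\<^sub>R S0 h v) < e / 2" .
    have "dist ((1/h) *\<^sub>R S0 h v) v \<le> h * R"
      using v h unfolding approximated_by_sine_def by (auto simp: dist_norm norm_minus_commute)
    then have "dist ((1/h) *\<^sub>R z) v < e"
      using 1 hR' dist_triangle[of "(1/h) *\<^sub>R z" v "(1/h) *\<^sub>R S0 h v"] by linarith
    then show ?thesis using z(1) by blast
  qed
  then show ?thesis using Z(1) by (intro exI[of _ "(\<lambda>z. (1/h) *\<^sub>R z) ` Z"]) auto
qed

end

text \<open>By (Z1) the difference quotients of \<open>S\<close> are pointwise bounded, hence bounded in norm; so \<open>S\<close>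
  is Lipschitz continuous in the operator norm.\<close>

lemma evolution_Lipschitz:
  fixes S :: "real \<Rightarrow> real \<Rightarrow> 'x::{real_normed_vector,complete_space} \<Rightarrow>\<^sub>L 'x"
  assumes Z1: "evolution_Z1 b S"
  obtains \<Lambda> where "\<Lambda> > 0"
    "\<And>t t' s. t \<in> {0..b} \<Longrightarrow> t' \<in> {0..b} \<Longrightarrow> s \<in> {0..b} \<Longrightarrow> norm (S t s - S t' s) \<le> \<Lambda> * \<bar>t - t'\<bar>"
    "\<And>t s s'. t \<in> {0..b} \<Longrightarrow> s \<in> {0..b} \<Longrightarrow> s' \<in> {0..b} \<Longrightarrow> norm (S t s - S t s') \<le> \<Lambda> * \<bar>s - s'\<bar>"
proof -
  have C1: "C1_square b (\<lambda>t s. S t s x)" for x using Z1 unfolding evolution_Z1_def by blast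
  let ?I = "{0..b} \<times> {0..b} \<times> {0..b}"
  have quotient: "\<exists>K>0. \<forall>(r, r', q)\<in>?I. norm (T r q - T r' q) \<le> K * \<bar>r - r'\<bar>"
    if T: "\<And>x. \<exists>K. \<forall>(r, r', q)\<in>?I. norm (T r q x - T r' q x) \<le> K * \<bar>r - r'\<bar>"
    for T :: "real \<Rightarrow> real \<Rightarrow> 'x \<Rightarrow>\<^sub>L 'x"
  proof -
    define Q where "Q i = (case i of (r, r', q) \<Rightarrow> inverse \<bar>r - r'\<bar> *\<^sub>R (T r q - T r' q))" for i
    have "\<exists>K. \<forall>i\<in>?I. norm (Q i x) \<le> K" for x
    proof -
      obtain K where K: "\<And>r r' q. (r, r', q) \<in> ?I \<Longrightarrow> norm (T r q x - T r' q x) \<le> K * \<bar>r - r'\<bar>"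
        using T[of x] by blast
      have "norm (Q (r, r', q) x) \<le> \<bar>K\<bar>" if "(r, r', q) \<in> ?I" for r r' q
      proof (cases "r = r'")
        case False
        have "norm (Q (r, r', q) x) = inverse \<bar>r - r'\<bar> * norm (T r q x - T r' q x)"
          by (simp add: Q_def blinfun.scaleR_left blinfun.diff_left)
        also have "\<dots> \<le> inverse \<bar>r - r'\<bar> * (K * \<bar>r - r'\<bar>)" by (intro mult_left_mono K that) simp
        also have "\<dots> = K" using False by simp
        finally show ?thesis by simp
      qed (simp add: Q_def)
      then show ?thesis by (intro exI[of _ "\<bar>K\<bar>"]) auto
    qed
    then obtain K where K: "\<And>i. i \<in> ?I \<Longrightarrow> norm (Q i) \<le> K" "K > 0" by (rule banach_steinhaus) blast
    have "norm (T r q - T r' q) \<le> K * \<bar>r - r'\<bar>" if "(r, r', q) \<in> ?I" for r r' q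
    proof (cases "r = r'")
      case False
      have "norm (Q (r, r', q)) = inverse \<bar>r - r'\<bar> * norm (T r q - T r' q)" by (simp add: Q_def)
      then have "inverse \<bar>r - r'\<bar> * norm (T r q - T r' q) \<le> K" using K(1)[OF that] by simp
      then show ?thesis using False by (simp add: field_simps)
    qed simp
    then show ?thesis using K(2) by blast
  qed
  have bound: "\<exists>K. \<forall>t\<in>{0..b}. \<forall>s\<in>{0..b}. norm (g t s) \<le> K"
    if "continuous_on ({0..b} \<times> {0..b}) (\<lambda>(t, s). g t s)" for g :: "real \<Rightarrow> real \<Rightarrow> 'x"
  proof -
    have "compact ((\<lambda>(t, s). g t s) ` ({0..b} \<times> {0..b}))"
      by (rule compact_continuous_image[OF that]) (intro compact_Times compact_Icc)
    from compact_imp_bounded[OF this] show ?thesis by (force simp: bounded_iff)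
  qed
  have 1: "\<exists>K. \<forall>(r, r', q)\<in>?I. norm (S r q x - S r' q x) \<le> K * \<bar>r - r'\<bar>" for x
  proof -
    obtain K where K: "\<And>t s. t \<in> {0..b} \<Longrightarrow> s \<in> {0..b} \<Longrightarrow> norm (D_fst b (\<lambda>t s. S t s x) t s) \<le> K"
      using bound C1[of x] unfolding C1_square_def by blast
    have "norm (S r q x - S r' q x) \<le> K * \<bar>r - r'\<bar>" if rq: "(r, r', q) \<in> ?I" for r r' q
    proof (rule has_vector_derivative_Lipschitz[of 0 b "\<lambda>r. S r q x" "\<lambda>r. D_fst b (\<lambda>t s. S t s x) r q"])
      show "((\<lambda>r. S r q x) has_vector_derivative D_fst b (\<lambda>t s. S t s x) u q) (at u within {0..b})"
        if "u \<in> {0..b}" for u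
        using C1[of x] rq that unfolding C1_square_def D_fst_def vector_derivative_works[symmetric] by auto
    qed (use rq K in auto)
    then show ?thesis by blast
  qed
  have 2: "\<exists>K. \<forall>(r, r', q)\<in>?I. norm (S q r x - S q r' x) \<le> K * \<bar>r - r'\<bar>" for x
  proof -
    obtain K where K: "\<And>t s. t \<in> {0..b} \<Longrightarrow> s \<in> {0..b} \<Longrightarrow> norm (D_snd b (\<lambda>t s. S t s x) t s) \<le> K"
      using bound C1[of x] unfolding C1_square_def by blast
    have "norm (S q r x - S q r' x) \<le> K * \<bar>r - r'\<bar>" if rq: "(r, r', q) \<in> ?I" for r r' q
    proof (rule has_vector_derivative_Lipschitz[of 0 b "\<lambda>r. S q r x" "\<lambda>r. D_snd b (\<lambda>t s. S t s x) q r"])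
      show "((\<lambda>r. S q r x) has_vector_derivative D_snd b (\<lambda>t s. S t s x) q u) (at u within {0..b})"
        if "u \<in> {0..b}" for u
        using C1[of x] rq that unfolding C1_square_def D_snd_def vector_derivative_works[symmetric] by auto
    qed (use rq K in auto)
    then show ?thesis by blast
  qed
  obtain K1 where K1: "K1 > 0" "\<And>r r' q. (r, r', q) \<in> ?I \<Longrightarrow> norm (S r q - S r' q) \<le> K1 * \<bar>r - r'\<bar>"
    using quotient[of S, OF 1] by blast
  obtain K2 where K2: "K2 > 0" "\<And>r r' q. (r, r', q) \<in> ?I \<Longrightarrow> norm (S q r - S q r') \<le> K2 * \<bar>r - r'\<bar>"
    using quotient[of "\<lambda>r q. S q r", OF 2] by blast
  show thesis
  proof (rule that[of "K1 + K2"])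
    show "K1 + K2 > 0" using K1 K2 by simp
    show "norm (S t s - S t' s) \<le> (K1 + K2) * \<bar>t - t'\<bar>" if "t \<in> {0..b}" "t' \<in> {0..b}" "s \<in> {0..b}" for t t' s
    proof -
      have "norm (S t s - S t' s) \<le> K1 * \<bar>t - t'\<bar>" using that by (intro K1) auto
      also have "\<dots> \<le> (K1 + K2) * \<bar>t - t'\<bar>" using K2 by (intro mult_right_mono) auto
      finally show ?thesis .
    qed
    show "norm (S t s - S t s') \<le> (K1 + K2) * \<bar>s - s'\<bar>" if "t \<in> {0..b}" "s \<in> {0..b}" "s' \<in> {0..b}" for t s s'
    proof -
      have "norm (S t s - S t s') \<le> K2 * \<bar>s - s'\<bar>" using that by (intro K2) auto
      also have "\<dots> \<le> (K1 + K2) * \<bar>s - s'\<bar>" using K1 by (intro mult_right_mono) auto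
      finally show ?thesis .
    qed
  qed
qed

section \<open>Approximate fixed points\<close>

text \<open>Kuhn's combinatorial lemma yields an approximate form of Brouwer's theorem on a cube whose
  dimension is a number and not a type.\<close>

lemma cube_approximate_fixed_point:
  fixes G :: "(nat \<Rightarrow> real) \<Rightarrow> nat \<Rightarrow> real"
  assumes cube: "\<And>c. \<forall>i<n. 0 \<le> c i \<and> c i \<le> 1 \<Longrightarrow> \<forall>i<n. 0 \<le> G c i \<and> G c i \<le> 1"
    and Lip: "\<And>c c' d. \<forall>i<n. 0 \<le> c i \<and> c i \<le> 1 \<Longrightarrow> \<forall>i<n. 0 \<le> c' i \<and> c' i \<le> 1 \<Longrightarrow>
        \<forall>i<n. \<bar>c i - c' i\<bar> \<le> d \<Longrightarrow> \<forall>i<n. \<bar>G c i - G c' i\<bar> \<le> \<Lambda> * d"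
    and \<Lambda>: "\<Lambda> \<ge> 0" and e: "e > 0"
  obtains c where "\<forall>i<n. 0 \<le> c i \<and> c i \<le> 1" "\<forall>i<n. \<bar>G c i - c i\<bar> \<le> e"
proof -
  obtain p :: nat where p: "real p > (\<Lambda> + 1) / e" using reals_Archimedean2 by blast
  have p0: "0 < p" using p e \<Lambda> by (metis add_nonneg_pos divide_pos_pos less_trans of_nat_0_less_iff zero_less_one)
  define d where "d = 1 / real p"
  have d: "d > 0" "(\<Lambda> + 1) * d \<le> e" using p p0 e by (auto simp: d_def field_simps)
  define pt where "pt x i = real (x i) * d" for x :: "nat \<Rightarrow> nat" and i
  have pt: "\<forall>i<n. 0 \<le> pt x i \<and> pt x i \<le> 1" if "\<forall>i<n. x i \<le> p" for x
    using that p0 by (auto simp: pt_def d_def divide_le_eq_1)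
  \<comment> \<open>the label tells whether \<open>G\<close> does not decrease or does not increase the coordinate\<close>
  define label :: "(nat \<Rightarrow> nat) \<Rightarrow> nat \<Rightarrow> nat"
    where "label x i = (if x i = 0 \<or> (x i < p \<and> pt x i \<le> G (pt x) i) then 0 else 1)" for x i
  obtain q where q: "\<forall>i<n. q i < p"
    "\<forall>i<n. \<exists>r s. (\<forall>j<n. q j \<le> r j \<and> r j \<le> q j + 1) \<and> (\<forall>j<n. q j \<le> s j \<and> s j \<le> q j + 1) \<and> label r i \<noteq> label s i"
  proof (rule kuhn_lemma[OF p0, of n label])
    show "\<forall>x. (\<forall>i<n. x i \<le> p) \<longrightarrow> (\<forall>i<n. x i = p \<longrightarrow> label x i = 1)" using p0 by (simp add: label_def)
  qed (auto simp: label_def)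
  have label0: "pt x i \<le> G (pt x) i" if "label x i = 0" "\<forall>i<n. x i \<le> p" "i < n" for x i
  proof (cases "x i = 0")
    case True
    then have "pt x i = 0" by (simp add: pt_def)
    then show ?thesis using cube[OF pt[OF that(2)]] that(3) by simp
  qed (use that(1) in \<open>auto simp: label_def split: if_splits\<close>)
  have label1: "G (pt x) i \<le> pt x i" if l: "label x i \<noteq> 0" and x: "\<forall>i<n. x i \<le> p" and i: "i < n" for x i
  proof (cases "x i < p")
    case False
    then have "pt x i = 1" using x i p0 by (simp add: pt_def d_def le_antisym not_less)
    then show ?thesis using cube[OF pt[OF x]] i by simp
  qed (use l in \<open>auto simp: label_def split: if_splits\<close>)
  define c where "c = pt q"
  have qp: "\<forall>i<n. q i \<le> p" using q(1) by (simp add: less_imp_le)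
  have cell: "\<bar>G c i - G (pt r) i\<bar> \<le> \<Lambda> * d \<and> c i \<le> pt r i \<and> pt r i \<le> c i + d \<and> (\<forall>j<n. r j \<le> p)"
    if i: "i < n" and r: "\<forall>j<n. q j \<le> r j \<and> r j \<le> q j + 1" for r i
  proof -
    have rp: "\<forall>j<n. r j \<le> p" using r q(1) by (metis Suc_eq_plus1 Suc_leI order_trans)
    have le: "c j \<le> pt r j \<and> pt r j \<le> c j + d" if "j < n" for j
    proof -
      have "real (q j) * d \<le> real (r j) * d" using r that d(1) by simp
      moreover have "real (r j) * d \<le> (real (q j) + 1) * d"
        using r[rule_format, OF that] d(1) by (intro mult_right_mono) linarith+
      ultimately show ?thesis by (simp add: c_def pt_def algebra_simps)
    qed
    then have "\<forall>j<n. \<bar>c j - pt r j\<bar> \<le> d" by (simp add: abs_le_iff) (metis add.commute diff_le_eq le_add_same_cancel2 less_imp_le d(1) order_trans)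
    from Lip[OF _ pt[OF rp] this] have "\<bar>G c i - G (pt r) i\<bar> \<le> \<Lambda> * d" using pt[OF qp] i unfolding c_def by blast
    then show ?thesis using le[OF i] rp by blast
  qed
  have "\<bar>G c i - c i\<bar> \<le> e" if i: "i < n" for i
  proof -
    obtain r s where r: "\<forall>j<n. q j \<le> r j \<and> r j \<le> q j + 1" and s: "\<forall>j<n. q j \<le> s j \<and> s j \<le> q j + 1"
      and ne: "label r i \<noteq> label s i"
      using q(2) i by blast
    have key: "\<bar>G c i - c i\<bar> \<le> e" if r: "\<forall>j<n. q j \<le> r j \<and> r j \<le> q j + 1" "label r i = 0"
      and s: "\<forall>j<n. q j \<le> s j \<and> s j \<le> q j + 1" "label s i \<noteq> 0" for r s
    proof -
      note cr = cell[OF i r(1)] and cs = cell[OF i s(1)]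
      have "pt r i \<le> G (pt r) i" using label0[OF r(2) _ i] cr by blast
      moreover have "G (pt s) i \<le> pt s i" using label1[OF s(2) _ i] cs by blast
      moreover have "\<Lambda> * d + d \<le> e" using d(2) by (simp add: algebra_simps)
      ultimately show ?thesis using cr cs d(1) by (simp add: abs_le_iff)
    qed
    have "label x i = 0 \<or> label x i = 1" for x by (simp add: label_def)
    then have "label r i = 0 \<or> label s i = 0" using ne by metis
    then show ?thesis using key[OF r _ s] key[OF s _ r] ne by auto
  qed
  moreover have "\<forall>i<n. 0 \<le> c i \<and> c i \<le> 1" using pt[OF qp] by (simp add: c_def)
  ultimately show thesis using that by blast
qed

text \<open>For an arbitrary selection \<open>\<sigma>\<close>, the partition of unity \<open>\<nu>\<close> subordinate to a finite net \<open>I\<close> gives the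
  Lipschitz continuous substitute \<open>y \<mapsto> \<Sum>i\<in>I. \<nu> y i *\<^sub>R \<sigma> i\<close>, which at \<open>y\<close> involves only points of \<open>I\<close>
  near \<open>y\<close>. In terms of the weights it becomes a map of a cube. To stay inside \<open>K\<close>, weights with a
  sum above \<open>1\<close> are normalized, and those with a sum below \<open>1\<close> are completed by a base point.\<close>

theorem convexified_approximate_fixed_point:
  fixes K :: "'y::real_normed_vector set" and \<sigma> :: "'y \<Rightarrow> 'y"
  assumes K: "convex K" "K \<noteq> {}" and \<sigma>: "\<And>x. x \<in> K \<Longrightarrow> \<sigma> x \<in> K"
    and net: "\<And>e. e > 0 \<Longrightarrow> \<exists>I\<subseteq>K. finite I \<and> (\<forall>x\<in>K. \<exists>i\<in>I. dist i x < e)"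
    and e: "e > 0"
  obtains I \<mu> where "finite I" "I \<subseteq> K" "\<And>i. i \<in> I \<Longrightarrow> 0 \<le> \<mu> i" "sum \<mu> I = (1::real)"
    "\<And>i. i \<in> I \<Longrightarrow> dist i (\<Sum>j\<in>I. \<mu> j *\<^sub>R \<sigma> j) < e"
proof -
  define \<epsilon> where "\<epsilon> = e / 2"
  have \<epsilon>: "\<epsilon> > 0" using e by (simp add: \<epsilon>_def)
  obtain I where I: "I \<subseteq> K" "finite I" "\<And>x. x \<in> K \<Longrightarrow> \<exists>i\<in>I. dist i x < \<epsilon> / 2"
    using net[of "\<epsilon> / 2"] \<epsilon> by auto
  obtain b0 where b0: "b0 \<in> K" using K by blast
  obtain M where M: "M > 0" "\<And>x. x \<in> K \<Longrightarrow> norm x \<le> M"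
  proof -
    obtain M where M: "\<And>i. i \<in> I \<Longrightarrow> norm i \<le> M" using finite_imp_bounded[OF I(2)] by (auto simp: bounded_iff)
    have "norm x \<le> \<bar>M\<bar> + \<epsilon>" if x: "x \<in> K" for x
    proof -
      obtain i where i: "i \<in> I" "dist i x < \<epsilon> / 2" using I(3)[OF x] by blast
      have "norm x \<le> norm i + norm (x - i)" by (metis norm_triangle_sub)
      then show ?thesis using i(2) M[OF i(1)] \<epsilon> by (simp add: dist_norm norm_minus_commute)
    qed
    then show thesis using \<epsilon> by (intro that[of "\<bar>M\<bar> + \<epsilon>"]) (auto simp: add_nonneg_pos)
  qed
  define w where "w i y = max 0 (\<epsilon> - dist i y)" for i y :: 'y
  define W where "W y = (\<Sum>i\<in>I. w i y)" for y
  define \<nu> where "\<nu> y i = w i y / W y" for y i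
  have w: "0 \<le> w i y" "w i y \<le> W y" if "i \<in> I" for i y
  proof -
    show "0 \<le> w i y" by (simp add: w_def)
    show "w i y \<le> W y" unfolding W_def by (rule member_le_sum[OF that _ I(2)]) (simp add: w_def)
  qed
  have W: "\<epsilon> / 2 \<le> W y" if y: "y \<in> K" for y
  proof -
    obtain i where i: "i \<in> I" "dist i y < \<epsilon> / 2" using I(3)[OF y] by blast
    have "\<epsilon> / 2 \<le> w i y" unfolding w_def by (rule max.coboundedI2) (use i(2) in linarith)
    also have "\<dots> \<le> W y" by (rule w(2)[OF i(1)])
    finally show ?thesis .
  qed
  have Wpos: "W y > 0" if "y \<in> K" for y using W[OF that] \<epsilon> by linarith
  have \<nu>: "0 \<le> \<nu> y i" "\<nu> y i \<le> 1" if "i \<in> I" "y \<in> K" for y i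
    using w[OF that(1), of y] Wpos[OF that(2)] by (auto simp: \<nu>_def)
  have \<nu>_sum: "(\<Sum>i\<in>I. \<nu> y i) = 1" if "y \<in> K" for y
    using Wpos[OF that] unfolding \<nu>_def sum_divide_distrib[symmetric] W_def by simp
  define m where "m = card I"
  have w_Lip: "\<bar>w i y - w i y'\<bar> \<le> dist y y'" for i y y'
    using dist_triangle[of i y y'] dist_triangle[of i y' y] unfolding w_def by (auto simp: dist_commute)
  have \<nu>_Lip: "\<bar>\<nu> y i - \<nu> y' i\<bar> \<le> (real m + 1) * (2 / \<epsilon>) * dist y y'" if i: "i \<in> I" and y: "y \<in> K" "y' \<in> K" for i y y'
  proof -
    have "\<bar>W y' - W y\<bar> \<le> (\<Sum>i\<in>I. \<bar>w i y' - w i y\<bar>)"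
      unfolding W_def sum_subtractf[symmetric] by (rule sum_abs)
    also have "\<dots> \<le> (\<Sum>i\<in>I. dist y y')" by (intro sum_mono) (metis w_Lip dist_commute)
    finally have WW: "\<bar>W y' - W y\<bar> \<le> real m * dist y y'" by (simp add: m_def)
    have eq: "\<nu> y i - \<nu> y' i = (w i y - w i y') / W y + \<nu> y' i * ((W y' - W y) / W y)"
      using Wpos[OF y(1)] Wpos[OF y(2)] by (simp add: \<nu>_def field_simps)
    have inv: "1 / W y \<le> 2 / \<epsilon>" using W[OF y(1)] Wpos[OF y(1)] \<epsilon> by (simp add: field_simps)
    have "\<bar>\<nu> y i - \<nu> y' i\<bar> \<le> \<bar>(w i y - w i y') / W y\<bar> + \<bar>\<nu> y' i * ((W y' - W y) / W y)\<bar>"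
      unfolding eq by (rule abs_triangle_ineq)
    also have "\<dots> = \<bar>w i y - w i y'\<bar> * (1 / W y) + \<nu> y' i * (\<bar>W y' - W y\<bar> * (1 / W y))"
      using Wpos[OF y(1)] \<nu>(1)[OF i y(2)] by (simp add: abs_mult)
    also have "\<dots> \<le> dist y y' * (2 / \<epsilon>) + 1 * (real m * dist y y' * (2 / \<epsilon>))"
      using Wpos[OF y(1)] \<nu>[OF i y(2)] inv WW w_Lip \<epsilon> by (intro add_mono mult_mono) auto
    also have "\<dots> = (real m + 1) * (2 / \<epsilon>) * dist y y'" by (simp add: algebra_simps add_divide_distrib)
    finally show ?thesis .
  qed
  obtain z where z: "bij_betw z {..<m} I"
    using ex_bij_betw_nat_finite[OF I(2)] by (auto simp: m_def lessThan_atLeast0)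
  have zI: "z j \<in> I" if "j < m" for j using z that by (auto simp: bij_betw_def)
  have \<sigma>z: "\<sigma> (z j) \<in> K" if "j < m" for j using zI[OF that] I(1) \<sigma> by blast
  have reindex: "(\<Sum>j<m. f (z j)) = (\<Sum>i\<in>I. f i)" for f :: "'y \<Rightarrow> 'b::comm_monoid_add"
    by (rule sum.reindex_bij_betw[OF z])
  define s where "s c = (\<Sum>j<m. c j)" for c :: "nat \<Rightarrow> real"
  define \<tau> where "\<tau> r = 1 / max 1 r" for r :: real
  define y where "y c = (\<Sum>j<m. (\<tau> (s c) * c j) *\<^sub>R \<sigma> (z j)) + (1 - \<tau> (s c) * s c) *\<^sub>R b0" for c
  have \<tau>: "0 < \<tau> r" "\<tau> r \<le> 1" for r by (auto simp: \<tau>_def)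
  have \<tau>s: "\<tau> r * r = min 1 r" for r by (auto simp: \<tau>_def max_def min_def)
  have \<tau>_Lip: "\<bar>\<tau> r - \<tau> r'\<bar> \<le> \<bar>r - r'\<bar>" for r r'
  proof -
    have "\<tau> r - \<tau> r' = (max 1 r' - max 1 r) * (\<tau> r * \<tau> r')" by (simp add: \<tau>_def field_simps)
    then have "\<bar>\<tau> r - \<tau> r'\<bar> = \<bar>max 1 r' - max 1 r\<bar> * (\<tau> r * \<tau> r')"
      using \<tau>(1)[of r] \<tau>(1)[of r'] by (simp add: abs_mult)
    also have "\<dots> \<le> \<bar>max 1 r' - max 1 r\<bar> * (1 * 1)"
      using \<tau>(1)[of r] \<tau>(1)[of r'] \<tau>(2)[of r] \<tau>(2)[of r'] by (intro mult_left_mono mult_mono) auto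
    also have "\<dots> \<le> \<bar>r - r'\<bar>" by (auto simp: max_def)
    finally show ?thesis .
  qed
  let ?cube = "\<lambda>c. \<forall>i<m. 0 \<le> c i \<and> c i \<le> (1::real)"
  have s_nonneg: "0 \<le> s c" if "?cube c" for c unfolding s_def using that by (intro sum_nonneg) auto
  have yK: "y c \<in> K" if c: "?cube c" for c
  proof -
    define g where "g j = (if j < m then \<tau> (s c) * c j else 1 - \<tau> (s c) * s c)" for j
    define v where "v j = (if j < m then \<sigma> (z j) else b0)" for j
    have "(\<Sum>j<Suc m. g j) = (\<Sum>j<m. \<tau> (s c) * c j) + (1 - \<tau> (s c) * s c)" by (simp add: g_def)
    then have 1: "(\<Sum>j<Suc m. g j) = 1" by (simp add: s_def flip: sum_distrib_left)
    have 2: "(\<Sum>j<Suc m. g j *\<^sub>R v j) = y c" by (simp add: g_def v_def y_def)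
    have "(\<Sum>j<Suc m. g j *\<^sub>R v j) \<in> K"
    proof (rule convex_sum[OF _ K(1) 1])
      show "0 \<le> g j" for j using c \<tau>(1)[of "s c"] \<tau>s[of "s c"] by (auto simp: g_def)
      show "v j \<in> K" for j using \<sigma>z b0 by (simp add: v_def)
    qed simp
    then show ?thesis using 2 by simp
  qed
  define L1 where "L1 = real m * (real m + 1) * M + real m * M"
  have L1: "L1 \<ge> 0" using M(1) by (simp add: L1_def)
  have y_Lip: "dist (y c) (y c') \<le> L1 * d" if c: "?cube c" "?cube c'" and d: "\<forall>i<m. \<bar>c i - c' i\<bar> \<le> d" for c c' d
  proof -
    have ss: "\<bar>s c - s c'\<bar> \<le> real m * d"
    proof -
      have "\<bar>s c - s c'\<bar> \<le> (\<Sum>j<m. \<bar>c j - c' j\<bar>)" unfolding s_def sum_subtractf[symmetric] by (rule sum_abs)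
      also have "\<dots> \<le> (\<Sum>j<m. d)" using d by (intro sum_mono) auto
      finally show ?thesis by simp
    qed
    have coeff: "\<bar>\<tau> (s c) * c j - \<tau> (s c') * c' j\<bar> \<le> (real m + 1) * d" if j: "j < m" for j
    proof -
      have "\<tau> (s c) * c j - \<tau> (s c') * c' j = \<tau> (s c) * (c j - c' j) + (\<tau> (s c) - \<tau> (s c')) * c' j"
        by (simp add: algebra_simps)
      also have "\<bar>\<dots>\<bar> \<le> \<tau> (s c) * \<bar>c j - c' j\<bar> + \<bar>\<tau> (s c) - \<tau> (s c')\<bar> * c' j"
        using c(2) j \<tau>(1)[of "s c"] abs_triangle_ineq[of "\<tau> (s c) * (c j - c' j)" "(\<tau> (s c) - \<tau> (s c')) * c' j"]
        by (simp add: abs_mult)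
      also have "\<dots> \<le> 1 * d + (real m * d) * 1"
      proof (intro add_mono mult_mono)
        show "\<bar>\<tau> (s c) - \<tau> (s c')\<bar> \<le> real m * d" using \<tau>_Lip[of "s c" "s c'"] ss by linarith
      qed (use \<tau>[of "s c"] d c(2) j ss in \<open>auto intro: order_trans[OF abs_ge_zero]\<close>)
      finally show ?thesis by (simp add: algebra_simps)
    qed
    have rest: "\<bar>\<tau> (s c') * s c' - \<tau> (s c) * s c\<bar> \<le> real m * d" unfolding \<tau>s using ss by linarith
    have "y c - y c' = (\<Sum>j<m. (\<tau> (s c) * c j - \<tau> (s c') * c' j) *\<^sub>R \<sigma> (z j))
        + (\<tau> (s c') * s c' - \<tau> (s c) * s c) *\<^sub>R b0"
      by (simp add: y_def sum_subtractf scaleR_diff_left)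
    then have "norm (y c - y c') \<le> norm (\<Sum>j<m. (\<tau> (s c) * c j - \<tau> (s c') * c' j) *\<^sub>R \<sigma> (z j))
        + norm ((\<tau> (s c') * s c' - \<tau> (s c) * s c) *\<^sub>R b0)"
      using norm_triangle_ineq by metis
    also have "\<dots> \<le> (\<Sum>j<m. (real m + 1) * d * M) + real m * d * M"
    proof (rule add_mono)
      show "norm (\<Sum>j<m. (\<tau> (s c) * c j - \<tau> (s c') * c' j) *\<^sub>R \<sigma> (z j)) \<le> (\<Sum>j<m. (real m + 1) * d * M)"
      proof (rule sum_norm_le)
        fix j assume "j \<in> {..<m}"
        then have j: "j < m" by simp
        show "norm ((\<tau> (s c) * c j - \<tau> (s c') * c' j) *\<^sub>R \<sigma> (z j)) \<le> (real m + 1) * d * M"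
          unfolding norm_scaleR
          by (rule mult_mono[OF coeff[OF j] M(2)[OF \<sigma>z[OF j]]]) (use coeff[OF j] in auto)
      qed
      show "norm ((\<tau> (s c') * s c' - \<tau> (s c) * s c) *\<^sub>R b0) \<le> real m * d * M"
        unfolding norm_scaleR by (rule mult_mono[OF rest M(2)[OF b0]]) (use rest in auto)
    qed
    also have "\<dots> = L1 * d" by (simp add: L1_def algebra_simps)
    finally show ?thesis by (simp add: dist_norm)
  qed
  define G where "G c j = \<nu> (y c) (z j)" for c j
  define \<Lambda> where "\<Lambda> = (real m + 1) * (2 / \<epsilon>) * L1"
  have \<Lambda>: "\<Lambda> \<ge> 0" using \<epsilon> L1 by (simp add: \<Lambda>_def)
  \<comment> \<open>replacing the weights \<open>c\<close> by \<open>G c\<close> moves the point by at most \<open>3 m \<delta> M\<close>\<close>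
  define \<delta> where "\<delta> = \<epsilon> / (4 * (real m + 1) * M)"
  have \<delta>: "\<delta> > 0" using \<epsilon> M(1) by (simp add: \<delta>_def)
  obtain c where c: "?cube c" "\<forall>i<m. \<bar>G c i - c i\<bar> \<le> \<delta>"
  proof (rule cube_approximate_fixed_point[of m G \<Lambda> \<delta>])
    show "\<forall>i<m. 0 \<le> G c i \<and> G c i \<le> 1" if "?cube c" for c
      using \<nu>[OF zI yK[OF that]] by (simp add: G_def)
    show "\<forall>i<m. \<bar>G c i - G c' i\<bar> \<le> \<Lambda> * d" if "?cube c" "?cube c'" "\<forall>i<m. \<bar>c i - c' i\<bar> \<le> d" for c c' d
    proof (intro allI impI)
      fix i assume i: "i < m"
      have "\<bar>G c i - G c' i\<bar> \<le> (real m + 1) * (2 / \<epsilon>) * dist (y c) (y c')"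
        unfolding G_def by (rule \<nu>_Lip[OF zI[OF i] yK[OF that(1)] yK[OF that(2)]])
      also have "\<dots> \<le> (real m + 1) * (2 / \<epsilon>) * (L1 * d)"
        using \<epsilon> by (intro mult_left_mono y_Lip that) auto
      finally show "\<bar>G c i - G c' i\<bar> \<le> \<Lambda> * d" by (simp add: \<Lambda>_def mult.assoc)
    qed
  qed (use \<Lambda> \<delta> that in auto)
  define x where "x = (\<Sum>j<m. G c j *\<^sub>R \<sigma> (z j))"
  have x_eq: "x = (\<Sum>i\<in>I. \<nu> (y c) i *\<^sub>R \<sigma> i)"
    unfolding x_def G_def by (rule reindex)
  have sG: "(\<Sum>j<m. G c j) = 1"
    unfolding G_def reindex[of "\<nu> (y c)"] by (rule \<nu>_sum[OF yK[OF c(1)]])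
  have s1: "\<bar>s c - 1\<bar> \<le> real m * \<delta>"
  proof -
    have "\<bar>s c - 1\<bar> = \<bar>\<Sum>j<m. G c j - c j\<bar>" by (simp add: s_def sum_subtractf sG abs_minus_commute)
    also have "\<dots> \<le> (\<Sum>j<m. \<bar>G c j - c j\<bar>)" by (rule sum_abs)
    also have "\<dots> \<le> (\<Sum>j<m. \<delta>)" using c(2) by (intro sum_mono) auto
    finally show ?thesis by simp
  qed
  have "dist x (y c) < \<epsilon>"
  proof -
    have tri: "norm (u + v - w) \<le> norm u + norm v + norm w" for u v w :: 'y
      using norm_triangle_ineq4[of "u + v" w] norm_triangle_ineq[of u v] by linarith
    have xyc: "x - y c = (\<Sum>j<m. (G c j - c j) *\<^sub>R \<sigma> (z j)) + (\<Sum>j<m. ((1 - \<tau> (s c)) * c j) *\<^sub>R \<sigma> (z j))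
        - (1 - \<tau> (s c) * s c) *\<^sub>R b0"
    proof -
      have "(\<Sum>j<m. (G c j - c j) *\<^sub>R \<sigma> (z j)) + (\<Sum>j<m. ((1 - \<tau> (s c)) * c j) *\<^sub>R \<sigma> (z j))
          = (\<Sum>j<m. G c j *\<^sub>R \<sigma> (z j) - (\<tau> (s c) * c j) *\<^sub>R \<sigma> (z j))"
        unfolding sum.distrib[symmetric] scaleR_add_left[symmetric] scaleR_diff_left[symmetric]
        by (rule sum.cong) (auto simp: left_diff_distrib)
      also have "\<dots> = x - (\<Sum>j<m. (\<tau> (s c) * c j) *\<^sub>R \<sigma> (z j))" unfolding x_def by (rule sum_subtractf)
      finally show ?thesis by (simp add: y_def)
    qed
    have "norm (x - y c) \<le> norm (\<Sum>j<m. (G c j - c j) *\<^sub>R \<sigma> (z j))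
        + norm (\<Sum>j<m. ((1 - \<tau> (s c)) * c j) *\<^sub>R \<sigma> (z j)) + norm ((1 - \<tau> (s c) * s c) *\<^sub>R b0)"
      unfolding xyc by (rule tri)
    also have "\<dots> \<le> (\<Sum>j<m. \<delta> * M) + (\<Sum>j<m. ((1 - \<tau> (s c)) * c j) * M) + real m * \<delta> * M"
    proof (intro add_mono)
      show "norm (\<Sum>j<m. (G c j - c j) *\<^sub>R \<sigma> (z j)) \<le> (\<Sum>j<m. \<delta> * M)"
      proof (rule sum_norm_le)
        fix j assume "j \<in> {..<m}"
        then have j: "j < m" by simp
        show "norm ((G c j - c j) *\<^sub>R \<sigma> (z j)) \<le> \<delta> * M"
          unfolding norm_scaleR by (rule mult_mono[OF _ M(2)[OF \<sigma>z[OF j]]]) (use c(2) j \<delta> in auto)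
      qed
      show "norm (\<Sum>j<m. ((1 - \<tau> (s c)) * c j) *\<^sub>R \<sigma> (z j)) \<le> (\<Sum>j<m. ((1 - \<tau> (s c)) * c j) * M)"
      proof (rule sum_norm_le)
        fix j assume "j \<in> {..<m}"
        then have j: "j < m" by simp
        have "0 \<le> (1 - \<tau> (s c)) * c j" using c(1) j \<tau>(2) by simp
        then show "norm (((1 - \<tau> (s c)) * c j) *\<^sub>R \<sigma> (z j)) \<le> ((1 - \<tau> (s c)) * c j) * M"
          unfolding norm_scaleR by (simp add: mult_left_mono M(2)[OF \<sigma>z[OF j]])
      qed
      show "norm ((1 - \<tau> (s c) * s c) *\<^sub>R b0) \<le> real m * \<delta> * M"
        unfolding norm_scaleR \<tau>s
        by (rule mult_mono[OF _ M(2)[OF b0]]) (use s1 in \<open>auto simp: min_def\<close>)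
    qed
    also have "(\<Sum>j<m. ((1 - \<tau> (s c)) * c j) * M) = (s c - min 1 (s c)) * M"
    proof -
      have "(\<Sum>j<m. ((1 - \<tau> (s c)) * c j) * M) = (1 - \<tau> (s c)) * s c * M"
        by (simp only: sum_distrib_right[symmetric] sum_distrib_left[symmetric] s_def)
      then show ?thesis by (simp only: left_diff_distrib \<tau>s mult_1_left)
    qed
    also have "\<dots> \<le> real m * \<delta> * M"
      using s1 M(1) \<delta> by (intro mult_right_mono) (auto simp: min_def)
    finally have "norm (x - y c) \<le> 3 * (real m * \<delta> * M)" by (simp add: mult_ac)
    also have "\<dots> < 4 * ((real m + 1) * \<delta> * M)"
    proof -
      have "real m * \<delta> * M < (real m + 1) * \<delta> * M" "0 \<le> real m * \<delta> * M" using \<delta> M(1) by auto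
      then show ?thesis by linarith
    qed
    also have "\<dots> = \<delta> * (4 * (real m + 1) * M)" by (simp only: mult_ac)
    also have "\<dots> = \<epsilon>"
    proof -
      have "u / v * v = u" if "v \<noteq> 0" for u v :: real using that by simp
      then show ?thesis unfolding \<delta>_def by this (use M(1) in simp)
    qed
    finally show ?thesis by (simp add: dist_norm)
  qed
  note xy = this
  \<comment> \<open>net points of weight zero may be far away and are dropped\<close>
  define I' where "I' = {i \<in> I. 0 < \<nu> (y c) i}"
  have yc: "y c \<in> K" by (rule yK[OF c(1)])
  have zero: "\<nu> (y c) i = 0" if "i \<in> I - I'" for i
    using that \<nu>(1)[OF _ yc, of i] by (auto simp: I'_def)
  show thesis
  proof (rule that[of I' "\<nu> (y c)"])
    show "finite I'" "I' \<subseteq> K" using I by (auto simp: I'_def)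
    show "0 \<le> \<nu> (y c) i" if "i \<in> I'" for i using that by (simp add: I'_def)
    have "sum (\<nu> (y c)) I' = sum (\<nu> (y c)) I"
      by (rule sum.mono_neutral_left[OF I(2)]) (use zero in \<open>auto simp: I'_def\<close>)
    then show "sum (\<nu> (y c)) I' = 1" using \<nu>_sum[OF yc] by simp
    have x': "(\<Sum>j\<in>I'. \<nu> (y c) j *\<^sub>R \<sigma> j) = x"
      unfolding x_eq by (rule sum.mono_neutral_left[OF I(2)]) (use zero in \<open>auto simp: I'_def\<close>)
    show "dist i (\<Sum>j\<in>I'. \<nu> (y c) j *\<^sub>R \<sigma> j) < e" if i: "i \<in> I'" for i
    proof -
      have "0 < w i (y c)" using i Wpos[OF yc] by (simp add: I'_def \<nu>_def zero_less_divide_iff)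
      then have "dist i (y c) < \<epsilon>" by (simp add: w_def)
      then show ?thesis
        unfolding x' using xy dist_triangle[of i x "y c"] by (simp add: \<epsilon>_def dist_commute)
    qed
  qed
qed

text \<open>A Lipschitz family is determined up to a small error by the values at the points of a
  fine grid, and these are determined up to a small error by finitely many codes.\<close>

lemma Lipschitz_family_totally_bounded:
  fixes v :: "'f \<Rightarrow> real \<Rightarrow> 'a::metric_space"
  assumes b: "b > 0"
    and Lip: "\<And>f s t. f \<in> Q \<Longrightarrow> s \<in> {0..b} \<Longrightarrow> t \<in> {0..b} \<Longrightarrow> dist (v f s) (v f t) \<le> K * \<bar>s - t\<bar>"
    and range: "\<And>e. e > 0 \<Longrightarrow> \<exists>Z. finite Z \<and> (\<forall>f\<in>Q. \<forall>t\<in>{0..b}. \<exists>z\<in>Z. dist z (v f t) < e)"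
    and e: "e > 0"
  obtains P where "P \<subseteq> Q" "finite P" "\<And>f. f \<in> Q \<Longrightarrow> \<exists>g\<in>P. \<forall>t\<in>{0..b}. dist (v f t) (v g t) < e"
proof -
  obtain Z where Z: "finite Z" "\<And>f t. f \<in> Q \<Longrightarrow> t \<in> {0..b} \<Longrightarrow> \<exists>z\<in>Z. dist z (v f t) < e / 8"
    using range[of "e / 8"] e by auto
  obtain m :: nat where m: "real m > 8 * \<bar>K\<bar> * b / e" using reals_Archimedean2 by blast
  have m0: "real m > 0" using m b e by (smt (verit) divide_nonneg_pos mult_nonneg_nonneg abs_ge_zero)
  define grid where "grid j = real j * b / real m" for j :: nat
  have grid: "grid j \<in> {0..b}" if "j \<le> m" for j
    using that b m0 by (auto simp: grid_def field_simps)
  have near: "\<exists>j\<le>m. \<bar>t - grid j\<bar> \<le> b / real m" if t: "t \<in> {0..b}" for t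
  proof -
    define j where "j = nat \<lfloor>t * real m / b\<rfloor>"
    have nn: "0 \<le> t * real m / b" using t b by simp
    have j: "real j \<le> t * real m / b" "t * real m / b < real j + 1"
      using nn unfolding j_def by (auto simp: of_nat_nat)
    have "t * real m / b \<le> real m" using t b m0 by (simp add: field_simps)
    then have "j \<le> m" using j(1) by linarith
    moreover have "grid j \<le> t" "t \<le> grid j + b / real m"
      using j b m0 by (auto simp: grid_def field_simps)
    ultimately show ?thesis using b m0 by (intro exI[of _ j]) (auto simp: abs_le_iff)
  qed
  define code where "code f = (\<lambda>j\<in>{..m}. SOME z. z \<in> Z \<and> dist z (v f (grid j)) < e / 8)" for f
  have code: "code f j \<in> Z \<and> dist (code f j) (v f (grid j)) < e / 8" if "f \<in> Q" "j \<le> m" for f j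
  proof -
    have "\<exists>z. z \<in> Z \<and> dist z (v f (grid j)) < e / 8" using Z(2)[OF that(1) grid[OF that(2)]] by blast
    from someI_ex[OF this] show ?thesis using that(2) by (simp add: code_def)
  qed
  have "code ` Q \<subseteq> {..m} \<rightarrow>\<^sub>E Z"
  proof (rule image_subsetI, rule PiE_I)
    show "code f j \<in> Z" if "f \<in> Q" "j \<in> {..m}" for f j using code[of f j] that by simp
    show "code f j = undefined" if "j \<notin> {..m}" for f j using that by (simp add: code_def)
  qed
  then have fin: "finite (code ` Q)" by (rule finite_subset) (intro finite_PiE Z(1) finite_atMost)
  define P where "P = inv_into Q code ` (code ` Q)"
  have "\<exists>g\<in>P. \<forall>t\<in>{0..b}. dist (v f t) (v g t) < e" if f: "f \<in> Q" for f
  proof -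
    define g where "g = inv_into Q code (code f)"
    have g: "g \<in> P" "g \<in> Q" "code g = code f"
      using f by (auto simp: g_def P_def inv_into_into f_inv_into_f)
    have "dist (v f t) (v g t) < e" if t: "t \<in> {0..b}" for t
    proof -
      obtain j where j: "j \<le> m" "\<bar>t - grid j\<bar> \<le> b / real m" using near[OF t] by blast
      have "dist (v h t) (v h (grid j)) \<le> e / 8" if h: "h \<in> Q" for h
      proof -
        have "dist (v h t) (v h (grid j)) \<le> K * \<bar>t - grid j\<bar>" by (rule Lip[OF h t grid[OF j(1)]])
        also have "\<dots> \<le> \<bar>K\<bar> * (b / real m)" using j(2) by (intro mult_mono) auto
        also have "\<dots> \<le> e / 8" using m m0 e by (simp add: field_simps)
        finally show ?thesis .
      qed
      from this[OF f] this[OF g(2)] code[OF f j(1)] code[OF g(2) j(1)]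
      show ?thesis
        unfolding g(3)
        using dist_triangle[of "v f t" "v g t" "v f (grid j)"] dist_triangle[of "v f (grid j)" "v g t" "code f j"]
          dist_triangle[of "code f j" "v g t" "v g (grid j)"] e
        by (simp add: dist_commute)
    qed
    then show ?thesis using g(1) by blast
  qed
  moreover have "P \<subseteq> Q" by (auto simp: P_def inv_into_into)
  moreover have "finite P" using fin by (simp add: P_def)
  ultimately show thesis using that by blast
qed

lemma totally_bounded_convergent_subsequence:
  fixes x :: "nat \<Rightarrow> 'a::complete_space"
  assumes net: "\<And>e. e > 0 \<Longrightarrow> \<exists>I. finite I \<and> (\<forall>y\<in>K. \<exists>i\<in>I. dist i y < e)" and x: "\<And>n. x n \<in> K"
  obtains l r where "strict_mono r" "(x \<circ> r) \<longlonglongrightarrow> l"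
proof -
  have "compact (closure K)"
    unfolding compact_eq_totally_bounded
  proof (intro conjI allI impI)
    show "complete (closure K)" by (simp add: complete_eq_closed)
    fix e :: real assume "e > 0"
    then obtain I where I: "finite I" "\<And>y. y \<in> K \<Longrightarrow> \<exists>i\<in>I. dist i y < e / 2" using net[of "e / 2"] by auto
    have "closure K \<subseteq> (\<Union>i\<in>I. cball i (e / 2))"
      by (rule closure_minimal) (use I in \<open>force simp: less_imp_le\<close>)+
    also have "\<dots> \<subseteq> (\<Union>i\<in>I. ball i e)" using \<open>e > 0\<close> by force
    finally show "\<exists>k. finite k \<and> closure K \<subseteq> (\<Union>x\<in>k. ball x e)" using I(1) by blast
  qed
  then have "seq_compact (closure K)" by (simp add: compact_imp_seq_compact)
  moreover have "\<forall>n. x n \<in> closure K" using x closure_subset by blast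
  ultimately obtain l r where "strict_mono r" "(x \<circ> r) \<longlonglongrightarrow> l" by (rule seq_compactE)
  then show thesis by (rule that)
qed

section \<open>Integral inclusions\<close>

lemma L1_on_AE_eq:
  assumes f: "f \<in> L1_on {a..b}" and eq: "AE t in leb a b. f t = g t"
  shows "g \<in> L1_on {a..b}" "(LINT t|leb a b. norm (g t - f t)) = 0"
proof -
  have lim: "AE t in leb a b. (\<lambda>n::nat. f t) \<longlonglongrightarrow> g t" using eq by eventually_elim simp
  have le: "AE t in leb a b. norm (f t) \<le> norm (f t)" by simp
  note * = L1_on_dominated_limit[OF f lim L1_on_norm_integrable[OF f] le]
  show "g \<in> L1_on {a..b}" by (rule *(1))
  show "(LINT t|leb a b. norm (g t - f t)) = 0"
    using LIMSEQ_unique[OF *(3) tendsto_const] by simp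
qed

lemma apply_bcontfun_sum: "apply_bcontfun (\<Sum>i\<in>I. f i) t = (\<Sum>i\<in>I. apply_bcontfun (f i) t)"
  by (induction I rule: infinite_finite_induct) (auto simp: zero_bcontfun.rep_eq plus_bcontfun.rep_eq)

text \<open>A sequence of selections whose arguments approach \<open>x\<close> lies eventually in every convex
  neighbourhood of the value at \<open>x\<close>, and so do its tail combinations.\<close>

lemma upper_semicontinuous_closed_convex_limit:
  fixes G :: "'x::real_normed_vector \<Rightarrow> 'x set"
  assumes usc: "upper_semicontinuous G" and conv: "convex (G x)"
    and g: "\<And>n. g n \<in> tail_convex_combs f n" and lim: "(\<lambda>n. g n t) \<longlonglongrightarrow> h"
    and f: "\<And>\<delta>. \<delta> > 0 \<Longrightarrow> \<exists>N. \<forall>k\<ge>N. \<forall>V. convex V \<and> (\<forall>x'\<in>ball x \<delta>. G x' \<subseteq> V) \<longrightarrow> f k t \<in> V"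
  shows "h \<in> G x"
proof -
  have closed: "closed (G x)" using usc by (simp add: upper_semicontinuous_def)
  have "\<exists>c\<in>G x. dist c h < e" if e: "e > 0" for e
  proof -
    define V where "V = (\<Union>y\<in>ball 0 (e/2). \<Union>c\<in>G x. {y + c})"
    have V: "open V" "convex V" unfolding V_def by (auto intro: open_sums convex_sums conv)
    have "G x \<subseteq> V" using e by (force simp: V_def)
    then obtain W where W: "open W" "x \<in> W" "\<forall>x'\<in>W. G x' \<subseteq> V"
      using usc V(1) unfolding upper_semicontinuous_def by meson
    obtain \<delta> where \<delta>: "\<delta> > 0" "ball x \<delta> \<subseteq> W" by (rule openE[OF W(1,2)])
    have "\<forall>x'\<in>ball x \<delta>. G x' \<subseteq> V" using W(3) \<delta>(2) by blast
    then obtain N where N: "\<And>k. k \<ge> N \<Longrightarrow> f k t \<in> V" using f[OF \<delta>(1)] V(2) by metis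
    have "g n t \<in> V" if "n \<ge> N" for n
      by (rule tail_convex_combs_mem[OF g V(2)]) (use N that in auto)
    moreover have "\<forall>\<^sub>F n in sequentially. dist (g n t) h < e/2" using lim e by (intro tendstoD) auto
    ultimately have "\<forall>\<^sub>F n in sequentially. g n t \<in> V \<and> dist (g n t) h < e/2"
      by (auto simp: eventually_conj_iff intro: eventually_sequentiallyI)
    then obtain n where n: "g n t \<in> V" "dist (g n t) h < e/2" by (auto simp: eventually_sequentially)
    then obtain y c where yc: "norm y < e/2" "c \<in> G x" "g n t = y + c" by (auto simp: V_def)
    have "dist c (g n t) = norm y" using yc(3) by (simp add: dist_norm)
    then have "dist c h < e" using yc(1) n(2) dist_triangle[of c h "g n t"] by linarith
    then show ?thesis using yc(2) by blast
  qed
  then have "h \<in> closure (G x)" by (simp add: closure_approachable)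
  then show ?thesis using closed by simp
qed

text \<open>The unknown is the selection \<open>f\<close> and not the trajectory \<open>\<Phi> f\<close>. Approximate solutions of the
  convexified problem exist by the finite dimensional argument; their trajectories converge by
  compactness of \<open>\<Phi>\<close>, and tail convex combinations of their selections converge almost everywhere.
  Upper semicontinuity and convexity of the values of \<open>F\<close> identify the limit.\<close>

theorem integral_inclusion_solvable:
  fixes F :: "real \<Rightarrow> 'x::{real_inner,complete_space} \<Rightarrow> 'x set"
    and \<Phi> :: "(real \<Rightarrow> 'x) \<Rightarrow> real \<Rightarrow> 'x" and l :: "real \<Rightarrow> real" and b C :: real
  defines "Q \<equiv> {f \<in> L1_on {0..b}. AE t in leb 0 b. norm (f t) \<le> l t}"
  assumes b: "b > 0" and F: "admissible_multimap b F"
    and l: "integrable (leb 0 b) l" "\<And>t. t \<in> {0..b} \<Longrightarrow> 0 \<le> l t"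
    and cont: "\<And>f. f \<in> Q \<Longrightarrow> continuous_on {0..b} (\<Phi> f)"
    and affine: "\<And>J c f t. finite J \<Longrightarrow> (\<And>j. j \<in> J \<Longrightarrow> 0 \<le> c j) \<Longrightarrow> sum c J = 1 \<Longrightarrow> (\<And>j. j \<in> J \<Longrightarrow> f j \<in> Q) \<Longrightarrow>
        t \<in> {0..b} \<Longrightarrow> \<Phi> (\<lambda>s. \<Sum>j\<in>J. c j *\<^sub>R f j s) t = (\<Sum>j\<in>(J :: nat set). c j *\<^sub>R \<Phi> (f j) t)"
    and L1_Lip: "\<And>f g t. f \<in> Q \<Longrightarrow> g \<in> Q \<Longrightarrow> t \<in> {0..b} \<Longrightarrow>
        norm (\<Phi> f t - \<Phi> g t) \<le> C * (LINT s|leb 0 b. norm (f s - g s))"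
    and compact: "\<And>e. e > 0 \<Longrightarrow> \<exists>P\<subseteq>Q. finite P \<and> (\<forall>f\<in>Q. \<exists>g\<in>P. \<forall>t\<in>{0..b}. dist (\<Phi> f t) (\<Phi> g t) < e)"
    and self: "\<And>f h. f \<in> Q \<Longrightarrow> h \<in> selections b F (\<Phi> f) \<Longrightarrow> h \<in> Q"
  obtains f where "f \<in> Q" "f \<in> selections b F (\<Phi> f)"
proof -
  have QI: "f \<in> Q" if "f \<in> L1_on {0..b}" "AE t in leb 0 b. norm (f t) \<le> l t" for f
    using that by (simp add: Q_def)
  have QD: "f \<in> L1_on {0..b}" "AE t in leb 0 b. norm (f t) \<le> l t" if "f \<in> Q" for f
    using that by (auto simp: Q_def)
  have Q_sum: "(\<lambda>s. \<Sum>j\<in>J. c j *\<^sub>R f j s) \<in> Q"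
    if J: "finite J" "\<And>j. j \<in> J \<Longrightarrow> 0 \<le> c j" "sum c J = 1" and f: "\<And>j. j \<in> J \<Longrightarrow> f j \<in> Q"
    for J :: "'j set" and c f
  proof (rule QI)
    show "(\<lambda>s. \<Sum>j\<in>J. c j *\<^sub>R f j s) \<in> L1_on {0..b}"
      using QD(1)[OF f] unfolding L1_on_iff_approximable
      by (intro L1_approximable_sum J L1_approximable_scaleR)
    have "AE t in leb 0 b. \<forall>j\<in>J. norm (f j t) \<le> l t"
      using QD(2)[OF f] by (intro AE_finite_allI J) auto
    then show "AE t in leb 0 b. norm (\<Sum>j\<in>J. c j *\<^sub>R f j t) \<le> l t"
    proof eventually_elim
      case (elim t)
      have "(\<Sum>j\<in>J. c j *\<^sub>R f j t) \<in> cball 0 (l t)"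
        by (rule convex_sum[OF J(1) convex_cball J(3)]) (use J elim in auto)
      then show ?case by simp
    qed
  qed
  have affine': "\<Phi> (\<lambda>s. \<Sum>j\<in>J. c j *\<^sub>R f j s) t = (\<Sum>j\<in>J. c j *\<^sub>R \<Phi> (f j) t)"
    if J: "finite J" "\<And>j. j \<in> J \<Longrightarrow> 0 \<le> c j" "sum c J = 1" and f: "\<And>j. j \<in> J \<Longrightarrow> f j \<in> Q" and t: "t \<in> {0..b}"
    for J :: "'j set" and c f t
  proof -
    obtain \<pi> where \<pi>: "bij_betw \<pi> {0..<card J} J" using ex_bij_betw_nat_finite[OF J(1)] by blast
    have \<pi>J: "\<pi> k \<in> J" if "k \<in> {0..<card J}" for k using \<pi> that by (auto simp: bij_betw_def)
    have re: "(\<Sum>k\<in>{0..<card J}. u (\<pi> k)) = sum u J" for u :: "'j \<Rightarrow> 'c::comm_monoid_add"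
      by (rule sum.reindex_bij_betw[OF \<pi>])
    have "\<Phi> (\<lambda>s. \<Sum>k\<in>{0..<card J}. c (\<pi> k) *\<^sub>R f (\<pi> k) s) t = (\<Sum>k\<in>{0..<card J}. c (\<pi> k) *\<^sub>R \<Phi> (f (\<pi> k)) t)"
      by (rule affine) (use J f \<pi>J t re[of c] in auto)
    then show ?thesis by (simp only: re[of "\<lambda>j. c j *\<^sub>R \<Phi> (f j) t"] re[of "\<lambda>j. c j *\<^sub>R f j s" for s])
  qed
  \<comment> \<open>trajectories are extended by constants to bounded continuous functions on the line, which form a
    complete normed space\<close>
  define ext where "ext f = Bcontfun (\<lambda>t. \<Phi> f (clamp 0 b t))" for f
  have clamp: "clamp 0 b t \<in> {0..b}" for t using clamp_in_interval[of 0 b t] b by auto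
  have ext: "apply_bcontfun (ext f) t = \<Phi> f (clamp 0 b t)" if f: "f \<in> Q" for f t
  proof -
    have "(\<lambda>t. \<Phi> f (clamp 0 b t)) \<in> bcontfun"
      unfolding bcontfun_def
    proof (intro CollectI conjI)
      show "continuous_on UNIV (\<lambda>t. \<Phi> f (clamp 0 b t))"
        by (rule clamp_continuous_on) (use cont[OF f] in simp)
      have "compact (\<Phi> f ` {0..b})" by (rule compact_continuous_image[OF cont[OF f]]) simp
      then show "bounded (range (\<lambda>t. \<Phi> f (clamp 0 b t)))"
        by (rule bounded_subset[OF compact_imp_bounded]) (use clamp in auto)
    qed
    then show ?thesis unfolding ext_def by (simp add: Bcontfun_inverse)
  qed
  have ext_on: "apply_bcontfun (ext f) t = \<Phi> f t" if "f \<in> Q" "t \<in> {0..b}" for f t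
    using ext[OF that(1), of t] clamp_cancel_cbox[of t 0 b] that(2) by simp
  have ext_sum: "ext (\<lambda>s. \<Sum>j\<in>J. c j *\<^sub>R f j s) = (\<Sum>j\<in>J. c j *\<^sub>R ext (f j))"
    if J: "finite J" "\<And>j. j \<in> J \<Longrightarrow> 0 \<le> c j" "sum c J = 1" and f: "\<And>j. j \<in> J \<Longrightarrow> f j \<in> Q"
    for J :: "'j set" and c f
  proof (rule bcontfun_eqI)
    fix t
    have "apply_bcontfun (ext (\<lambda>s. \<Sum>j\<in>J. c j *\<^sub>R f j s)) t = \<Phi> (\<lambda>s. \<Sum>j\<in>J. c j *\<^sub>R f j s) (clamp 0 b t)"
      by (rule ext[OF Q_sum[OF J f]])
    also have "\<dots> = (\<Sum>j\<in>J. c j *\<^sub>R \<Phi> (f j) (clamp 0 b t))" by (rule affine'[OF J f clamp])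
    also have "\<dots> = apply_bcontfun (\<Sum>j\<in>J. c j *\<^sub>R ext (f j)) t"
      using f by (simp add: apply_bcontfun_sum scaleR_bcontfun.rep_eq ext)
    finally show "apply_bcontfun (ext (\<lambda>s. \<Sum>j\<in>J. c j *\<^sub>R f j s)) t = apply_bcontfun (\<Sum>j\<in>J. c j *\<^sub>R ext (f j)) t" .
  qed
  define K where "K = ext ` Q"
  have zero: "(\<lambda>t. 0) \<in> Q"
    using l(2) by (intro QI AE_I2) (auto simp: L1_on_iff_approximable intro: L1_approximable_simple)
  have K_ne: "K \<noteq> {}" using zero by (auto simp: K_def)
  have K_convex: "convex K"
  proof (rule convexI)
    fix x y and u v :: real assume xy: "x \<in> K" "y \<in> K" and uv: "0 \<le> u" "0 \<le> v" "u + v = 1"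
    obtain f g where fg: "f \<in> Q" "g \<in> Q" "x = ext f" "y = ext g" using xy by (auto simp: K_def)
    define h where "h k = (if k = 0 then f else g)" for k :: nat
    define c where "c k = (if k = 0 then u else v)" for k :: nat
    have *: "\<And>j. j \<in> {0, 1} \<Longrightarrow> 0 \<le> c j" "sum c {0, 1} = 1" "\<And>j. j \<in> {0, 1} \<Longrightarrow> h j \<in> Q"
      using uv fg by (auto simp: c_def h_def)
    have eq: "ext (\<lambda>s. \<Sum>j\<in>{0, 1}. c j *\<^sub>R h j s) = u *\<^sub>R x + v *\<^sub>R y"
      by (subst ext_sum) (use * in \<open>auto simp: c_def h_def fg\<close>)
    have "(\<lambda>s. \<Sum>j\<in>{0, 1}. c j *\<^sub>R h j s) \<in> Q" by (rule Q_sum) (use * in auto)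
    then show "u *\<^sub>R x + v *\<^sub>R y \<in> K" unfolding eq[symmetric] K_def by (rule imageI)
  qed
  have dist_ext: "dist (ext f) (ext g) \<le> e" if "f \<in> Q" "g \<in> Q" "\<And>t. t \<in> {0..b} \<Longrightarrow> dist (\<Phi> f t) (\<Phi> g t) \<le> e" for f g e
    by (rule dist_bound) (use that ext clamp in auto)
  have net: "\<exists>I\<subseteq>K. finite I \<and> (\<forall>x\<in>K. \<exists>i\<in>I. dist i x < e)" if e: "e > 0" for e
  proof -
    obtain P where P: "P \<subseteq> Q" "finite P" "\<And>f. f \<in> Q \<Longrightarrow> \<exists>g\<in>P. \<forall>t\<in>{0..b}. dist (\<Phi> f t) (\<Phi> g t) < e / 2"
      using compact[of "e / 2"] e by auto
    have "\<exists>i\<in>ext ` P. dist i (ext f) < e" if f: "f \<in> Q" for f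
    proof -
      obtain g where g: "g \<in> P" "\<And>t. t \<in> {0..b} \<Longrightarrow> dist (\<Phi> f t) (\<Phi> g t) < e / 2" using P(3)[OF f] by blast
      have "dist (ext g) (ext f) \<le> e / 2"
        using g P(1) f by (intro dist_ext) (auto simp: dist_commute less_imp_le)
      then show ?thesis using g(1) e by force
    qed
    then show ?thesis using P(1,2) by (intro exI[of _ "ext ` P"]) (auto simp: K_def)
  qed
  have sel_cong: "selections b F x = selections b F y" if "\<And>t. t \<in> {0..b} \<Longrightarrow> x t = y t" for x y
    using that unfolding selections_def by auto
  have sel_ex: "\<exists>h. h \<in> Q \<and> (\<forall>t\<in>{0..b}. h t \<in> F t (apply_bcontfun x t))" if x: "x \<in> K" for x
  proof -
    obtain f where f: "f \<in> Q" "x = ext f" using x by (auto simp: K_def)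
    obtain h where h: "h \<in> selections b F (\<Phi> f)"
      using F cont[OF f(1)] unfolding admissible_multimap_def by blast
    then have "\<forall>t\<in>{0..b}. h t \<in> F t (apply_bcontfun x t)"
      using ext_on[OF f(1)] by (simp add: f(2) selections_def)
    then show ?thesis using self[OF f(1) h] by blast
  qed
  then obtain sel where sel: "\<And>x. x \<in> K \<Longrightarrow> sel x \<in> Q"
    "\<And>x t. x \<in> K \<Longrightarrow> t \<in> {0..b} \<Longrightarrow> sel x t \<in> F t (apply_bcontfun x t)" by metis
  define near_fixed where "near_fixed n I \<mu> \<longleftrightarrow> finite I \<and> I \<subseteq> K \<and> (\<forall>i\<in>I. 0 \<le> \<mu> i) \<and> sum \<mu> I = (1::real) \<and>
      (\<forall>i\<in>I. dist i (\<Sum>j\<in>I. \<mu> j *\<^sub>R ext (sel j)) < 1 / real (Suc n))" for n I \<mu>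
  have "\<exists>I \<mu>. near_fixed n I \<mu>" for n
  proof -
    have pos: "1 / real (Suc n) > 0" by simp
    have \<sigma>: "ext (sel x) \<in> K" if "x \<in> K" for x unfolding K_def by (rule imageI[OF sel(1)[OF that]])
    show ?thesis
    proof (rule convexified_approximate_fixed_point[OF K_convex K_ne \<sigma> net pos])
      fix I \<mu>
      assume "finite I" "I \<subseteq> K" "\<And>i. i \<in> I \<Longrightarrow> 0 \<le> \<mu> i" "sum \<mu> I = (1::real)"
        "\<And>i. i \<in> I \<Longrightarrow> dist i (\<Sum>j\<in>I. \<mu> j *\<^sub>R ext (sel j)) < 1 / real (Suc n)"
      then show ?thesis unfolding near_fixed_def by (intro exI[of _ I] exI[of _ \<mu>] conjI ballI)
    qed
  qed
  then obtain I \<mu> where near_fixed: "\<And>n. near_fixed n (I n) (\<mu> n)" by metis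
  have I: "finite (I n)" "I n \<subseteq> K" "i \<in> I n \<Longrightarrow> 0 \<le> \<mu> n i" "sum (\<mu> n) (I n) = (1::real)"
    "i \<in> I n \<Longrightarrow> dist i (\<Sum>j\<in>I n. \<mu> n j *\<^sub>R ext (sel j)) < 1 / real (Suc n)" for n i
    using near_fixed[of n] unfolding near_fixed_def by simp_all
  define f where "f n = (\<lambda>s. \<Sum>j\<in>I n. \<mu> n j *\<^sub>R sel j s)" for n
  have selQ: "j \<in> I n \<Longrightarrow> sel j \<in> Q" for j n using I(2) sel(1) by blast
  have fQ: "f n \<in> Q" for n unfolding f_def using I selQ by (intro Q_sum) auto
  have fy: "ext (f n) = (\<Sum>j\<in>I n. \<mu> n j *\<^sub>R ext (sel j))" for n
    unfolding f_def using I selQ by (intro ext_sum) auto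
  have near: "dist i (ext (f n)) < 1 / real (Suc n)" if "i \<in> I n" for i n using I(5)[OF that] fy by simp
  obtain x r where r: "strict_mono r" and x: "((\<lambda>n. ext (f n)) \<circ> r) \<longlonglongrightarrow> x"
  proof (rule totally_bounded_convergent_subsequence)
    show "\<exists>I. finite I \<and> (\<forall>y\<in>K. \<exists>i\<in>I. dist i y < e)" if "e > 0" for e using net[OF that] by blast
    show "ext (f n) \<in> K" for n using fQ by (simp add: K_def)
  qed
  define f' where "f' k = f (r k)" for k
  have f'Q: "f' k \<in> Q" for k using fQ by (simp add: f'_def)
  obtain g h where g: "\<And>n. g n \<in> tail_convex_combs f' n" and gh: "AE t in leb 0 b. (\<lambda>n. g n t) \<longlonglongrightarrow> h t"
  proof (rule forward_convex_combinations_converge[of f' 0 b l])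
    show "f' n \<in> L1_on {0..b}" "AE t in leb 0 b. norm (f' n t) \<le> l t" for n by (rule QD[OF f'Q])+
    show "integrable (leb 0 b) l" "\<And>t. t \<in> {0..b} \<Longrightarrow> 0 \<le> l t" by (rule l, assumption?)+
    fix h g assume "\<And>n. g n \<in> tail_convex_combs f' n" "AE t in leb 0 b. (\<lambda>n. g n t) \<longlonglongrightarrow> h t"
    then show thesis by (rule that)
  qed
  have g_comb: "g n \<in> Q \<and> (\<exists>u\<in>tail_convex_combs (\<lambda>k. \<Phi> (f' k)) n. \<forall>t\<in>{0..b}. \<Phi> (g n) t = u t)" for n
    using g[of n]
  proof (rule tail_convex_combsE)
    fix m \<alpha> assume \<alpha>: "\<forall>k. 0 \<le> \<alpha> k" "\<forall>k. k < n \<or> m \<le> k \<longrightarrow> \<alpha> k = 0" "sum \<alpha> {..<m} = 1"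
      and gn: "g n = (\<lambda>t. \<Sum>k<m. \<alpha> k *\<^sub>R f' k t)"
    have u: "(\<lambda>t. \<Sum>k<m. \<alpha> k *\<^sub>R \<Phi> (f' k) t) \<in> tail_convex_combs (\<lambda>k. \<Phi> (f' k)) n"
      unfolding tail_convex_combs_def using \<alpha> by blast
    have eq: "\<forall>t\<in>{0..b}. \<Phi> (g n) t = (\<Sum>k<m. \<alpha> k *\<^sub>R \<Phi> (f' k) t)"
      unfolding gn using \<alpha> f'Q by (intro ballI affine') auto
    have "g n \<in> Q" unfolding gn using \<alpha> f'Q by (intro Q_sum) auto
    then show ?thesis by (rule conjI, intro bexI[OF _ u]) (rule eq)
  qed
  then have gQ: "g n \<in> Q" for n by blast
  note dom = L1_on_dominated_limit[OF QD(1)[OF gQ] gh l(1) QD(2)[OF gQ]]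
  have hQ: "h \<in> Q" by (rule QI[OF dom(1,2)])
  have x': "(\<lambda>k. ext (f' k)) \<longlonglongrightarrow> x" using x unfolding f'_def o_def .
  have x_lim: "(\<lambda>k. apply_bcontfun (ext (f' k)) t) \<longlonglongrightarrow> apply_bcontfun x t" for t
  proof (rule tendstoI)
    fix e :: real assume "e > 0"
    with x' have "\<forall>\<^sub>F k in sequentially. dist (ext (f' k)) x < e" by (rule tendstoD)
    then show "\<forall>\<^sub>F k in sequentially. dist (apply_bcontfun (ext (f' k)) t) (apply_bcontfun x t) < e"
      by eventually_elim (rule dist_fun_lt_imp_dist_val_lt)
  qed
  have \<Phi>h: "\<Phi> h t = apply_bcontfun x t" if t: "t \<in> {0..b}" for t
  proof (rule LIMSEQ_unique)
    show "(\<lambda>n. \<Phi> (g n) t) \<longlonglongrightarrow> \<Phi> h t"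
    proof (rule LIM_zero_cancel, rule Lim_null_comparison)
      have "norm (\<Phi> (g n) t - \<Phi> h t) \<le> C * (LINT s|leb 0 b. norm (h s - g n s))" for n
        using L1_Lip[OF hQ gQ t, of n] by (simp add: norm_minus_commute)
      then show "\<forall>\<^sub>F n in sequentially. norm (\<Phi> (g n) t - \<Phi> h t) \<le> C * (LINT s|leb 0 b. norm (h s - g n s))" by simp
      show "(\<lambda>n. C * (LINT s|leb 0 b. norm (h s - g n s))) \<longlonglongrightarrow> 0"
        by (rule tendsto_mult_right_zero[OF dom(3)])
    qed
    show "(\<lambda>n. \<Phi> (g n) t) \<longlonglongrightarrow> apply_bcontfun x t"
    proof (rule tendstoI)
      fix e :: real assume "e > 0"
      then have "\<forall>\<^sub>F k in sequentially. dist (apply_bcontfun (ext (f' k)) t) (apply_bcontfun x t) < e"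
        by (rule tendstoD[OF x_lim])
      then obtain N where N: "\<And>k. k \<ge> N \<Longrightarrow> \<Phi> (f' k) t \<in> ball (apply_bcontfun x t) e"
        using ext_on[OF f'Q t] by (auto simp: eventually_sequentially dist_commute)
      have "\<Phi> (g n) t \<in> ball (apply_bcontfun x t) e" if n: "n \<ge> N" for n
      proof -
        obtain u where u: "u \<in> tail_convex_combs (\<lambda>k. \<Phi> (f' k)) n" "\<Phi> (g n) t = u t"
          using g_comb[of n] t by blast
        show ?thesis unfolding u(2) by (rule tail_convex_combs_mem[OF u(1) convex_ball]) (use N n in auto)
      qed
      then show "\<forall>\<^sub>F n in sequentially. dist (\<Phi> (g n) t) (apply_bcontfun x t) < e"
        by (auto simp: eventually_sequentially dist_commute)
    qed
  qed
  have h_sel: "AE t in leb 0 b. h t \<in> F t (\<Phi> h t)"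
    using gh AE_space
  proof eventually_elim
    case (elim t)
    then have t: "t \<in> {0..b}" by simp
    have "h t \<in> F t (apply_bcontfun x t)"
    proof (rule upper_semicontinuous_closed_convex_limit[OF _ _ g elim(1)])
      show "upper_semicontinuous (F t)" "convex (F t (apply_bcontfun x t))"
        using F t unfolding admissible_multimap_def by blast+
      fix \<delta> :: real assume \<delta>: "\<delta> > 0"
      have "\<forall>\<^sub>F k in sequentially. dist (ext (f' k)) x < \<delta> / 2"
        by (rule tendstoD[OF x']) (use \<delta> in simp)
      then obtain N1 where N1: "\<And>k. k \<ge> N1 \<Longrightarrow> dist (ext (f' k)) x < \<delta> / 2" by (auto simp: eventually_sequentially)
      obtain N2 where N2: "1 / real (Suc N2) < \<delta> / 2" using nat_approx_posE[of "\<delta> / 2"] \<delta> by auto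
      show "\<exists>N. \<forall>k\<ge>N. \<forall>V. convex V \<and> (\<forall>x'\<in>ball (apply_bcontfun x t) \<delta>. F t x' \<subseteq> V) \<longrightarrow> f' k t \<in> V"
      proof (intro exI[of _ "max N1 N2"] allI impI, elim conjE)
        fix k V assume k: "max N1 N2 \<le> k" and V: "convex V" "\<forall>x'\<in>ball (apply_bcontfun x t) \<delta>. F t x' \<subseteq> V"
        have "sel i t \<in> V" if i: "i \<in> I (r k)" for i
        proof -
          have "N2 \<le> r k" using k seq_suble[OF r, of k] by simp
          then have "1 / real (Suc (r k)) \<le> 1 / real (Suc N2)" by (simp add: frac_le)
          then have "dist i (ext (f' k)) < \<delta> / 2" using near[OF i] N2 by (simp add: f'_def)
          then have "dist i x < \<delta>" using N1[of k] k dist_triangle[of i x "ext (f' k)"] by simp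
          then have "apply_bcontfun i t \<in> ball (apply_bcontfun x t) \<delta>"
            using dist_bounded[of i t x] by (simp add: dist_commute)
          then have "F t (apply_bcontfun i t) \<subseteq> V" using V(2) by blast
          then show ?thesis using sel(2)[OF _ t, of i] I(2) i by blast
        qed
        then show "f' k t \<in> V"
          unfolding f'_def f_def by (intro convex_sum[OF I(1) V(1) I(4)]) (use I(3) in auto)
      qed
    qed
    then show ?case by (simp add: \<Phi>h[OF t])
  qed
  obtain s0 where s0: "s0 \<in> selections b F (\<Phi> h)"
    using F cont[OF hQ] unfolding admissible_multimap_def by blast
  \<comment> \<open>on a null set the limit is replaced by values of some selection\<close>
  define h' where "h' t = (if h t \<in> F t (\<Phi> h t) then h t else s0 t)" for t
  have eq: "AE t in leb 0 b. h t = h' t" using h_sel by eventually_elim (simp add: h'_def)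
  have h'Q: "h' \<in> Q"
  proof (rule QI)
    show "h' \<in> L1_on {0..b}" by (rule L1_on_AE_eq(1)[OF QD(1)[OF hQ] eq])
    show "AE t in leb 0 b. norm (h' t) \<le> l t" using QD(2)[OF hQ] eq by eventually_elim simp
  qed
  have same: "\<Phi> h' t = \<Phi> h t" if "t \<in> {0..b}" for t
    using L1_Lip[OF h'Q hQ that] L1_on_AE_eq(2)[OF QD(1)[OF hQ] eq] by simp
  have "h' t \<in> F t (\<Phi> h' t)" if t: "t \<in> {0..b}" for t
    using s0 t unfolding same[OF t] by (auto simp: h'_def selections_def)
  then have "h' \<in> selections b F (\<Phi> h')" using QD(1)[OF h'Q] by (simp add: selections_def)
  with h'Q show thesis by (rule that)
qed

section \<open>Variation of constants\<close>

text \<open>The properties of the evolution operator that enter the fixed point argument, apart from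
  compactness.\<close>

locale Lipschitz_evolution =
  fixes b \<Lambda> N :: real and S :: "real \<Rightarrow> real \<Rightarrow> 'x::{real_inner,complete_space} \<Rightarrow>\<^sub>L 'x"
  assumes b_pos: "b > 0" and \<Lambda>_pos: "\<Lambda> > 0" and N_pos: "N > 0"
    and Lip_fst: "t \<in> {0..b} \<Longrightarrow> t' \<in> {0..b} \<Longrightarrow> s \<in> {0..b} \<Longrightarrow> norm (S t s - S t' s) \<le> \<Lambda> * \<bar>t - t'\<bar>"
    and Lip_snd: "t \<in> {0..b} \<Longrightarrow> s \<in> {0..b} \<Longrightarrow> s' \<in> {0..b} \<Longrightarrow> norm (S t s - S t s') \<le> \<Lambda> * \<bar>s - s'\<bar>"
    and bound: "t \<in> {0..b} \<Longrightarrow> s \<in> {0..b} \<Longrightarrow> norm (S t s) \<le> N"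
    and diagonal: "t \<in> {0..b} \<Longrightarrow> S t t = 0"
begin

definition duhamel :: "(real \<Rightarrow> 'x) \<Rightarrow> real \<Rightarrow> 'x" where
  "duhamel k t = integral {0..t} (\<lambda>s. S t s (k s))"

lemma continuous_S:
  assumes t: "t \<in> {0..b}" shows "continuous_on {0..b} (S t)"
proof (rule lipschitz_on_continuous_on[of \<Lambda>], rule lipschitz_onI)
  show "dist (S t s) (S t s') \<le> \<Lambda> * dist s s'" if "s \<in> {0..b}" "s' \<in> {0..b}" for s s'
    using Lip_snd[OF t that] by (simp add: dist_norm)
qed (use \<Lambda>_pos in simp)

lemma continuous_adj:
  assumes t: "t \<in> {0..b}" shows "continuous_on {0..b} (\<lambda>s. adj (S t s))"
proof (rule lipschitz_on_continuous_on[of \<Lambda>], rule lipschitz_onI)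
  show "dist (adj (S t s)) (adj (S t s')) \<le> \<Lambda> * dist s s'" if "s \<in> {0..b}" "s' \<in> {0..b}" for s s'
    using Lip_snd[OF t that] norm_adj_le[of "S t s - S t s'"] by (simp add: dist_norm adj_diff)
qed (use \<Lambda>_pos in simp)

lemma L1_continuous: "continuous_on {0..b} k \<Longrightarrow> k \<in> L1_on {0..b}"
  unfolding L1_on_iff_approximable using b_pos by (intro L1_approximable_continuous) auto

lemma integrable_S:
  assumes k: "k \<in> L1_on {0..b}" and t: "t \<in> {0..b}" and cd: "{c..d} \<subseteq> {0..b}"
  shows "(\<lambda>s. S t s (k s)) integrable_on {c..d}"
proof -
  have "L1_approximable 0 b (\<lambda>s. S t s (k s))"
    using k b_pos continuous_S[OF t] unfolding L1_on_iff_approximable by (intro L1_approximable_operator) auto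
  then have "(\<lambda>s. S t s (k s)) integrable_on {0..b}" by (rule L1_approximable_integrable_on)
  then show ?thesis using cd by (rule hilbert_integrable_subinterval)
qed

lemma duhamel_sum:
  assumes "finite J" "\<And>j. j \<in> J \<Longrightarrow> f j \<in> L1_on {0..b}" and t: "t \<in> {0..b}"
  shows "duhamel (\<lambda>s. \<Sum>j\<in>J. c j *\<^sub>R f j s) t = (\<Sum>j\<in>J. c j *\<^sub>R duhamel (f j) t)"
proof -
  have int: "(\<lambda>s. c j *\<^sub>R S t s (f j s)) integrable_on {0..t}" if "j \<in> J" for j
    using integrable_S[OF assms(2)[OF that] t, of 0 t] t by (intro integrable_cmul) auto
  have "duhamel (\<lambda>s. \<Sum>j\<in>J. c j *\<^sub>R f j s) t = integral {0..t} (\<lambda>s. \<Sum>j\<in>J. c j *\<^sub>R S t s (f j s))"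
    by (simp add: duhamel_def blinfun.sum_right blinfun.scaleR_right)
  also have "\<dots> = (\<Sum>j\<in>J. integral {0..t} (\<lambda>s. c j *\<^sub>R S t s (f j s)))"
    by (rule Henstock_Kurzweil_Integration.integral_sum[OF assms(1) int])
  finally show ?thesis by (simp add: duhamel_def)
qed

lemma duhamel_add:
  assumes f: "f \<in> L1_on {0..b}" and g: "g \<in> L1_on {0..b}" and t: "t \<in> {0..b}"
  shows "duhamel (\<lambda>s. f s + g s) t = duhamel f t + duhamel g t"
  unfolding duhamel_def blinfun.add_right
  using integrable_S[OF f t, of 0 t] integrable_S[OF g t, of 0 t] t
  by (intro Henstock_Kurzweil_Integration.integral_add) auto

lemma duhamel_diff:
  assumes f: "f \<in> L1_on {0..b}" and g: "g \<in> L1_on {0..b}" and t: "t \<in> {0..b}"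
  shows "duhamel (\<lambda>s. f s - g s) t = duhamel f t - duhamel g t"
  using duhamel_add[OF L1_on_diff[OF f g] g t] by simp

lemma norm_blinfun_duhamel_le:
  fixes T :: "'x \<Rightarrow>\<^sub>L 'x"
  assumes k: "k \<in> L1_on {0..b}" and t: "t \<in> {0..b}" and c: "0 \<le> c"
    and le: "\<And>s y. s \<in> {0..t} \<Longrightarrow> norm (T (S t s y)) \<le> c * norm y"
  shows "norm (T (duhamel k t)) \<le> c * (LINT s|leb 0 b. norm (k s))"
proof -
  have "T (duhamel k t) = integral {0..t} (\<lambda>s. T (S t s (k s)))"
    using integral_linear[OF integrable_S[OF k t, of 0 t] blinfun.bounded_linear_right[of T]] t
    by (simp add: duhamel_def o_def)
  also have "norm \<dots> \<le> (LINT s|leb 0 b. c * norm (k s))"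
    by (rule norm_integral_le_LINT) (use t le c L1_on_norm_integrable[OF k] in auto)
  finally show ?thesis by simp
qed

lemma norm_duhamel_le:
  assumes k: "k \<in> L1_on {0..b}" and t: "t \<in> {0..b}"
  shows "norm (duhamel k t) \<le> N * (LINT s|leb 0 b. norm (k s))"
proof -
  have "norm (id_blinfun (duhamel k t)) \<le> N * (LINT s|leb 0 b. norm (k s))"
  proof (rule norm_blinfun_duhamel_le[OF k t])
    show "norm (id_blinfun (S t s y)) \<le> N * norm y" if "s \<in> {0..t}" for s y
      using order_trans[OF norm_blinfun mult_right_mono[OF bound norm_ge_zero], of t s y] that t by auto
  qed (use N_pos in simp)
  then show ?thesis by simp
qed

text \<open>Since \<open>S(t,t) = 0\<close>, the part of the integral near the upper end is Lipschitz as well, even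
  though \<open>k\<close> is only integrable.\<close>

lemma duhamel_Lipschitz:
  assumes k: "k \<in> L1_on {0..b}" and t: "t \<in> {0..b}" "t' \<in> {0..b}"
  shows "norm (duhamel k t - duhamel k t') \<le> 2 * \<Lambda> * (LINT s|leb 0 b. norm (k s)) * \<bar>t - t'\<bar>"
proof -
  have main: "norm (duhamel k t' - duhamel k t) \<le> 2 * \<Lambda> * (LINT s|leb 0 b. norm (k s)) * \<bar>t - t'\<bar>"
    if t: "t \<in> {0..b}" "t' \<in> {0..b}" and le: "t \<le> t'" for t t'
  proof -
    have split: "duhamel k t' = integral {0..t} (\<lambda>s. S t' s (k s)) + integral {t..t'} (\<lambda>s. S t' s (k s))"
      unfolding duhamel_def using t le
      by (intro hilbert_integral_combine[symmetric] integrable_S k) auto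
    have "integral {0..t} (\<lambda>s. S t' s (k s)) - duhamel k t = integral {0..t} (\<lambda>s. (S t' s - S t s) (k s))"
      unfolding duhamel_def blinfun.diff_left using t le
      by (intro Henstock_Kurzweil_Integration.integral_diff[symmetric] integrable_S k) auto
    then have eq: "duhamel k t' - duhamel k t
        = integral {0..t} (\<lambda>s. (S t' s - S t s) (k s)) + integral {t..t'} (\<lambda>s. S t' s (k s))"
      using split by (simp add: algebra_simps)
    have int: "integrable (leb 0 b) (\<lambda>s. \<Lambda> * \<bar>t - t'\<bar> * norm (k s))"
      using L1_on_norm_integrable[OF k] by simp
    have 1: "norm (integral {0..t} (\<lambda>s. (S t' s - S t s) (k s))) \<le> (LINT s|leb 0 b. \<Lambda> * \<bar>t - t'\<bar> * norm (k s))"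
    proof (rule norm_integral_le_LINT[OF int])
      fix s assume "s \<in> {0..t}"
      then have s: "s \<in> {0..b}" using t by auto
      have "norm ((S t' s - S t s) (k s)) \<le> norm (S t' s - S t s) * norm (k s)" by (rule norm_blinfun)
      also have "\<dots> \<le> \<Lambda> * \<bar>t - t'\<bar> * norm (k s)"
        using Lip_fst[OF t(2,1) s] by (intro mult_right_mono) (auto simp: abs_minus_commute)
      finally show "norm ((S t' s - S t s) (k s)) \<le> \<Lambda> * \<bar>t - t'\<bar> * norm (k s)" .
    qed (use t \<Lambda>_pos in auto)
    have 2: "norm (integral {t..t'} (\<lambda>s. S t' s (k s))) \<le> (LINT s|leb 0 b. \<Lambda> * \<bar>t - t'\<bar> * norm (k s))"
    proof (rule norm_integral_le_LINT[OF int])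
      fix s assume st: "s \<in> {t..t'}"
      then have s: "s \<in> {0..b}" using t by auto
      have "norm (S t' s) \<le> \<Lambda> * \<bar>t' - s\<bar>" using Lip_fst[OF t(2) s s] diagonal[OF s] by simp
      also have "\<dots> \<le> \<Lambda> * \<bar>t - t'\<bar>" using st \<Lambda>_pos by (intro mult_left_mono) auto
      finally show "norm (S t' s (k s)) \<le> \<Lambda> * \<bar>t - t'\<bar> * norm (k s)"
        using order_trans[OF norm_blinfun mult_right_mono[OF _ norm_ge_zero]] by blast
    qed (use t \<Lambda>_pos in auto)
    have "norm (duhamel k t' - duhamel k t)
        \<le> (LINT s|leb 0 b. \<Lambda> * \<bar>t - t'\<bar> * norm (k s)) + (LINT s|leb 0 b. \<Lambda> * \<bar>t - t'\<bar> * norm (k s))"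
      unfolding eq by (rule norm_triangle_mono[OF 1 2])
    also have "\<dots> = 2 * \<Lambda> * (LINT s|leb 0 b. norm (k s)) * \<bar>t - t'\<bar>" by simp
    finally show ?thesis .
  qed
  show ?thesis
  proof (cases "t \<le> t'")
    case True
    then show ?thesis using main[OF t] by (simp add: norm_minus_commute)
  next
    case False
    then show ?thesis using main[OF t(2,1)] by (simp add: abs_minus_commute)
  qed
qed

lemma duhamel_continuous:
  assumes k: "k \<in> L1_on {0..b}" shows "continuous_on {0..b} (duhamel k)"
proof (rule lipschitz_on_continuous_on, rule lipschitz_onI)
  show "dist (duhamel k t) (duhamel k t') \<le> (2 * \<Lambda> * (LINT s|leb 0 b. norm (k s))) * dist t t'"
    if "t \<in> {0..b}" "t' \<in> {0..b}" for t t'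
    using duhamel_Lipschitz[OF k that] by (simp add: dist_norm)
qed (use \<Lambda>_pos in simp)

end

section \<open>Existence of a controlled mild solution\<close>

theorem theorem8:
  fixes b a N \<gamma> :: real
    and D :: "'x::{real_inner,complete_space} set"
    and A :: "'x \<Rightarrow> 'x"
    and C0 :: "real \<Rightarrow> 'x \<Rightarrow>\<^sub>L 'x"
    and Bt :: "real \<Rightarrow> 'x \<Rightarrow> 'x"
    and S :: "real \<Rightarrow> real \<Rightarrow> 'x \<Rightarrow>\<^sub>L 'x"
    and B :: "'u::{real_inner,complete_space} \<Rightarrow>\<^sub>L 'x"
    and F :: "real \<Rightarrow> 'x \<Rightarrow> 'x set"
    and L :: "real \<Rightarrow> real \<Rightarrow> real"
    and x0 y0 xb :: 'x
  assumes b_pos: "b > 0"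
    and evolution: "second_order_evolution_system b D A C0 Bt S"
    and N_pos: "N > 0"
    and S_bound: "\<forall>t\<in>{0..b}. \<forall>s\<in>{0..b}. norm (S t s) \<le> N"
    and multimap: "admissible_multimap b F"
    and resolvent_limit:
      "\<forall>z. ((\<lambda>\<alpha>. \<alpha> *\<^sub>R resolvent_op \<alpha> (gramian b S B) z) \<longlongrightarrow> 0) (at_right 0)"
    and sine_compact: "\<forall>t>0. compact_op (sine_family C0 t)"
    and L_integrable: "\<forall>r>0. integrable (lebesgue_on {0..b}) (L r) \<and> (\<forall>t\<in>{0..b}. L r t \<ge> 0)"
    and growth: "\<forall>r>0. \<forall>x. continuous_on {0..b} x \<and> (SUP t\<in>{0..b}. norm (x t)) \<le> r \<longrightarrow>
      (AE t in lebesgue_on {0..b}. (SUP f\<in>F t (x t). norm f) \<le> L r t)"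
    and gamma_pos: "\<gamma> > 0"
    and L_limit: "((\<lambda>r. (1 / r) * (LINT s|lebesgue_on {0..b}. L r s)) \<longlongrightarrow> \<gamma>) at_top"
    and a_pos: "a > 0"
    and smallness: "N * \<gamma> * (1 + (1 / a) * N\<^sup>2 * (norm B)\<^sup>2 * b) < 1"
  shows "\<exists>x f. continuous_on {0..b} x \<and> f \<in> selections b F x \<and>
    (\<forall>t\<in>{0..b}. x t = evolution_C b S t 0 x0 + S t 0 y0
       + integral {0..t} (\<lambda>s. S t s (f s))
       + integral {0..t} (\<lambda>s. S t s (B (steering_control b S B x0 y0 xb a f s))))"
proof -
  have gen: "generates_cosine_family D A C0" and adm: "admissible_perturbation A C0 Bt"
    and dense: "closure D = UNIV" and ass: "associated_evolution_operator b A C0 Bt S" and Z1: "evolution_Z1 b S"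
    using evolution unfolding second_order_evolution_system_def by blast+
  interpret cos: strongly_continuous_cosine_family C0
    using gen unfolding generates_cosine_family_def by unfold_locales blast
  obtain M where M: "M > 0" "\<And>h s t y. 0 < h \<Longrightarrow> h \<le> 1 \<Longrightarrow> 0 \<le> s \<Longrightarrow> s \<le> t \<Longrightarrow> t \<le> b \<Longrightarrow>
      norm (S t s y - (1/h) *\<^sub>R sine_family C0 h (S t s y)) \<le> h * M * norm y"
    using cos.evolution_approximation[OF b_pos gen adm ass dense] by metis
  obtain \<Lambda> where \<Lambda>: "\<Lambda> > 0"
    "\<And>t t' s. t \<in> {0..b} \<Longrightarrow> t' \<in> {0..b} \<Longrightarrow> s \<in> {0..b} \<Longrightarrow> norm (S t s - S t' s) \<le> \<Lambda> * \<bar>t - t'\<bar>"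
    "\<And>t s s'. t \<in> {0..b} \<Longrightarrow> s \<in> {0..b} \<Longrightarrow> s' \<in> {0..b} \<Longrightarrow> norm (S t s - S t s') \<le> \<Lambda> * \<bar>s - s'\<bar>"
    using evolution_Lipschitz[OF Z1] by metis
  interpret Lipschitz_evolution b \<Lambda> N S
  proof
    show "S t t = 0" if "t \<in> {0..b}" for t
      using Z1 that unfolding evolution_Z1_def by (intro blinfun_eqI) auto
  qed (use b_pos \<Lambda> N_pos S_bound in auto)
  have b_in: "b \<in> {0..b}" using b_pos by simp

  \<comment> \<open>the control enters through the vector \<open>p f\<close>, on which the source term \<open>ctrl f\<close> depends linearly\<close>
  define R where "R = resolvent_op a (gramian b S B)"
  define p0 where "p0 = xb - evolution_C b S b 0 x0 - S b 0 y0"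
  define p where "p f = p0 - duhamel f b" for f
  define V where "V s = B o\<^sub>L adj B o\<^sub>L adj (S b s)" for s
  define ctrl where "ctrl f s = V s (R (p f))" for f s
  define g where "g t = evolution_C b S t 0 x0 + S t 0 y0" for t
  define \<Phi> where "\<Phi> f t = g t + duhamel f t + duhamel (ctrl f) t" for f t
  have ctrl_eq: "ctrl f s = B (steering_control b S B x0 y0 xb a f s)" for f s
    by (simp add: ctrl_def V_def p_def p0_def R_def steering_control_def duhamel_def)
  have R_le: "norm (R w) \<le> norm w / a" for w unfolding R_def by (rule norm_resolvent_gramian_le[OF a_pos])
  have V_cont: "continuous_on {0..b} V"
    unfolding V_def by (intro continuous_intros continuous_adj b_in)
  have V_le: "norm (V s w) \<le> (norm B)\<^sup>2 * N * norm w" if s: "s \<in> {0..b}" for s w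
  proof -
    have "norm (V s w) \<le> norm B * norm (adj B (adj (S b s) w))" by (simp add: V_def norm_blinfun)
    also have "\<dots> \<le> norm B * (norm B * norm (adj (S b s) w))"
      by (intro mult_left_mono order_trans[OF norm_blinfun mult_right_mono[OF norm_adj_le]]) auto
    also have "\<dots> \<le> norm B * (norm B * (N * norm w))"
      by (intro mult_left_mono order_trans[OF norm_blinfun mult_right_mono[OF order_trans[OF norm_adj_le bound]]])
        (use b_in s in auto)
    finally show ?thesis by (simp add: power2_eq_square mult_ac)
  qed
  define \<kappa> where "\<kappa> = b * ((norm B)\<^sup>2 * N / a)"
  have \<kappa>: "0 \<le> \<kappa>" using b_pos N_pos a_pos by (simp add: \<kappa>_def)
  have VR_cont: "continuous_on {0..b} (\<lambda>s. V s (R w))" for w by (intro continuous_intros V_cont)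
  have VR_L1: "(\<lambda>s. V s (R w)) \<in> L1_on {0..b}" for w by (rule L1_continuous[OF VR_cont])
  have VR_le: "(LINT s|leb 0 b. norm (V s (R w))) \<le> \<kappa> * norm w" for w
  proof -
    have "(LINT s|leb 0 b. norm (V s (R w))) \<le> (LINT s|leb 0 b. (norm B)\<^sup>2 * N * (norm w / a))"
    proof (rule integral_mono[OF L1_on_norm_integrable[OF VR_L1]])
      fix s assume "s \<in> space (leb 0 b)"
      then have "norm (V s (R w)) \<le> (norm B)\<^sup>2 * N * norm (R w)" by (intro V_le) simp
      also have "\<dots> \<le> (norm B)\<^sup>2 * N * (norm w / a)" using R_le N_pos by (intro mult_left_mono) auto
      finally show "norm (V s (R w)) \<le> (norm B)\<^sup>2 * N * (norm w / a)" .
    qed simp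
    also have "\<dots> = \<kappa> * norm w" by (subst LINT_const) (use b_pos in \<open>auto simp: \<kappa>_def\<close>)
    finally show ?thesis .
  qed
  have ctrl_L1: "ctrl f \<in> L1_on {0..b}" for f unfolding ctrl_def[abs_def] by (rule VR_L1)
  have g_cont: "continuous_on {0..b} g"
  proof -
    have "C1_square b (\<lambda>t s. S t s x0)" using Z1 unfolding evolution_Z1_def by blast
    then have "continuous_on ({0..b} \<times> {0..b}) (\<lambda>(t, s). D_snd b (\<lambda>t s. S t s x0) t s)"
      unfolding C1_square_def by blast
    then have "continuous_on {0..b} (\<lambda>t. (\<lambda>(t, s). D_snd b (\<lambda>t s. S t s x0) t s) (t, 0))"
      by (rule continuous_on_compose2) (use b_pos in \<open>auto intro!: continuous_intros\<close>)
    then have 1: "continuous_on {0..b} (\<lambda>t. evolution_C b S t 0 x0)"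
      unfolding evolution_C_def by (intro continuous_on_minus) simp
    have "continuous_on {0..b} (\<lambda>t. S t 0)"
    proof (rule lipschitz_on_continuous_on[of \<Lambda>], rule lipschitz_onI)
      show "dist (S t 0) (S t' 0) \<le> \<Lambda> * dist t t'" if "t \<in> {0..b}" "t' \<in> {0..b}" for t t'
        using Lip_fst[OF that, of 0] b_pos by (simp add: dist_norm)
    qed (use \<Lambda>(1) in simp)
    then show ?thesis unfolding g_def by (intro continuous_intros 1)
  qed
  obtain G where G: "\<And>t. t \<in> {0..b} \<Longrightarrow> norm (g t) \<le> G"
  proof -
    have "compact (g ` {0..b})" by (rule compact_continuous_image[OF g_cont]) simp
    then have "bounded (g ` {0..b})" by (rule compact_imp_bounded)
    then obtain G where "\<forall>x\<in>g ` {0..b}. norm x \<le> G" unfolding bounded_iff by blast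
    then show thesis by (intro that[of G]) blast
  qed

  define q where "q = N * (1 + \<kappa> * N)"
  have q_eq: "q = N * (1 + (1 / a) * N\<^sup>2 * (norm B)\<^sup>2 * b)"
    by (simp add: q_def \<kappa>_def power2_eq_square mult_ac)
  have q: "0 \<le> q" using N_pos \<kappa> by (simp add: q_def)
  define G' where "G' = G + N * \<kappa> * norm p0"
  have \<Phi>_le: "norm (\<Phi> f t) \<le> G' + q * (LINT s|leb 0 b. norm (f s))" if f: "f \<in> L1_on {0..b}" and t: "t \<in> {0..b}" for f t
  proof -
    let ?i = "LINT s|leb 0 b. norm (f s)"
    have "norm (p f) \<le> norm p0 + N * ?i"
      unfolding p_def using norm_triangle_ineq4[of p0 "duhamel f b"] norm_duhamel_le[OF f b_in] by linarith
    then have "(LINT s|leb 0 b. norm (ctrl f s)) \<le> \<kappa> * (norm p0 + N * ?i)"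
      unfolding ctrl_def using VR_le[of "p f"] mult_left_mono[OF _ \<kappa>] by (meson order_trans)
    then have "N * (LINT s|leb 0 b. norm (ctrl f s)) \<le> N * (\<kappa> * (norm p0 + N * ?i))"
      using N_pos by (intro mult_left_mono) auto
    then have "norm (duhamel (ctrl f) t) \<le> N * (\<kappa> * (norm p0 + N * ?i))"
      using norm_duhamel_le[OF ctrl_L1 t] order_trans by blast
    moreover have "norm (\<Phi> f t) \<le> norm (g t) + norm (duhamel f t) + norm (duhamel (ctrl f) t)"
      unfolding \<Phi>_def by (rule order_trans[OF norm_triangle_ineq add_right_mono[OF norm_triangle_ineq]])
    ultimately have "norm (\<Phi> f t) \<le> G + N * ?i + N * (\<kappa> * (norm p0 + N * ?i))"
      using G[OF t] norm_duhamel_le[OF f t] by linarith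
    also have "\<dots> = G' + q * ?i" by (simp add: G'_def q_def algebra_simps)
    finally show ?thesis .
  qed

  \<comment> \<open>the smallness condition makes a large ball invariant\<close>
  obtain r where r: "r > 0" "G' + q * (LINT s|leb 0 b. L r s) \<le> r"
  proof -
    have "((\<lambda>r. G' * (1 / r) + q * ((1 / r) * (LINT s|leb 0 b. L r s))) \<longlongrightarrow> G' * 0 + q * \<gamma>) at_top"
      by (intro tendsto_intros L_limit) (auto intro!: tendsto_divide_0[OF tendsto_const] filterlim_at_top_imp_at_infinity filterlim_ident)
    moreover have "G' * 0 + q * \<gamma> < 1" using smallness by (simp add: q_eq mult_ac)
    ultimately have "\<forall>\<^sub>F r in at_top. G' * (1 / r) + q * ((1 / r) * (LINT s|leb 0 b. L r s)) < 1"
      by (rule order_tendstoD)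
    then have "\<forall>\<^sub>F r in at_top. G' * (1 / r) + q * ((1 / r) * (LINT s|leb 0 b. L r s)) < 1 \<and> r > (0::real)"
      by (intro eventually_conj eventually_gt_at_top)
    then obtain r :: real where r: "G' * (1 / r) + q * ((1 / r) * (LINT s|leb 0 b. L r s)) < 1" "r > 0"
      by (auto simp: eventually_at_top_linorder)
    have "G' + q * (LINT s|leb 0 b. L r s) = r * (G' * (1 / r) + q * ((1 / r) * (LINT s|leb 0 b. L r s)))"
      using r(2) by (simp add: field_simps)
    also have "\<dots> \<le> r * 1" using r by (intro mult_left_mono) auto
    finally show thesis using r(2) by (intro that) auto
  qed
  define l where "l = L r"
  have l: "integrable (leb 0 b) l" "\<And>t. t \<in> {0..b} \<Longrightarrow> 0 \<le> l t" using L_integrable r(1) by (auto simp: l_def)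
  define Q :: "(real \<Rightarrow> 'x) set" where "Q = {f \<in> L1_on {0..b}. AE t in leb 0 b. norm (f t) \<le> l t}"
  have QL: "f \<in> L1_on {0..b}" if "f \<in> Q" for f using that by (simp add: Q_def)
  have Q_int: "(LINT s|leb 0 b. norm (f s)) \<le> (LINT s|leb 0 b. l s)" if "f \<in> Q" for f
    using that l(1) by (intro integral_mono_AE L1_on_norm_integrable) (auto simp: Q_def)
  have \<Phi>_cont: "continuous_on {0..b} (\<Phi> f)" if "f \<in> Q" for f
    unfolding \<Phi>_def[abs_def] by (intro continuous_intros g_cont duhamel_continuous QL that ctrl_L1)
  obtain f where "f \<in> Q" and f: "f \<in> selections b F (\<Phi> f)"
  proof (rule integral_inclusion_solvable[OF b_pos multimap l, folded Q_def, of \<Phi> q])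
    show "continuous_on {0..b} (\<Phi> f)" if "f \<in> Q" for f by (rule \<Phi>_cont[OF that])
    show "\<Phi> (\<lambda>s. \<Sum>j\<in>J. c j *\<^sub>R f j s) t = (\<Sum>j\<in>J. c j *\<^sub>R \<Phi> (f j) t)"
      if J: "finite J" "sum c J = 1" and fQ: "\<And>j. j \<in> J \<Longrightarrow> f j \<in> Q" and t: "t \<in> {0..b}" for J :: "nat set" and c f t
    proof -
      have const: "(\<Sum>j\<in>J. c j *\<^sub>R v) = v" for v :: 'x using J(2) by (simp flip: scaleR_left.sum)
      have duhamel_f: "duhamel (\<lambda>s. \<Sum>j\<in>J. c j *\<^sub>R f j s) u = (\<Sum>j\<in>J. c j *\<^sub>R duhamel (f j) u)"
        if "u \<in> {0..b}" for u
        by (rule duhamel_sum[OF J(1) QL[OF fQ] that])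
      have "p (\<lambda>s. \<Sum>j\<in>J. c j *\<^sub>R f j s) = (\<Sum>j\<in>J. c j *\<^sub>R p (f j))"
        unfolding p_def duhamel_f[OF b_in] by (simp add: scaleR_diff_right sum_subtractf const)
      then have "ctrl (\<lambda>s. \<Sum>j\<in>J. c j *\<^sub>R f j s) = (\<lambda>s. \<Sum>j\<in>J. c j *\<^sub>R ctrl (f j) s)"
        by (intro ext) (simp add: ctrl_def blinfun.sum_right blinfun.scaleR_right)
      then have "duhamel (ctrl (\<lambda>s. \<Sum>j\<in>J. c j *\<^sub>R f j s)) t = (\<Sum>j\<in>J. c j *\<^sub>R duhamel (ctrl (f j)) t)"
        using duhamel_sum[OF J(1) ctrl_L1 t] by simp
      then show ?thesis
        unfolding \<Phi>_def duhamel_f[OF t] by (simp add: scaleR_add_right sum.distrib const)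
    qed
    show "norm (\<Phi> f t - \<Phi> h t) \<le> q * (LINT s|leb 0 b. norm (f s - h s))"
      if fh: "f \<in> Q" "h \<in> Q" and t: "t \<in> {0..b}" for f h t
    proof -
      let ?i = "LINT s|leb 0 b. norm (f s - h s)"
      note fhL = L1_on_diff[OF QL[OF fh(1)] QL[OF fh(2)]]
      define w where "w = p f - p h"
      have "w = - duhamel (\<lambda>s. f s - h s) b"
        by (simp add: w_def p_def duhamel_diff[OF QL[OF fh(1)] QL[OF fh(2)] b_in])
      then have w: "norm w \<le> N * ?i" using norm_duhamel_le[OF fhL b_in] by simp
      have "(\<lambda>s. ctrl f s - ctrl h s) = (\<lambda>s. V s (R w))"
        by (simp add: ctrl_def w_def blinfun.diff_right)
      then have "\<Phi> f t - \<Phi> h t = duhamel (\<lambda>s. f s - h s) t + duhamel (\<lambda>s. V s (R w)) t"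
        using duhamel_diff[OF ctrl_L1 ctrl_L1 t, of f h] duhamel_diff[OF QL[OF fh(1)] QL[OF fh(2)] t]
        by (simp add: \<Phi>_def)
      also have "norm \<dots> \<le> N * ?i + N * (LINT s|leb 0 b. norm (V s (R w)))"
        by (rule norm_triangle_mono[OF norm_duhamel_le[OF fhL t] norm_duhamel_le[OF VR_L1 t]])
      also have "\<dots> \<le> N * ?i + N * (\<kappa> * (N * ?i))"
        using VR_le[of w] mult_left_mono[OF w \<kappa>] N_pos by (intro add_left_mono mult_left_mono) auto
      also have "\<dots> = q * ?i" by (simp add: q_def algebra_simps)
      finally show ?thesis .
    qed
    show "\<exists>P\<subseteq>Q. finite P \<and> (\<forall>f\<in>Q. \<exists>h\<in>P. \<forall>t\<in>{0..b}. dist (\<Phi> f t) (\<Phi> h t) < e)" if e: "e > 0" for e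
    proof -
      define I0 where "I0 = (LINT s|leb 0 b. l s)"
      define k where "k f s = f s + ctrl f s" for f s
      define K0 where "K0 = I0 + \<kappa> * (norm p0 + N * I0)"
      have kL: "k f \<in> L1_on {0..b}" if "f \<in> Q" for f
        using QL[OF that] ctrl_L1[of f] unfolding k_def[abs_def] L1_on_iff_approximable by (rule L1_approximable_add)
      have k_int: "(LINT s|leb 0 b. norm (k f s)) \<le> K0" if f: "f \<in> Q" for f
      proof -
        note ints = L1_on_norm_integrable[OF QL[OF f]] L1_on_norm_integrable[OF ctrl_L1, of f]
        have "(LINT s|leb 0 b. norm (k f s)) \<le> (LINT s|leb 0 b. norm (f s) + norm (ctrl f s))"
          by (rule integral_mono[OF L1_on_norm_integrable[OF kL[OF f]] Bochner_Integration.integrable_add[OF ints]])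
            (simp add: k_def norm_triangle_ineq)
        also have "\<dots> = (LINT s|leb 0 b. norm (f s)) + (LINT s|leb 0 b. norm (ctrl f s))"
          by (rule Bochner_Integration.integral_add[OF ints])
        also have "\<dots> \<le> I0 + \<kappa> * (norm p0 + N * I0)"
        proof (rule add_mono)
          show "(LINT s|leb 0 b. norm (f s)) \<le> I0" unfolding I0_def by (rule Q_int[OF f])
          have "norm (p f) \<le> norm p0 + N * (LINT s|leb 0 b. norm (f s))"
            unfolding p_def using norm_triangle_ineq4[of p0 "duhamel f b"] norm_duhamel_le[OF QL[OF f] b_in] by linarith
          also have "\<dots> \<le> norm p0 + N * I0"
            unfolding I0_def using Q_int[OF f] N_pos by (intro add_left_mono mult_left_mono) auto
          finally have "\<kappa> * norm (p f) \<le> \<kappa> * (norm p0 + N * I0)" using \<kappa> by (rule mult_left_mono)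
          then show "(LINT s|leb 0 b. norm (ctrl f s)) \<le> \<kappa> * (norm p0 + N * I0)"
            unfolding ctrl_def using VR_le[of "p f"] by (rule order_trans[rotated])
        qed
        finally show ?thesis by (simp add: K0_def)
      qed
      have diff: "\<Phi> f t - \<Phi> h t = duhamel (k f) t - duhamel (k h) t" if "f \<in> Q" "h \<in> Q" "t \<in> {0..b}" for f h t
        using that by (simp add: \<Phi>_def k_def[abs_def] duhamel_add QL ctrl_L1)
      have K0: "0 \<le> K0"
      proof -
        have "0 \<le> I0" unfolding I0_def using l by (intro Bochner_Integration.integral_nonneg) auto
        then show ?thesis using \<kappa> N_pos by (simp add: K0_def)
      qed
      have sine: "duhamel (k f) t \<in> cos.approximated_by_sine ((N + M) * K0)" if f: "f \<in> Q" and t: "t \<in> {0..b}" for f t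
        unfolding cos.approximated_by_sine_def
      proof (intro CollectI conjI allI impI)
        have "norm (duhamel (k f) t) \<le> N * (LINT s|leb 0 b. norm (k f s))" by (rule norm_duhamel_le[OF kL[OF f] t])
        also have "\<dots> \<le> (N + M) * K0"
          using k_int[OF f] N_pos M(1) K0 by (intro mult_mono) auto
        finally show "norm (duhamel (k f) t) \<le> (N + M) * K0" .
        fix h :: real assume h: "0 < h \<and> h \<le> 1"
        define T where "T = id_blinfun - (1/h) *\<^sub>R Blinfun (sine_family C0 h)"
        have T: "T v = v - (1/h) *\<^sub>R sine_family C0 h v" for v
          by (simp add: T_def blinfun.diff_left blinfun.scaleR_left bounded_linear_Blinfun_apply[OF cos.bounded_linear_S0])
        have "norm (T (duhamel (k f) t)) \<le> (h * M) * (LINT s|leb 0 b. norm (k f s))"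
          by (rule norm_blinfun_duhamel_le[OF kL[OF f] t]) (use h t M in \<open>auto simp: T\<close>)
        also have "\<dots> \<le> (h * M) * K0" using h M(1) k_int[OF f] by (intro mult_left_mono) auto
        also have "\<dots> \<le> h * ((N + M) * K0)"
          using h N_pos K0 by (simp add: mult.assoc mult_left_mono mult_right_mono)
        finally show "norm (duhamel (k f) t - (1/h) *\<^sub>R sine_family C0 h (duhamel (k f) t)) \<le> h * ((N + M) * K0)"
          by (simp add: T)
      qed
      obtain P where P: "P \<subseteq> Q" "finite P"
        "\<And>f. f \<in> Q \<Longrightarrow> \<exists>h\<in>P. \<forall>t\<in>{0..b}. dist (duhamel (k f) t) (duhamel (k h) t) < e"
      proof (rule Lipschitz_family_totally_bounded[OF b_pos, of Q "\<lambda>f. duhamel (k f)" "2 * \<Lambda> * K0" e])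
        show "dist (duhamel (k f) s) (duhamel (k f) t) \<le> 2 * \<Lambda> * K0 * \<bar>s - t\<bar>"
          if f: "f \<in> Q" and st: "s \<in> {0..b}" "t \<in> {0..b}" for f s t
        proof -
          have "dist (duhamel (k f) s) (duhamel (k f) t) \<le> 2 * \<Lambda> * (LINT s|leb 0 b. norm (k f s)) * \<bar>s - t\<bar>"
            using duhamel_Lipschitz[OF kL[OF f] st] by (simp add: dist_norm)
          also have "\<dots> \<le> 2 * \<Lambda> * K0 * \<bar>s - t\<bar>"
            using k_int[OF f] \<Lambda>(1) by (intro mult_right_mono mult_left_mono) auto
          finally show ?thesis .
        qed
        show "\<exists>Z. finite Z \<and> (\<forall>f\<in>Q. \<forall>t\<in>{0..b}. \<exists>z\<in>Z. dist z (duhamel (k f) t) < e)" if "e > 0" for e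
          using cos.approximated_by_sine_totally_bounded[OF sine_compact that, of "(N + M) * K0"] sine by meson
      qed (use e in auto)
      have "\<exists>h\<in>P. \<forall>t\<in>{0..b}. dist (\<Phi> f t) (\<Phi> h t) < e" if f: "f \<in> Q" for f
      proof -
        obtain h where h: "h \<in> P" "\<forall>t\<in>{0..b}. dist (duhamel (k f) t) (duhamel (k h) t) < e" using P(3)[OF f] by blast
        have "h \<in> Q" using h(1) P(1) by blast
        then have "\<forall>t\<in>{0..b}. dist (\<Phi> f t) (\<Phi> h t) < e"
          using h(2) diff[OF f] by (simp add: dist_norm)
        then show ?thesis using h(1) by blast
      qed
      then show ?thesis using P(1,2) by blast
    qed
    show "h \<in> Q" if f: "f \<in> Q" and h: "h \<in> selections b F (\<Phi> f)" for f h
    proof -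
      have "norm (\<Phi> f t) \<le> r" if "t \<in> {0..b}" for t
      proof -
        have "norm (\<Phi> f t) \<le> G' + q * (LINT s|leb 0 b. norm (f s))" by (rule \<Phi>_le[OF QL[OF f] that])
        also have "\<dots> \<le> G' + q * (LINT s|leb 0 b. L r s)"
          using Q_int[OF f] q by (intro add_left_mono mult_left_mono) (auto simp: l_def)
        finally show ?thesis using r(2) by linarith
      qed
      then have "(SUP t\<in>{0..b}. norm (\<Phi> f t)) \<le> r" using b_pos by (intro cSUP_least) auto
      then have "AE t in leb 0 b. (SUP f\<in>F t (\<Phi> f t). norm f) \<le> l t"
        using growth r(1) \<Phi>_cont[OF f] unfolding l_def by blast
      then have "AE t in leb 0 b. norm (h t) \<le> l t"
        using AE_space
      proof eventually_elim
        case (elim t)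
        then have t: "t \<in> {0..b}" by simp
        have "bounded (F t (\<Phi> f t))" using multimap t unfolding admissible_multimap_def by blast
        then have "bdd_above (norm ` F t (\<Phi> f t))" by (simp add: bdd_above_norm)
        moreover have "h t \<in> F t (\<Phi> f t)" using h t by (simp add: selections_def)
        ultimately have "norm (h t) \<le> (SUP f\<in>F t (\<Phi> f t). norm f)" by (intro cSUP_upper)
        then show ?case using elim(1) by linarith
      qed
      then show ?thesis using h by (simp add: Q_def selections_def)
    qed
  qed
  show ?thesis
  proof (intro exI conjI ballI)
    show "continuous_on {0..b} (\<Phi> f)" by (rule \<Phi>_cont[OF \<open>f \<in> Q\<close>])
    show "f \<in> selections b F (\<Phi> f)" by (rule f)
    show "\<Phi> f t = evolution_C b S t 0 x0 + S t 0 y0 + integral {0..t} (\<lambda>s. S t s (f s))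
       + integral {0..t} (\<lambda>s. S t s (B (steering_control b S B x0 y0 xb a f s)))" for t
      by (simp add: \<Phi>_def g_def duhamel_def ctrl_eq)
  qed
qed

end
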